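(* Let $a,a'\in A$, $x\in a\,\mathcal W^{(+)}\subset\widetilde{\mathcal W}^{(+)}$ and $y\in a'\,\mathcal W^{(+)}$. Then $$\chi_x\,\chi_y=\sum_{z\in aa'\mathcal W^{(+)}}N^z_{x,y}\,\chi_z,$$ where $$N^z_{x,y}=\sum_{w'\in\overline W^{[z]}}\det(\overline{w'})\,m^x_{w'zy^{-1}}=\sum_{w\in\overline W}\det(w)\,m^x_{zwy^{-1}}=\sum_{w\in\overline W}\det(w)\,\bar m^{\iota(x)}_{\iota(zwy^{-1})}.$$
   Context: Setting: $sl(3)$ with simple roots $\alpha_1,\alpha_2$, $\theta=\alpha_1+\alpha_2$, $\langle\alpha_i,\alpha_i\rangle=2$, root lattice $Q$, weight lattice $P$, fundamental weights $\bar\Lambda_1,\bar\Lambda_2$, $\bar\rho=\bar\Lambda_1+\bar\Lambda_2$, dominant weights $P_+$. $\overline W$ is the finite Weyl group with simple reflections $w_1,w_2$, $\det(w)=\pm1$, shifted action $w\cdot\lambda=w(\lambda+\bar\rho)-\bar\rho$. The extended affine Weyl group is $\widetilde W=\overline W\ltimes t_P$ (with $w\,t_\beta w^{-1}=t_{w(\beta)}$), the affine Weyl group is $W=\overline W\ltimes t_Q$. Each $y\in\widetilde W$ is uniquely $y=\bar y\,t_{-\lambda}$, $\bar y\in\overline W$, $\lambda\in P$; $y\mapsto\bar y$ is the horizontal projection. Let $\gamma=t_{\bar\Lambda_1}w_1w_2$ and $A=\{1,\gamma,\gamma^2\}$ (a cyclic group of order 3); $\widetilde W=W\rtimes A$.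 $\iota:\widetilde W\to Q$, $\iota(\bar y\,t_{-\lambda})=3\lambda+\bar y^{-1}\cdot0$. $\widetilde{\mathcal W}^{(+)}=\{\bar y\,t_{-\lambda}\in\widetilde W:\lambda\in P_+,\ \langle\lambda,\alpha_i\rangle>0 \text{ whenever } \bar y(\alpha_i)\text{ is a negative root},\ i=1,2\}$ and $\mathcal W^{(+)}=\widetilde{\mathcal W}^{(+)}\cap W$. For $z\in\widetilde{\mathcal W}^{(+)}$ the Kac--Wakimoto group is $\overline W^{[z]}=z\,\overline W z^{-1}\subset W$. For $x\in\widetilde{\mathcal W}^{(+)}$ (so $\iota(x)\in P_+$) and $z\in\widetilde W$ put $m^x_z=\bar m^{\iota(x)}_{\iota(z)}$ if $z\in Wx$ and $m^x_z=0$ otherwise, where $\bar m^\lambda_\mu$ is the multiplicity of the weight $\mu$ in the irreducible $sl(3)$-module of highest weight $\lambda$; and $\chi_x=\sum_{z\in\widetilde W}m^x_z\,z\in\mathbb Z[\widetilde W]$ (a finite sum). *)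

theory Defs
  imports "HOL-Analysis.Analysis" "HOL-Library.Poly_Mapping"
begin

section \<open>Weights and the finite Weyl group of sl(3)\<close>

text \<open>The pair \<open>(a, b)\<close> is the weight \<open>a \<Lambda>\<^sub>1 + b \<Lambda>\<^sub>2\<close>, so its components are the
  pairings with the two simple roots, and the type is the weight lattice \<open>P\<close>.\<close>

type_synonym weight = "int \<times> int"

definition pairing :: "weight \<Rightarrow> nat \<Rightarrow> int" where
  "pairing \<nu> i = (if i = 1 then fst \<nu> else snd \<nu>)"

text \<open>The simple roots are the rows of the Cartan matrix.\<close>

definition simple_root :: "nat \<Rightarrow> weight" where
  "simple_root i = (if i = 1 then (2, -1) else (-1, 2))"

definition wscale :: "int \<Rightarrow> weight \<Rightarrow> weight" where
  "wscale k \<nu> = (k * fst \<nu>, k * snd \<nu>)"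

definition root_lattice :: "weight set" where
  "root_lattice = {wscale m (simple_root 1) + wscale n (simple_root 2) | m n. True}"

definition dominant :: "weight set" where
  "dominant = {\<nu>. \<forall>i\<in>{1,2}. pairing \<nu> i \<ge> 0}"

definition rho :: weight where
  "rho = (1, 1)"

definition negative_roots :: "weight set" where
  "negative_roots = {- simple_root 1, - simple_root 2, - (simple_root 1 + simple_root 2)}"

definition wrefl :: "nat \<Rightarrow> weight \<Rightarrow> weight" where
  "wrefl i \<nu> = \<nu> - wscale (pairing \<nu> i) (simple_root i)"

inductive_set fin_weyl :: "(weight \<Rightarrow> weight) set" where
  id: "id \<in> fin_weyl"
| step: "w \<in> fin_weyl \<Longrightarrow> i \<in> {1,2} \<Longrightarrow> wrefl i \<circ> w \<in> fin_weyl"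

text \<open>Determinant of the matrix of \<open>w\<close> in the basis of fundamental weights.\<close>

definition wdet :: "(weight \<Rightarrow> weight) \<Rightarrow> int" where
  "wdet w = fst (w (1, 0)) * snd (w (0, 1)) - fst (w (0, 1)) * snd (w (1, 0))"

definition shifted :: "(weight \<Rightarrow> weight) \<Rightarrow> weight \<Rightarrow> weight" where
  "shifted w \<nu> = w (\<nu> + rho) - rho"

lemma refl_simps:
  "wrefl (Suc 0) (a, b) = (- a, a + b)"
  "wrefl 2 (a, b) = (a + b, - b)"
  by (simp_all add: wrefl_def wscale_def pairing_def simple_root_def)

lemma refl_comp_refl: "i \<in> {1,2} \<Longrightarrow> wrefl i \<circ> wrefl i = id"
  by (auto simp: fun_eq_iff refl_simps)

lemma fin_weyl_comp: "u \<in> fin_weyl \<Longrightarrow> v \<in> fin_weyl \<Longrightarrow> u \<circ> v \<in> fin_weyl"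
  by (induction rule: fin_weyl.induct) (auto simp: comp_assoc intro: fin_weyl.step)

lemma refl_in_fin_weyl: "i \<in> {1,2} \<Longrightarrow> wrefl i \<in> fin_weyl"
  using fin_weyl.step[OF fin_weyl.id] by simp

lemma fin_weyl_add: "w \<in> fin_weyl \<Longrightarrow> w (\<nu> + \<mu>) = w \<nu> + w \<mu>"
  by (induction rule: fin_weyl.induct)
     (auto simp: wrefl_def wscale_def pairing_def simple_root_def algebra_simps prod_eq_iff)

lemma fin_weyl_bij_inv: "w \<in> fin_weyl \<Longrightarrow> bij w \<and> inv w \<in> fin_weyl"
proof (induction rule: fin_weyl.induct)
  case id
  then show ?case using fin_weyl.id by (simp flip: id_def)
next
  case (step w i)
  have b: "bij (wrefl i)"
    using refl_comp_refl[OF step(2)] o_bij by blast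
  have "inv (wrefl i) = wrefl i"
    using refl_comp_refl[OF step(2)] inv_unique_comp by blast
  then have "inv (wrefl i \<circ> w) = inv w \<circ> wrefl i"
    using o_inv_distrib[OF b, of w] step.IH by auto
  then show ?case
    using b step.IH step.hyps(2) by (metis bij_comp fin_weyl_comp refl_in_fin_weyl)
qed

lemma fin_weyl_inv_add: "w \<in> fin_weyl \<Longrightarrow> inv w (\<nu> + \<mu>) = inv w \<nu> + inv w \<mu>"
  by (rule fin_weyl_add) (simp add: fin_weyl_bij_inv)

lemma fin_weyl_zero: "w \<in> fin_weyl \<Longrightarrow> w 0 = 0"
  using fin_weyl_add[of w 0 0] by simp

lemma fin_weyl_minus: "w \<in> fin_weyl \<Longrightarrow> w (- \<nu>) = - w \<nu>"
  using fin_weyl_add[of w \<nu> "- \<nu>"] fin_weyl_zero[of w]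
  by (metis add.right_inverse eq_neg_iff_add_eq_0 add.commute)


section \<open>The extended affine Weyl group\<close>

text \<open>The pair \<open>(w, \<beta>)\<close> stands for \<open>w t\<^sub>\<beta>\<close>.  The product
  \<open>(w t\<^sub>\<beta>) (w' t\<^sub>\<beta>\<^sub>') = w w' t\<^bsub>w'\<^sup>-\<^sup>1(\<beta>) + \<beta>'\<^esub>\<close> is written \<^emph>\<open>additively\<close>: the class of
  not necessarily commutative groups is \<^class>\<open>group_add\<close>, and the convolution product of
  \<^theory>\<open>HOL-Library.Poly_Mapping\<close> turns \<open>ext_weyl \<Rightarrow>\<^sub>0 int\<close> into the integral group ring of
  such a group.  So \<open>u + v\<close>, \<open>u - v\<close>, \<open>0\<close> mean \<open>u v\<close>, \<open>u v\<^sup>-\<^sup>1\<close>, \<open>1\<close>.\<close>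

typedef ext_weyl = "fin_weyl \<times> (UNIV :: weight set)"
  using fin_weyl.id by auto

setup_lifting type_definition_ext_weyl

instantiation ext_weyl :: group_add
begin

lift_definition zero_ext_weyl :: ext_weyl is "(id, 0)"
  by (simp add: fin_weyl.id)

lift_definition plus_ext_weyl :: "ext_weyl \<Rightarrow> ext_weyl \<Rightarrow> ext_weyl" is
  "\<lambda>(w, \<beta>) (w', \<beta>'). (w \<circ> w', inv w' \<beta> + \<beta>')"
  by (auto intro: fin_weyl_comp)

lift_definition uminus_ext_weyl :: "ext_weyl \<Rightarrow> ext_weyl" is
  "\<lambda>(w, \<beta>). (inv w, - w \<beta>)"
  by (auto simp: fin_weyl_bij_inv)

definition minus_ext_weyl :: "ext_weyl \<Rightarrow> ext_weyl \<Rightarrow> ext_weyl" where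
  "u - v = u + - (v :: ext_weyl)"

instance
proof
  fix a b c :: ext_weyl
  show "a + b + c = a + (b + c)"
    by transfer (auto simp: fin_weyl_bij_inv fin_weyl_inv_add o_inv_distrib comp_assoc add.assoc)
  show "0 + a = a"
  proof transfer
    fix a :: "(weight \<Rightarrow> weight) \<times> weight"
    assume "a \<in> fin_weyl \<times> UNIV"
    then obtain w \<beta> where a: "a = (w, \<beta>)" "inv w \<in> fin_weyl"
      by (auto dest: fin_weyl_bij_inv)
    show "(case (id, 0) of (w, \<beta>) \<Rightarrow> \<lambda>(w', \<beta>'). (w \<circ> w', inv w' \<beta> + \<beta>')) a = a"
      using fin_weyl_zero[OF a(2)] by (simp add: a(1))
  qed
  show "a + 0 = a"
    by transfer (auto simp: inv_id)
  show "- a + a = 0"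
  proof transfer
    fix a :: "(weight \<Rightarrow> weight) \<times> weight"
    assume "a \<in> fin_weyl \<times> UNIV"
    then obtain w \<beta> where a: "a = (w, \<beta>)" "inv w \<in> fin_weyl" "inj w"
      using fin_weyl_bij_inv bij_is_inj by (metis SigmaE)
    have "inv w (- w \<beta>) = - \<beta>"
      using fin_weyl_minus[OF a(2)] a(3) by simp
    then show "(case (case a of (w, \<beta>) \<Rightarrow> (inv w, - w \<beta>)) of
        (w, \<beta>) \<Rightarrow> \<lambda>(w', \<beta>'). (w \<circ> w', inv w' \<beta> + \<beta>')) a = (id, 0)"
      using a(3) by (simp add: a(1))
  qed
  show "a + - b = a - b"
    by (simp add: minus_ext_weyl_def)
qed

end

text \<open>For \<open>y = w t\<^bsub>-\<nu>\<^esub>\<close>, \<open>hproj y\<close> is the horizontal projection \<open>w\<close> and \<open>shift y\<close> is \<open>\<nu>\<close>.\<close>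

lift_definition hproj :: "ext_weyl \<Rightarrow> (weight \<Rightarrow> weight)" is fst .

lift_definition shift :: "ext_weyl \<Rightarrow> weight" is "\<lambda>(w, \<beta>). - \<beta>" .

lift_definition transl :: "weight \<Rightarrow> ext_weyl" is "\<lambda>\<beta>. (id, \<beta>)"
  by (simp add: fin_weyl.id)

lift_definition srefl :: "nat \<Rightarrow> ext_weyl" is "\<lambda>i. (if i = 1 then wrefl 1 else wrefl 2, 0)"
  using refl_in_fin_weyl by auto

definition Wbar :: "ext_weyl set" where
  "Wbar = {y. shift y = 0}"

definition Waff :: "ext_weyl set" where
  "Waff = {y. shift y \<in> root_lattice}"

definition gamma :: ext_weyl where
  "gamma = transl (1, 0) + srefl 1 + srefl 2"

definition Agrp :: "ext_weyl set" where
  "Agrp = {0, gamma, gamma + gamma}"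

definition iota :: "ext_weyl \<Rightarrow> weight" where
  "iota y = wscale 3 (shift y) + shifted (inv (hproj y)) 0"

definition Wtilde_plus :: "ext_weyl set" where
  "Wtilde_plus = {y. shift y \<in> dominant \<and>
     (\<forall>i\<in>{1,2}. hproj y (simple_root i) \<in> negative_roots \<longrightarrow> pairing (shift y) i > 0)}"

definition Wplus :: "ext_weyl set" where
  "Wplus = Wtilde_plus \<inter> Waff"

definition Wplus_coset :: "ext_weyl \<Rightarrow> ext_weyl set" where
  "Wplus_coset a = {a + u | u. u \<in> Wplus}"

definition KW_group :: "ext_weyl \<Rightarrow> ext_weyl set" where
  "KW_group z = {z + w - z | w. w \<in> Wbar}"


section \<open>Weight multiplicities of irreducible sl(3)-modules\<close>

definition sl3 :: "(complex^3^3) set" where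
  "sl3 = {A. trace A = 0}"

definition bracket :: "complex^3^3 \<Rightarrow> complex^3^3 \<Rightarrow> complex^3^3" where
  "bracket A B = A ** B - B ** A"

definition mscale :: "complex \<Rightarrow> complex^3^3 \<Rightarrow> complex^3^3" where
  "mscale c A = (\<chi> i j. c * A $ i $ j)"

definition unit_matrix :: "3 \<Rightarrow> 3 \<Rightarrow> complex^3^3" where
  "unit_matrix i j = (\<chi> k l. if k = i \<and> l = j then 1 else 0)"

definition cartan :: "(complex^3^3) set" where
  "cartan = {H \<in> sl3. \<forall>i j. i \<noteq> j \<longrightarrow> H $ i $ j = 0}"

text \<open>\<open>\<Lambda>\<^sub>1\<close> and \<open>\<Lambda>\<^sub>2\<close> send \<open>diag(h\<^sub>1, h\<^sub>2, h\<^sub>3)\<close> to \<open>h\<^sub>1\<close> and \<open>h\<^sub>1 + h\<^sub>2\<close>.\<close>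

definition weight_eval :: "weight \<Rightarrow> complex^3^3 \<Rightarrow> complex" where
  "weight_eval \<nu> H = of_int (fst \<nu>) * H $ 1 $ 1 + of_int (snd \<nu>) * (H $ 1 $ 1 + H $ 2 $ 2)"

text \<open>All modules are taken inside one complex vector space of countably infinite dimension.
  This loses nothing: an irreducible highest weight module has countable dimension.\<close>

type_synonym cvec = "nat \<Rightarrow>\<^sub>0 complex"

definition cscale :: "complex \<Rightarrow> cvec \<Rightarrow> cvec" where
  "cscale c v = Poly_Mapping.map ((*) c) v"

lemma lookup_cscale: "Poly_Mapping.lookup (cscale c v) k = c * Poly_Mapping.lookup v k"
  by (simp add: cscale_def Poly_Mapping.map.rep_eq when_def)

global_interpretation cvec: vector_space cscale
  by standard (auto intro!: poly_mapping_eqI simp: lookup_cscale lookup_add algebra_simps)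

type_synonym sl3_rep = "cvec set \<times> (complex^3^3 \<Rightarrow> cvec \<Rightarrow> cvec)"

definition is_sl3_module :: "sl3_rep \<Rightarrow> bool" where
  "is_sl3_module = (\<lambda>(V, act). cvec.subspace V \<and>
     (\<forall>A\<in>sl3. \<forall>v\<in>V. act A v \<in> V) \<and>
     (\<forall>A\<in>sl3. \<forall>u\<in>V. \<forall>v\<in>V. act A (u + v) = act A u + act A v) \<and>
     (\<forall>A\<in>sl3. \<forall>c. \<forall>v\<in>V. act A (cscale c v) = cscale c (act A v)) \<and>
     (\<forall>A\<in>sl3. \<forall>B\<in>sl3. \<forall>v\<in>V. act (A + B) v = act A v + act B v) \<and>
     (\<forall>A\<in>sl3. \<forall>c. \<forall>v\<in>V. act (mscale c A) v = cscale c (act A v)) \<and>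
     (\<forall>A\<in>sl3. \<forall>B\<in>sl3. \<forall>v\<in>V. act (bracket A B) v = act A (act B v) - act B (act A v)))"

definition is_irreducible :: "sl3_rep \<Rightarrow> bool" where
  "is_irreducible = (\<lambda>(V, act). is_sl3_module (V, act) \<and> V \<noteq> {0} \<and>
     (\<forall>U. U \<subseteq> V \<and> cvec.subspace U \<and> (\<forall>A\<in>sl3. \<forall>u\<in>U. act A u \<in> U) \<longrightarrow> U = {0} \<or> U = V))"

definition weight_space :: "sl3_rep \<Rightarrow> weight \<Rightarrow> cvec set" where
  "weight_space = (\<lambda>(V, act) \<mu>. {v \<in> V. \<forall>H\<in>cartan. act H v = cscale (weight_eval \<mu> H) v})"

definition is_irreducible_hw :: "weight \<Rightarrow> sl3_rep \<Rightarrow> bool" where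
  "is_irreducible_hw \<nu> = (\<lambda>(V, act). is_irreducible (V, act) \<and>
     (\<exists>v \<in> weight_space (V, act) \<nu>. v \<noteq> 0 \<and>
        act (unit_matrix 1 2) v = 0 \<and> act (unit_matrix 2 3) v = 0))"

text \<open>The irreducible module of highest weight \<open>\<nu>\<close> is unique up to isomorphism, so the choice
  does not affect the multiplicities.\<close>

definition irreducible_module :: "weight \<Rightarrow> sl3_rep" where
  "irreducible_module \<nu> = (SOME M. is_irreducible_hw \<nu> M)"

definition mbar :: "weight \<Rightarrow> weight \<Rightarrow> nat" where
  "mbar \<nu> \<mu> = cvec.dim (weight_space (irreducible_module \<nu>) \<mu>)"


section \<open>Characters and structure constants\<close>

definition coeff_m :: "ext_weyl \<Rightarrow> ext_weyl \<Rightarrow> int" where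
  "coeff_m x z = (if \<exists>u\<in>Waff. z = u + x then int (mbar (iota x) (iota z)) else 0)"

definition chi_char :: "ext_weyl \<Rightarrow> (ext_weyl \<Rightarrow>\<^sub>0 int)" where
  "chi_char x = (\<Sum>z | coeff_m x z \<noteq> 0. Poly_Mapping.single z (coeff_m x z))"

definition fusion :: "ext_weyl \<Rightarrow> ext_weyl \<Rightarrow> ext_weyl \<Rightarrow> int" where
  "fusion x y z = (\<Sum>w'\<in>KW_group z. wdet (hproj w') * coeff_m x (w' + z - y))"


section \<open>Basic facts\<close>

lemma hproj_plus: "hproj (u + v) = hproj u \<circ> hproj v"
  by transfer auto

lemma hproj_in_fin_weyl: "hproj y \<in> fin_weyl"
  by transfer auto

lemma shift_plus: "shift (u + v) = inv (hproj v) (shift u) + shift v"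
proof transfer
  fix u v :: "(weight \<Rightarrow> weight) \<times> weight"
  assume "u \<in> fin_weyl \<times> UNIV" "v \<in> fin_weyl \<times> UNIV"
  then obtain w \<beta> w' \<beta>' where uv: "u = (w, \<beta>)" "v = (w', \<beta>')" "inv w' \<in> fin_weyl"
    using fin_weyl_bij_inv by (metis SigmaE)
  show "(\<lambda>(w, \<beta>). - \<beta>) ((case u of (w, \<beta>) \<Rightarrow> \<lambda>(w', \<beta>'). (w \<circ> w', inv w' \<beta> + \<beta>')) v) =
      inv (fst v) ((\<lambda>(w, \<beta>). - \<beta>) u) + (\<lambda>(w, \<beta>). - \<beta>) v"
    unfolding uv prod.case fst_conv fin_weyl_minus[OF uv(3)] by (rule minus_add_distrib)
qed

lemma ext_weyl_eqI: "hproj u = hproj v \<Longrightarrow> shift u = shift v \<Longrightarrow> u = v"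
  by transfer auto

lemma hproj_zero: "hproj 0 = id"
  by transfer simp

lemma shift_zero: "shift 0 = 0"
  by transfer simp

lemma hproj_transl: "hproj (transl \<beta>) = id"
  by transfer simp

lemma shift_transl: "shift (transl \<beta>) = - \<beta>"
  by transfer simp

lemma transl_conj:
  assumes "w \<in> Wbar"
  shows "w + transl \<beta> - w = transl (hproj w \<beta>)"
proof -
  have *: "inv (hproj w) (- hproj w \<beta>) = - \<beta>"
    using fin_weyl_bij_inv[OF hproj_in_fin_weyl[of w]] fin_weyl_minus[OF hproj_in_fin_weyl[of w]]
    by (metis bij_is_inj inv_f_f)
  have "w + transl \<beta> = transl (hproj w \<beta>) + w"
    using assms
    by (intro ext_weyl_eqI) (simp_all add: Wbar_def hproj_plus shift_plus hproj_transl shift_transl inv_id *)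
  then show ?thesis
    by (simp add: diff_eq_eq)
qed

lemma ext_weyl_decomposition: "\<exists>!(w, \<nu>). w \<in> Wbar \<and> y = w + transl (- \<nu>)"
proof (rule ex_ex1I)
  have "y + transl (shift y) \<in> Wbar"
    by (simp add: Wbar_def shift_plus hproj_transl shift_transl inv_id)
  moreover have "y = y + transl (shift y) + transl (- shift y)"
    by (rule ext_weyl_eqI) (simp_all add: hproj_plus shift_plus hproj_transl shift_transl inv_id)
  ultimately show "\<exists>p. case p of (w, \<nu>) \<Rightarrow> w \<in> Wbar \<and> y = w + transl (- \<nu>)"
    by blast
next
  fix p q
  assume p: "case p of (w, \<nu>) \<Rightarrow> w \<in> Wbar \<and> y = w + transl (- \<nu>)"
    and q: "case q of (w, \<nu>) \<Rightarrow> w \<in> Wbar \<and> y = w + transl (- \<nu>)"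
  have "shift y = \<nu> \<and> hproj y = hproj w" if "w \<in> Wbar" "y = w + transl (- \<nu>)" for w \<nu>
    using that by (simp add: Wbar_def shift_plus hproj_plus hproj_transl shift_transl inv_id)
  then show "p = q"
    using p q by (cases p; cases q) (metis (mono_tags, lifting) Wbar_def case_prodD ext_weyl_eqI mem_Collect_eq)
qed

lemma fin_weyl_explicit:
  assumes "w \<in> fin_weyl"
  shows "w \<in> {\<lambda>(a, b). (a, b), \<lambda>(a, b). (- a, a + b), \<lambda>(a, b). (a + b, - b),
    \<lambda>(a, b). (- a - b, a), \<lambda>(a, b). (b, - a - b), \<lambda>(a, b). (- b, - a)}"
  using assms
proof (induction rule: fin_weyl.induct)
  case id
  then show ?case by (simp add: fun_eq_iff)
next
  case (step w i)
  then show ?case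
    by (auto simp: fun_eq_iff refl_simps)
qed

lemma fin_weyl_inv_eq: "w \<in> fin_weyl \<Longrightarrow> w p = q \<Longrightarrow> inv w q = p"
  by (meson bij_is_inj fin_weyl_bij_inv inv_f_eq)

lemma hproj_srefl: "i \<in> {1,2} \<Longrightarrow> hproj (srefl i) = wrefl i"
  by transfer auto

lemma shift_srefl: "shift (srefl i) = 0"
  by transfer simp

lemma hproj_gamma: "hproj gamma = wrefl 1 \<circ> wrefl 2"
  by (simp add: gamma_def hproj_plus hproj_transl hproj_srefl)

lemma shift_gamma: "shift gamma = (0, 1)"
proof -
  have "shift gamma = inv (wrefl 2) (inv (wrefl 1) (- (1, 0)))"
    by (simp only: gamma_def shift_plus hproj_srefl shift_srefl shift_transl insert_iff simp_thms
        add_0_right)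
  also have "inv (wrefl 1) (- (1, 0)) = (1, -1)"
    by (rule fin_weyl_inv_eq) (auto simp: refl_in_fin_weyl refl_simps)
  also have "inv (wrefl 2) (1, -1) = (0, 1)"
    by (rule fin_weyl_inv_eq) (auto simp: refl_in_fin_weyl refl_simps)
  finally show ?thesis .
qed

lemma fin_weyl_table:
  assumes "w \<in> fin_weyl"
  shows "(w, inv w (0, 1), inv w (1, 1)) \<in>
    {(\<lambda>(a, b). (a, b), (0, 1), (1, 1)), (\<lambda>(a, b). (- a, a + b), (0, 1), (-1, 2)),
     (\<lambda>(a, b). (a + b, - b), (1, -1), (2, -1)), (\<lambda>(a, b). (- a - b, a), (1, -1), (1, -2)),
     (\<lambda>(a, b). (b, - a - b), (-1, 0), (-2, 1)), (\<lambda>(a, b). (- b, - a), (-1, 0), (-1, -1))}"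
proof -
  have *: "inv w q = p" if "w p = q" for p q
    using fin_weyl_inv_eq[OF assms that] .
  from fin_weyl_explicit[OF assms] show ?thesis
    unfolding insert_iff empty_iff prod.inject
    by (elim disjE FalseE) (insert *[of "(0, 1)" "(0, 1)"] *[of "(1, -1)" "(0, 1)"] *[of "(-1, 0)" "(0, 1)"]
        *[of "(1, 1)" "(1, 1)"] *[of "(-1, 2)" "(1, 1)"] *[of "(2, -1)" "(1, 1)"]
        *[of "(1, -2)" "(1, 1)"] *[of "(-2, 1)" "(1, 1)"] *[of "(-1, -1)" "(1, 1)"], simp_all)
qed

lemma gamma_Wtilde_plus:
  assumes "x \<in> Wtilde_plus"
  shows "gamma + x \<in> Wtilde_plus"
proof -
  obtain c d where cd: "shift x = (c, d)" by (cases "shift x")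
  define w p where "w = hproj x" and "p = inv w (0, 1)"
  have x: "c \<ge> 0" "d \<ge> 0" "w (2, -1) \<in> negative_roots \<Longrightarrow> c > 0" "w (-1, 2) \<in> negative_roots \<Longrightarrow> d > 0"
    using assms by (auto simp: Wtilde_plus_def dominant_def pairing_def simple_root_def cd w_def)
  have g: "gamma + x \<in> Wtilde_plus \<longleftrightarrow> p + (c, d) \<in> dominant \<and>
      (wrefl 1 (wrefl 2 (w (2, -1))) \<in> negative_roots \<longrightarrow> fst (p + (c, d)) > 0) \<and>
      (wrefl 1 (wrefl 2 (w (-1, 2))) \<in> negative_roots \<longrightarrow> snd (p + (c, d)) > 0)"
    by (simp add: Wtilde_plus_def hproj_plus shift_plus hproj_gamma shift_gamma cd pairing_def
        simple_root_def w_def p_def)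
  from fin_weyl_table[of w] have "(w, p) \<in>
    {(\<lambda>(a, b). (a, b), (0, 1)), (\<lambda>(a, b). (- a, a + b), (0, 1)),
     (\<lambda>(a, b). (a + b, - b), (1, -1)), (\<lambda>(a, b). (- a - b, a), (1, -1)),
     (\<lambda>(a, b). (b, - a - b), (-1, 0)), (\<lambda>(a, b). (- b, - a), (-1, 0))}"
    by (simp add: p_def w_def hproj_in_fin_weyl) blast
  then show ?thesis
    unfolding g insert_iff empty_iff prod.inject using x
    by (elim disjE FalseE conjE)
       (simp_all add: dominant_def pairing_def simple_root_def negative_roots_def refl_simps)
qed

lemma gamma_cubed: "gamma + gamma + gamma = 0"
proof -
  have w: "wrefl 1 \<circ> wrefl 2 \<in> fin_weyl"
    by (intro fin_weyl_comp refl_in_fin_weyl) auto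
  have 1: "inv (wrefl 1 \<circ> wrefl 2) (0, 1) = (1, -1)" "inv (wrefl 1 \<circ> wrefl 2) (1, 0) = (0, -1)"
    by (rule fin_weyl_inv_eq[OF w]; simp add: refl_simps)+
  show ?thesis
  proof (rule ext_weyl_eqI)
    show "hproj (gamma + gamma + gamma) = hproj 0"
      by (simp add: hproj_plus hproj_gamma hproj_zero fun_eq_iff refl_simps)
    show "shift (gamma + gamma + gamma) = shift 0"
      using 1 by (simp add: shift_plus hproj_gamma shift_gamma shift_zero zero_prod_def)
  qed
qed

lemma Wplus_coset_subset: "a \<in> Agrp \<Longrightarrow> Wplus_coset a \<subseteq> Wtilde_plus"
  by (auto simp: Agrp_def Wplus_coset_def Wplus_def add.assoc gamma_Wtilde_plus)

lemma iota_dominant: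
  assumes "x \<in> Wtilde_plus"
  shows "iota x \<in> dominant"
proof -
  obtain c d where cd: "shift x = (c, d)" by (cases "shift x")
  define w p where "w = hproj x" and "p = inv w (1, 1)"
  have x: "c \<ge> 0" "d \<ge> 0" "w (2, -1) \<in> negative_roots \<Longrightarrow> c > 0" "w (-1, 2) \<in> negative_roots \<Longrightarrow> d > 0"
    using assms by (auto simp: Wtilde_plus_def dominant_def pairing_def simple_root_def cd w_def)
  have g: "iota x = (3 * c + fst p - 1, 3 * d + snd p - 1)"
    by (simp add: iota_def shifted_def rho_def cd wscale_def w_def p_def prod_eq_iff)
  from fin_weyl_table[of w] have "(w, p) \<in>
    {(\<lambda>(a, b). (a, b), (1, 1)), (\<lambda>(a, b). (- a, a + b), (-1, 2)),
     (\<lambda>(a, b). (a + b, - b), (2, -1)), (\<lambda>(a, b). (- a - b, a), (1, -2)),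
     (\<lambda>(a, b). (b, - a - b), (-2, 1)), (\<lambda>(a, b). (- b, - a), (-1, -1))}"
    by (simp add: p_def w_def hproj_in_fin_weyl) blast
  then show ?thesis
    unfolding g insert_iff empty_iff prod.inject using x
    by (elim disjE FalseE conjE)
       (simp_all add: dominant_def pairing_def simple_root_def negative_roots_def)
qed

end

theory Submission
  imports Defs
begin

text \<open>An element \<open>y\<close> of the extended affine Weyl group moves the centre \<open>\<rho>/3\<close> of the fundamental
  alcove to another alcove centre, and \<open>\<iota>(y) + \<rho>\<close> is three times the centre \<open>y\<^sup>-\<^sup>1(\<rho>/3)\<close>.
  Hence \<open>\<iota>\<close> is injective on each coset of \<open>W\<close>, its values are the root lattice weights that are
  congruent to \<open>0\<close> or \<open>\<rho>\<close> modulo \<open>3P\<close> (the third class, of \<open>-\<rho>\<close>, never occurs), and the elements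
  of the set \<open>Wtilde_plus\<close> are those with dominant \<open>\<iota>(y)\<close>.  The cocycle rule
  \<open>\<iota>(u v) = \<iota>(v) + w\<^sup>-\<^sup>1 \<iota>(u)\<close>, where \<open>w\<close> is the horizontal projection of \<open>v\<close>, and the Weyl
  invariance of multiplicities turn left multiplication by \<open>\<chi>\<^sub>x\<close> into multiplication by the ordinary character \<open>F\<close> of highest weight
  \<open>\<iota>(x)\<close> in the group ring of \<open>P\<close>, except that exponents in the third class are lost.  So
  \<open>\<chi>\<^sub>x \<chi>\<^sub>y\<close> is the truncation of \<open>F\<close> times the truncation of \<open>G\<close>, where \<open>G\<close> is the character of
  highest weight \<open>\<iota>(y)\<close> (\<open>lookup_chi_char_mult\<close>), and the structure constants are the coefficients
  of \<open>F\<close> times the Weyl numerator of \<open>G\<close> (\<open>fusion_eq_lookup\<close>).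

  Without truncation the theorem would be the usual rule for multiplying characters, a consequence
  of the Weyl character formula.  Truncation could spoil it, because the missing terms of \<open>G\<close>
  contribute to \<open>F G\<close>.  What saves the rule is that shifted reflections exchange the two classes
  that occur, so the Weyl numerators of \<open>F\<close> and \<open>G\<close> have no terms in the third class.  Write
  \<open>F = F\<^sub>0 + F\<^sub>1 + F\<^sub>2\<close> by classes, likewise \<open>G\<close>, and \<open>D = D\<^sub>0 + D\<^sub>1\<close> for the Weyl denominator.
  Then \<open>F\<^sub>2 D\<^sub>0 + F\<^sub>1 D\<^sub>1 = 0\<close> and \<open>G\<^sub>2 D\<^sub>0 + G\<^sub>1 D\<^sub>1 = 0\<close>, hence \<open>F\<^sub>2 G\<^sub>1 = F\<^sub>1 G\<^sub>2\<close> after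
  cancelling \<open>D\<^sub>0\<close>.  It follows that
  \<open>K = (F\<^sub>0 G\<^sub>0 + F\<^sub>2 G\<^sub>1) + (F\<^sub>1 G\<^sub>0 + F\<^sub>0 G\<^sub>1) + (F\<^sub>2 G\<^sub>0 + F\<^sub>0 G\<^sub>2)\<close>
  is Weyl invariant, restricts to the truncated product on the classes that occur, and that \<open>K D\<close>
  is \<open>F G D\<close> with its third class removed.  Expanding the invariant \<open>K\<close> in irreducible characters
  reads its coefficients off \<open>K D\<close>, that is, off \<open>F G D\<close> (\<open>truncated_product\<close>).

  The multiplicities are defined through an unspecified irreducible module, so the Weyl character
  formula has to be derived for all of them.  A dual Verma module of polynomials in three variables
  shows that irreducible highest weight modules exist (\<open>irreducible_hw_exists\<close>).  In an arbitrary
  one of dominant highest weight, the Gelfand-Tsetlin vectors are an explicit basis of each weight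
  space (\<open>mbar_eq_card\<close>), and summing their weights gives the Weyl character formula
  (\<open>weyl_character_formula\<close>).\<close>

section \<open>Existence of irreducible highest weight modules\<close>

text \<open>A vector is read as a polynomial in three variables \<open>x\<close>, \<open>y\<close>, \<open>z\<close>, through an enumeration of the
  monomials; \<open>mcoeff p i j k\<close> is the coefficient of \<open>x\<^sup>i y\<^sup>j z\<^sup>k\<close>.  The indices are integers, with value
  \<open>0\<close> off the octant, so that differential operators act on coefficients by formulas without case
  distinctions.\<close>

definition mcoeff :: "cvec \<Rightarrow> int \<Rightarrow> int \<Rightarrow> int \<Rightarrow> complex" where
  "mcoeff p i j k = (if 0 \<le> i \<and> 0 \<le> j \<and> 0 \<le> k
     then Poly_Mapping.lookup p (prod_encode (nat i, prod_encode (nat j, nat k))) else 0)"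

definition of_mcoeff :: "(int \<Rightarrow> int \<Rightarrow> int \<Rightarrow> complex) \<Rightarrow> cvec" where
  "of_mcoeff \<phi> = Abs_poly_mapping (\<lambda>n. case prod_decode n of (i, m) \<Rightarrow>
     (case prod_decode m of (j, k) \<Rightarrow> \<phi> (int i) (int j) (int k)))"

lemma mcoeff_eqI:
  assumes "\<And>i j k. mcoeff p i j k = mcoeff q i j k"
  shows "p = q"
proof (rule poly_mapping_eqI)
  fix n
  obtain i m where m: "prod_decode n = (i, m)" by fastforce
  obtain j k where k: "prod_decode m = (j, k)" by fastforce
  have "n = prod_encode (i, prod_encode (j, k))"
    using m k by (metis prod_decode_inverse)
  then show "Poly_Mapping.lookup p n = Poly_Mapping.lookup q n"
    using assms[of "int i" "int j" "int k"] by (simp add: mcoeff_def)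
qed

lemma mcoeff_simps:
  "mcoeff 0 i j k = 0"
  "mcoeff (p + q) i j k = mcoeff p i j k + mcoeff q i j k"
  "mcoeff (p - q) i j k = mcoeff p i j k - mcoeff q i j k"
  "mcoeff (cscale c p) i j k = c * mcoeff p i j k"
  by (auto simp: mcoeff_def lookup_add lookup_minus lookup_cscale)

lemma mcoeff_neg: "i < 0 \<or> j < 0 \<or> k < 0 \<Longrightarrow> mcoeff p i j k = 0"
  by (auto simp: mcoeff_def)

lemma finite_mcoeff: "finite {(i, j, k). mcoeff p i j k \<noteq> 0}"
proof (rule finite_subset)
  let ?d = "\<lambda>n. case prod_decode n of (i, m) \<Rightarrow>
     (case prod_decode m of (j, k) \<Rightarrow> (int i, int j, int k))"
  show "{(i, j, k). mcoeff p i j k \<noteq> 0} \<subseteq> ?d ` Poly_Mapping.keys p"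
  proof clarify
    fix i j k assume "mcoeff p i j k \<noteq> 0"
    then have "0 \<le> i" "0 \<le> j" "0 \<le> k"
      "prod_encode (nat i, prod_encode (nat j, nat k)) \<in> Poly_Mapping.keys p"
      by (auto simp: mcoeff_def in_keys_iff split: if_splits)
    then show "(i, j, k) \<in> ?d ` Poly_Mapping.keys p"
      by (intro rev_image_eqI) auto
  qed
qed simp

lemma mcoeff_of_mcoeff:
  assumes fin: "finite {(i, j, k). \<phi> i j k \<noteq> 0}"
    and neg: "\<And>i j k. i < 0 \<or> j < 0 \<or> k < 0 \<Longrightarrow> \<phi> i j k = 0"
  shows "mcoeff (of_mcoeff \<phi>) i j k = \<phi> i j k"
proof -
  let ?f = "\<lambda>n. case prod_decode n of (i, m) \<Rightarrow>
     (case prod_decode m of (j, k) \<Rightarrow> \<phi> (int i) (int j) (int k))"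
  have "{n. ?f n \<noteq> 0} \<subseteq> (\<lambda>(i, j, k). prod_encode (nat i, prod_encode (nat j, nat k))) `
      {(i, j, k). \<phi> i j k \<noteq> 0}"
  proof
    fix n assume n: "n \<in> {n. ?f n \<noteq> 0}"
    obtain i m where m: "prod_decode n = (i, m)" by fastforce
    obtain j k where k: "prod_decode m = (j, k)" by fastforce
    have "n = prod_encode (i, prod_encode (j, k))"
      using m k by (metis prod_decode_inverse)
    then show "n \<in> (\<lambda>(i, j, k). prod_encode (nat i, prod_encode (nat j, nat k))) `
      {(i, j, k). \<phi> i j k \<noteq> 0}"
      using n m k by (intro rev_image_eqI[of "(int i, int j, int k)"]) auto
  qed
  then have "finite {n. ?f n \<noteq> 0}"
    using fin finite_surj by blast
  then have "Poly_Mapping.lookup (of_mcoeff \<phi>) = ?f"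
    unfolding of_mcoeff_def by simp
  then show ?thesis
    using neg[of i j k] by (auto simp: mcoeff_def not_le)
qed

text \<open>Let \<open>sl(3)\<close> act on functions of \<open>x\<^sub>1, x\<^sub>2, x\<^sub>3, y\<^sub>1, y\<^sub>2, y\<^sub>3\<close> subject to \<open>x\<^sub>1 y\<^sub>1 + x\<^sub>2 y\<^sub>2 + x\<^sub>3 y\<^sub>3 = 0\<close>,
  the matrix unit \<open>E\<^sub>i\<^sub>j\<close> acting as \<open>x\<^sub>i \<partial>/\<partial>x\<^sub>j - y\<^sub>j \<partial>/\<partial>y\<^sub>i\<close>.  On functions of degree \<open>a\<close> in the first
  and \<open>b\<close> in the second group of variables, in the coordinates \<open>x = x\<^sub>2/x\<^sub>1\<close>, \<open>z = x\<^sub>3/x\<^sub>1\<close>,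
  \<open>y = y\<^sub>2/y\<^sub>3\<close>, these become
  \<open>E\<^sub>1\<^sub>2 = \<partial>\<^sub>x\<close>, \<open>E\<^sub>1\<^sub>3 = \<partial>\<^sub>z\<close>, \<open>E\<^sub>2\<^sub>3 = x \<partial>\<^sub>z - \<partial>\<^sub>y\<close>,
  \<open>E\<^sub>2\<^sub>1 = x (a - x \<partial>\<^sub>x - z \<partial>\<^sub>z) + (x y + z) \<partial>\<^sub>y\<close>, \<open>E\<^sub>3\<^sub>2 = z \<partial>\<^sub>x - y (b - y \<partial>\<^sub>y)\<close>,
  \<open>E\<^sub>3\<^sub>1 = z (a - x \<partial>\<^sub>x - z \<partial>\<^sub>z) + (x y + z) (b - y \<partial>\<^sub>y)\<close>.  All polynomials together form a dual Verma
  module; the formula is its action on coefficients.\<close>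

definition coind_coeff :: "int \<Rightarrow> int \<Rightarrow> complex^3^3 \<Rightarrow> cvec \<Rightarrow> int \<Rightarrow> int \<Rightarrow> int \<Rightarrow> complex" where
  "coind_coeff a b A p i j k =
     A $ 1 $ 2 * (of_int (i + 1) * mcoeff p (i + 1) j k)
   + A $ 1 $ 3 * (of_int (k + 1) * mcoeff p i j (k + 1))
   + A $ 2 $ 3 * (of_int (k + 1) * mcoeff p (i - 1) j (k + 1) - of_int (j + 1) * mcoeff p i (j + 1) k)
   + A $ 2 $ 1 * (of_int (a - (i - 1) - k + j) * mcoeff p (i - 1) j k
                  + of_int (j + 1) * mcoeff p i (j + 1) (k - 1))
   + A $ 3 $ 2 * (of_int (i + 1) * mcoeff p (i + 1) j (k - 1)
                  - of_int (b - (j - 1)) * mcoeff p i (j - 1) k)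
   + A $ 3 $ 1 * (of_int (a + b - i - j - (k - 1)) * mcoeff p i j (k - 1)
                  + of_int (b - (j - 1)) * mcoeff p (i - 1) (j - 1) k)
   + A $ 1 $ 1 * (of_int (a - 2 * i - k + j) * mcoeff p i j k)
   + (A $ 1 $ 1 + A $ 2 $ 2) * (of_int (b + i - k - 2 * j) * mcoeff p i j k)"

definition coind_act :: "int \<Rightarrow> int \<Rightarrow> complex^3^3 \<Rightarrow> cvec \<Rightarrow> cvec" where
  "coind_act a b A p = of_mcoeff (coind_coeff a b A p)"

text \<open>Only finitely many coefficients are involved because only eleven index shifts occur, and nothing
  leaves the octant because lowering an exponent \<open>i\<close> to \<open>i - 1\<close> comes with the factor \<open>i\<close>.\<close>

lemma mcoeff_coind_act: "mcoeff (coind_act a b A p) i j k = coind_coeff a b A p i j k"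
  unfolding coind_act_def
proof (rule mcoeff_of_mcoeff)
  let ?S = "{(i, j, k). mcoeff p i j k \<noteq> 0}"
  define D :: "(int \<times> int \<times> int) set" where "D = {(-1, 0, 0), (0, 0, -1), (1, 0, -1), (0, -1, 0), (1, 0, 0), (0, -1, 1), (-1, 0, 1),
    (0, 1, 0), (0, 0, 1), (1, 1, 0), (0, 0, 0)}"
  have "{(i, j, k). coind_coeff a b A p i j k \<noteq> 0} \<subseteq> (\<Union>d\<in>D. (\<lambda>s. s + d) ` ?S)"
  proof clarify
    fix i j k assume c: "coind_coeff a b A p i j k \<noteq> 0"
    have "\<exists>d\<in>D. (i, j, k) - d \<in> ?S"
    proof (rule ccontr)
      assume "\<not> ?thesis"
      then have "coind_coeff a b A p i j k = 0"
        by (simp add: coind_coeff_def D_def)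
      with c show False by simp
    qed
    then obtain d where d: "d \<in> D" "(i, j, k) - d \<in> ?S" by (elim bexE)
    have "(i, j, k) \<in> (\<lambda>s. s + d) ` ?S"
      using d(2) by (rule rev_image_eqI) (simp only: diff_add_cancel)
    with d(1) show "(i, j, k) \<in> (\<Union>d\<in>D. (\<lambda>s. s + d) ` ?S)" by (rule UN_I)
  qed
  then show "finite {(i, j, k). coind_coeff a b A p i j k \<noteq> 0}"
    by (rule finite_subset) (intro finite_UN_I finite_imageI finite_mcoeff, unfold D_def, rule finite.intros, (rule finite.intros)+)
next
  fix i j k :: int
  assume n: "i < 0 \<or> j < 0 \<or> k < 0"
  have i0: "of_int (i + 1) * mcoeff p (i + 1) l m = 0" if "i < 0" for l m
    using that by (cases "i = -1") (auto simp: mcoeff_neg)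
  have j0: "of_int (j + 1) * mcoeff p l (j + 1) m = 0" if "j < 0" for l m
    using that by (cases "j = -1") (auto simp: mcoeff_neg)
  have k0: "of_int (k + 1) * mcoeff p l m (k + 1) = 0" if "k < 0" for l m
    using that by (cases "k = -1") (auto simp: mcoeff_neg)
  consider "i < 0" | "j < 0" | "k < 0" using n by blast
  then show "coind_coeff a b A p i j k = 0"
  proof cases
    case 1
    then have "mcoeff p i l m = 0" "mcoeff p (i - 1) l m = 0" for l m by (auto intro: mcoeff_neg)
    then show ?thesis unfolding coind_coeff_def i0[OF 1] by simp
  next
    case 2
    then have "mcoeff p l j m = 0" "mcoeff p l (j - 1) m = 0" for l m by (auto intro: mcoeff_neg)
    then show ?thesis unfolding coind_coeff_def j0[OF 2] by simp
  next
    case 3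
    then have "mcoeff p l m k = 0" "mcoeff p l m (k - 1) = 0" for l m by (auto intro: mcoeff_neg)
    then show ?thesis unfolding coind_coeff_def k0[OF 3] by simp
  qed
qed

lemma sl3_33: "A \<in> sl3 \<Longrightarrow> A $ 3 $ 3 = - A $ 1 $ 1 - A $ 2 $ 2"
  by (simp add: sl3_def trace_def sum_3 algebra_simps eq_neg_iff_add_eq_0)

lemma bracket_entry: "bracket A B $ i $ j =
   A $ i $ 1 * B $ 1 $ j + A $ i $ 2 * B $ 2 $ j + A $ i $ 3 * B $ 3 $ j
   - (B $ i $ 1 * A $ 1 $ j + B $ i $ 2 * A $ 2 $ j + B $ i $ 3 * A $ 3 $ j)"
  by (simp add: bracket_def matrix_matrix_mult_def sum_3)

lemma coind_bracket:
  assumes "A \<in> sl3" "B \<in> sl3"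
  shows "coind_act a b (bracket A B) p =
    coind_act a b A (coind_act a b B p) - coind_act a b B (coind_act a b A p)"
proof (rule mcoeff_eqI)
  fix i j k
  show "mcoeff (coind_act a b (bracket A B) p) i j k =
    mcoeff (coind_act a b A (coind_act a b B p) - coind_act a b B (coind_act a b A p)) i j k"
    \<comment> \<open>normalizing the shifted indices leaves an identity of polynomials in the matrix entries,
      the indices and the coefficients of \<open>p\<close>\<close>
    by (simp only: mcoeff_simps mcoeff_coind_act coind_coeff_def add_diff_cancel diff_add_cancel,
        simp only: bracket_entry sl3_33[OF assms(1)] sl3_33[OF assms(2)],
        simp only: of_int_add of_int_diff of_int_mult of_int_1 of_int_numeral, algebra)
qed

lemma mcoeff_eq_iff: "p = q \<longleftrightarrow> (\<forall>i j k. mcoeff p i j k = mcoeff q i j k)"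
  using mcoeff_eqI by blast

lemma mcoeff_one: "mcoeff 1 i j k = (if i = 0 \<and> j = 0 \<and> k = 0 then 1 else 0)"
proof -
  have "prod_encode (nat i, prod_encode (nat j, nat k)) = 0 \<longleftrightarrow>
      prod_encode (nat i, prod_encode (nat j, nat k)) = prod_encode (0, prod_encode (0, 0))"
    by (simp add: prod_encode_def)
  then show ?thesis
    by (auto simp: mcoeff_def lookup_one when_def simp del: prod_encode_def)
qed

lemma unit_matrix_entry: "unit_matrix i j $ k $ l = (if k = i \<and> l = j then 1 else 0)"
  by (simp add: unit_matrix_def)

lemma unit_matrix_sl3: "i \<noteq> j \<Longrightarrow> unit_matrix i j \<in> sl3"
  by (simp add: sl3_def trace_def unit_matrix_entry sum.neutral)

lemma coind_module: "is_sl3_module (UNIV, coind_act a b)"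
proof -
  note d = mcoeff_simps mcoeff_coind_act coind_coeff_def
  have "coind_act a b A (u + v) = coind_act a b A u + coind_act a b A v" for A u v
    by (rule mcoeff_eqI) (simp only: d, algebra)
  moreover have "coind_act a b A (cscale c v) = cscale c (coind_act a b A v)" for A c v
    by (rule mcoeff_eqI) (simp only: d, algebra)
  moreover have "coind_act a b (A + B) v = coind_act a b A v + coind_act a b B v" for A B v
    by (rule mcoeff_eqI) (simp only: d vector_add_component, algebra)
  moreover have "coind_act a b (mscale c A) v = cscale c (coind_act a b A v)" for c A v
    by (rule mcoeff_eqI) (simp only: d mscale_def vec_lambda_beta, algebra)
  ultimately show ?thesis
    by (simp add: is_sl3_module_def coind_bracket)
qed

definition is_submodule :: "(complex^3^3 \<Rightarrow> cvec \<Rightarrow> cvec) \<Rightarrow> cvec set \<Rightarrow> bool" where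
  "is_submodule act U \<longleftrightarrow> cvec.subspace U \<and> (\<forall>A\<in>sl3. \<forall>u\<in>U. act A u \<in> U)"

text \<open>The operators \<open>E\<^sub>1\<^sub>2\<close>, \<open>E\<^sub>1\<^sub>3\<close>, \<open>E\<^sub>2\<^sub>3\<close> lower the degree in which \<open>x\<close> and \<open>y\<close> count once and \<open>z\<close> twice,
  and only constants are killed by all three.  So from any nonzero vector of a submodule they lead
  to a nonzero constant.\<close>

lemma coind_submodule_contains_one:
  assumes U: "is_submodule (coind_act a b) U"
    and "u \<in> U" "u \<noteq> 0"
    and "\<And>i j k. mcoeff u i j k \<noteq> 0 \<Longrightarrow> i + j + 2 * k \<le> int N"
  shows "1 \<in> U"
  using assms(2-)
proof (induction N arbitrary: u)
  case 0
  have "mcoeff u i j k = mcoeff u 0 0 0 * mcoeff 1 i j k" for i j k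
    using 0(3)[of i j k] mcoeff_neg[of i j k u] by (force simp: mcoeff_one)
  then have u: "u = cscale (mcoeff u 0 0 0) 1"
    unfolding mcoeff_eq_iff mcoeff_simps by blast
  with 0(2) have "mcoeff u 0 0 0 \<noteq> 0"
    by (metis cvec.scale_zero_left)
  then have "cscale (1 / mcoeff u 0 0 0) (cscale (mcoeff u 0 0 0) 1) = 1"
    by simp
  then have "1 = cscale (1 / mcoeff u 0 0 0) u"
    using u by simp
  then show ?case
    using U 0(1) by (metis is_submodule_def cvec.subspace_scale)
next
  case (Suc N)
  let ?e = "\<lambda>i j. coind_act a b (unit_matrix i j) u"
  have inU: "?e i j \<in> U" if "i \<noteq> j" for i j
    using U Suc.prems(1) unit_matrix_sl3[OF that] by (auto simp: is_submodule_def)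
  have c12: "mcoeff (?e 1 2) i j k = of_int (i + 1) * mcoeff u (i + 1) j k" for i j k
    by (simp add: mcoeff_coind_act coind_coeff_def unit_matrix_entry)
  have c13: "mcoeff (?e 1 3) i j k = of_int (k + 1) * mcoeff u i j (k + 1)" for i j k
    by (simp add: mcoeff_coind_act coind_coeff_def unit_matrix_entry)
  have c23: "mcoeff (?e 2 3) i j k = of_int (k + 1) * mcoeff u (i - 1) j (k + 1) - of_int (j + 1) * mcoeff u i (j + 1) k"
    for i j k
    by (simp add: mcoeff_coind_act coind_coeff_def unit_matrix_entry)
  note deg = Suc.prems(3)
  consider "?e 1 2 \<noteq> 0" | "?e 1 3 \<noteq> 0" | "?e 2 3 \<noteq> 0" | "?e 1 2 = 0" "?e 1 3 = 0" "?e 2 3 = 0"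
    by blast
  then show ?case
  proof cases
    case 1
    show ?thesis
      by (rule Suc.IH[OF inU 1]) (use deg in \<open>force simp: c12\<close>)+
  next
    case 2
    show ?thesis
      by (rule Suc.IH[OF inU 2]) (use deg in \<open>force simp: c13\<close>)+
  next
    case 3
    show ?thesis
    proof (rule Suc.IH[OF inU 3])
      fix i j k assume "mcoeff (?e 2 3) i j k \<noteq> 0"
      then have "mcoeff u (i - 1) j (k + 1) \<noteq> 0 \<or> mcoeff u i (j + 1) k \<noteq> 0"
        by (auto simp: c23)
      then show "i + j + 2 * k \<le> int N"
        using deg[of "i - 1" j "k + 1"] deg[of i "j + 1" k] by auto
    qed simp
  next
    \<comment> \<open>a polynomial killed by the three raising operators is constant\<close>
    case 4
    have x: "mcoeff u i j k = 0" if "i > 0" for i j k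
      using c12[of "i - 1" j k] 4(1) that by (simp add: mcoeff_simps flip: of_int_diff)
    have z: "mcoeff u i j k = 0" if "k > 0" for i j k
      using c13[of i j "k - 1"] 4(2) that by (simp add: mcoeff_simps flip: of_int_diff)
    have y: "mcoeff u i j k = 0" if "j > 0" for i j k
    proof (cases "k < 0")
      case False
      then show ?thesis
        using c23[of i "j - 1" k] 4(3) that z[of "k + 1" "i - 1" "j - 1"] by (simp add: mcoeff_simps flip: of_int_diff)
    qed (simp add: mcoeff_neg)
    have "i = 0 \<and> j = 0 \<and> k = 0" if "mcoeff u i j k \<noteq> 0" for i j k
      using that x[of i j k] y[of j i k] z[of k i j] mcoeff_neg[of i j k u] by linarith
    then show ?thesis
      using Suc.IH[OF Suc.prems(1,2)] by fastforce
  qed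
qed

text \<open>The smallest submodule containing \<open>1\<close> is irreducible, since every nonzero submodule contains \<open>1\<close>.\<close>

theorem irreducible_hw_exists: "\<exists>M. is_irreducible_hw (a, b) M"
proof -
  let ?act = "coind_act a b"
  define V where "V = \<Inter>{U. is_submodule ?act U \<and> 1 \<in> U}"
  have sub: "is_submodule ?act V"
    unfolding is_submodule_def
  proof
    show "cvec.subspace V"
      unfolding V_def by (rule cvec.subspace_Inter) (auto simp: is_submodule_def)
    show "\<forall>A\<in>sl3. \<forall>u\<in>V. ?act A u \<in> V"
      unfolding V_def by (auto simp: is_submodule_def)
  qed
  have one: "1 \<in> V" by (auto simp: V_def)
  have least: "V \<subseteq> U" if "U \<subseteq> V" "is_submodule ?act U" "U \<noteq> {0}" for U
  proof -
    have "0 \<in> U"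
      using that(2) cvec.subspace_0 by (auto simp: is_submodule_def)
    with that(3) obtain u where u: "u \<in> U" "u \<noteq> 0" by blast
    obtain N where N: "\<And>i j k. mcoeff u i j k \<noteq> 0 \<Longrightarrow> i + j + 2 * k \<le> int N"
    proof -
      let ?d = "\<lambda>(i, j, k). nat (i + j + 2 * k)"
      have "finite (?d ` {(i, j, k). mcoeff u i j k \<noteq> 0})"
        by (rule finite_imageI[OF finite_mcoeff])
      then obtain N where "\<forall>n \<in> ?d ` {(i, j, k). mcoeff u i j k \<noteq> 0}. n \<le> N"
        using finite_nat_set_iff_bounded_le by blast
      then show ?thesis
        by (intro that[of N]) fastforce
    qed
    have "1 \<in> U"
      by (rule coind_submodule_contains_one[OF that(2) u N])
    then show ?thesis
      using that(2) by (auto simp: V_def)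
  qed
  have mod: "is_sl3_module (V, ?act)"
    using coind_module[of a b] sub by (auto simp: is_sl3_module_def is_submodule_def)
  have "is_irreducible (V, ?act)"
    unfolding is_irreducible_def prod.case
  proof (intro conjI allI impI mod)
    show "V \<noteq> {0}" using one by (metis singletonD zero_neq_one)
    fix U assume "U \<subseteq> V \<and> cvec.subspace U \<and> (\<forall>A\<in>sl3. \<forall>u\<in>U. ?act A u \<in> U)"
    then show "U = {0} \<or> U = V"
      using least[of U] by (auto simp: is_submodule_def)
  qed
  moreover have "1 \<in> weight_space (V, ?act) (a, b)"
  proof -
    have "?act H 1 = cscale (weight_eval (a, b) H) 1" if H: "H \<in> cartan" for H
    proof (rule mcoeff_eqI)
      have "H $ 1 $ 2 = 0" "H $ 1 $ 3 = 0" "H $ 2 $ 3 = 0" "H $ 2 $ 1 = 0" "H $ 3 $ 1 = 0" "H $ 3 $ 2 = 0"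
        using H by (auto simp: cartan_def)
      then show "mcoeff (?act H 1) i j k = mcoeff (cscale (weight_eval (a, b) H) 1) i j k" for i j k
        by (auto simp: mcoeff_simps mcoeff_coind_act coind_coeff_def mcoeff_one weight_eval_def algebra_simps)
    qed
    with one show ?thesis by (simp add: weight_space_def)
  qed
  moreover have "?act (unit_matrix 1 2) 1 = 0" "?act (unit_matrix 2 3) 1 = 0"
    by (auto simp: mcoeff_eq_iff mcoeff_coind_act coind_coeff_def unit_matrix_entry mcoeff_one mcoeff_simps
        eq_neg_iff_add_eq_0[symmetric])
  ultimately have "is_irreducible_hw (a, b) (V, ?act)"
    unfolding is_irreducible_hw_def prod.case by (metis zero_neq_one)
  then show ?thesis ..
qed

section \<open>Operators of an irreducible module\<close>

text \<open>The module is arbitrary: its multiplicities are computed without comparing it with a model, so that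
  the result holds for whichever module is chosen in the definition of the multiplicities.\<close>

locale sl3_hw_module =
  fixes V :: "cvec set" and act :: "complex^3^3 \<Rightarrow> cvec \<Rightarrow> cvec" and a b :: nat and v0 :: cvec
  assumes irr: "is_irreducible (V, act)"
    and v0_weight: "v0 \<in> weight_space (V, act) (int a, int b)"
    and v0_nz: "v0 \<noteq> 0"
    and e1_v0: "act (unit_matrix 1 2) v0 = 0" and e2_v0: "act (unit_matrix 2 3) v0 = 0"
begin

abbreviation "e1 \<equiv> act (unit_matrix 1 2)"
abbreviation "e2 \<equiv> act (unit_matrix 2 3)"
abbreviation "e3 \<equiv> act (unit_matrix 1 3)"
abbreviation "f1 \<equiv> act (unit_matrix 2 1)"
abbreviation "f2 \<equiv> act (unit_matrix 3 2)"
abbreviation "f3 \<equiv> act (unit_matrix 3 1)"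
abbreviation "h1 \<equiv> act (unit_matrix 1 1 - unit_matrix 2 2)"
abbreviation "h2 \<equiv> act (unit_matrix 2 2 - unit_matrix 3 3)"

lemma module: "is_sl3_module (V, act)"
  using irr by (simp add: is_irreducible_def)

lemma subspace_V: "cvec.subspace V"
  using module by (simp add: is_sl3_module_def)

lemmas V_add = cvec.subspace_add[OF subspace_V]
lemmas V_scale = cvec.subspace_scale[OF subspace_V]
lemmas V_0 = cvec.subspace_0[OF subspace_V]

definition lin :: "(cvec \<Rightarrow> cvec) \<Rightarrow> bool" where
  "lin T \<longleftrightarrow> (\<forall>u\<in>V. T u \<in> V) \<and> (\<forall>u\<in>V. \<forall>w\<in>V. T (u + w) = T u + T w)
     \<and> (\<forall>c. \<forall>u\<in>V. T (cscale c u) = cscale c (T u))"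

lemma lin_V: "lin T \<Longrightarrow> u \<in> V \<Longrightarrow> T u \<in> V"
  by (simp add: lin_def)
lemma lin_add: "lin T \<Longrightarrow> u \<in> V \<Longrightarrow> w \<in> V \<Longrightarrow> T (u + w) = T u + T w"
  by (simp add: lin_def)
lemma lin_scale: "lin T \<Longrightarrow> u \<in> V \<Longrightarrow> T (cscale c u) = cscale c (T u)"
  by (simp add: lin_def)
lemma lin_0: "lin T \<Longrightarrow> T 0 = 0"
  using lin_scale[OF _ V_0, of T 0] by simp

lemma lin_sum:
  assumes "lin T" "\<And>i. i \<in> I \<Longrightarrow> g i \<in> V"
  shows "(\<Sum>i\<in>I. g i) \<in> V \<and> T (\<Sum>i\<in>I. g i) = (\<Sum>i\<in>I. T (g i))"
  using assms(2)
  by (induction I rule: infinite_finite_induct) (auto simp: V_0 V_add lin_0[OF assms(1)] lin_add[OF assms(1)])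

lemma lin_pow: "lin T \<Longrightarrow> lin (T ^^ n)"
  by (induction n) (auto simp: lin_def)

lemma lin_act: "A \<in> sl3 \<Longrightarrow> lin (act A)"
  using module by (simp add: is_sl3_module_def lin_def)

lemma h_sl3: "unit_matrix i i - unit_matrix j j \<in> sl3"
proof -
  have "trace (unit_matrix i i) = 1" for i
    by (simp add: trace_def unit_matrix_entry)
  then show ?thesis
    by (simp add: sl3_def trace_sub)
qed

lemma lin_op: "lin e1" "lin e2" "lin e3" "lin f1" "lin f2" "lin f3" "lin h1" "lin h2"
  by (auto intro!: lin_act unit_matrix_sl3 h_sl3)

lemmas op_V [simp] = lin_op[THEN lin_V]
lemmas op_add = lin_op[THEN lin_add]
lemmas op_scale = lin_op[THEN lin_scale]
lemmas op_0 [simp] = lin_op[THEN lin_0]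

lemma act_add: "A \<in> sl3 \<Longrightarrow> B \<in> sl3 \<Longrightarrow> u \<in> V \<Longrightarrow> act (A + B) u = act A u + act B u"
  using module by (simp add: is_sl3_module_def)

lemma act_mscale: "A \<in> sl3 \<Longrightarrow> u \<in> V \<Longrightarrow> act (mscale c A) u = cscale c (act A u)"
  using module by (simp add: is_sl3_module_def)

lemma act_bracket:
  assumes "bracket A B = C" "A \<in> sl3" "B \<in> sl3" "u \<in> V"
  shows "act A (act B u) = act B (act A u) + act C u"
  using module assms by (auto simp: is_sl3_module_def)

lemma act_zero: "u \<in> V \<Longrightarrow> act 0 u = 0"
  using act_mscale[of 0 u 0] by (simp add: sl3_def trace_def mscale_def vec_eq_iff zero_vec_def[symmetric])

lemma act_uminus:
  assumes "A \<in> sl3" "u \<in> V"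
  shows "act (- A) u = - act A u"
proof -
  have "- A = mscale (-1) A" by (simp add: mscale_def vec_eq_iff)
  then show ?thesis using act_mscale[OF assms, of "-1"] by simp
qed

lemmas br_simps = vec_eq_iff bracket_entry forall_3 unit_matrix_entry mscale_def

lemma comm_rules:
  assumes "u \<in> V"
  shows "e1 (f1 u) = f1 (e1 u) + h1 u" "e1 (f2 u) = f2 (e1 u)" "e1 (f3 u) = f3 (e1 u) - f2 u"
    "e2 (f1 u) = f1 (e2 u)" "e2 (f2 u) = f2 (e2 u) + h2 u" "e2 (f3 u) = f3 (e2 u) + f1 u"
    "e1 (e2 u) = e2 (e1 u) + e3 u" "f2 (f1 u) = f1 (f2 u) + f3 u"
    "f3 (f1 u) = f1 (f3 u)" "f3 (f2 u) = f2 (f3 u)"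
    "h1 (f1 u) = f1 (h1 u) + cscale (-2) (f1 u)" "h2 (f1 u) = f1 (h2 u) + f1 u"
    "h1 (f2 u) = f2 (h1 u) + f2 u" "h2 (f2 u) = f2 (h2 u) + cscale (-2) (f2 u)"
    "h1 (e1 u) = e1 (h1 u) + cscale 2 (e1 u)" "h2 (e1 u) = e1 (h2 u) - e1 u"
    "h1 (e2 u) = e2 (h1 u) - e2 u" "h2 (e2 u) = e2 (h2 u) + cscale 2 (e2 u)"
proof -
  let ?e = unit_matrix
  have *: "act A (act B u) = act B (act A u) + act C u" if "bracket A B = C" "A \<in> sl3" "B \<in> sl3" for A B C
    using act_bracket[OF that assms] .
  note ** = unit_matrix_sl3 h_sl3
  show "e1 (f1 u) = f1 (e1 u) + h1 u" by (rule *) (simp_all add: br_simps **)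
  show "e2 (f2 u) = f2 (e2 u) + h2 u" by (rule *) (simp_all add: br_simps **)
  show "e2 (f3 u) = f3 (e2 u) + f1 u" by (rule *) (simp_all add: br_simps **)
  show "e1 (e2 u) = e2 (e1 u) + e3 u" by (rule *) (simp_all add: br_simps **)
  show "f2 (f1 u) = f1 (f2 u) + f3 u" by (rule *) (simp_all add: br_simps **)
  show "h2 (f1 u) = f1 (h2 u) + f1 u" by (rule *) (simp_all add: br_simps **)
  show "h1 (f2 u) = f2 (h1 u) + f2 u" by (rule *) (simp_all add: br_simps **)
  have "e1 (f2 u) = f2 (e1 u) + act 0 u" by (rule *) (simp_all add: br_simps **)
  then show "e1 (f2 u) = f2 (e1 u)" by (simp add: act_zero assms)
  have "e2 (f1 u) = f1 (e2 u) + act 0 u" by (rule *) (simp_all add: br_simps **)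
  then show "e2 (f1 u) = f1 (e2 u)" by (simp add: act_zero assms)
  have "f3 (f1 u) = f1 (f3 u) + act 0 u" by (rule *) (simp_all add: br_simps **)
  then show "f3 (f1 u) = f1 (f3 u)" by (simp add: act_zero assms)
  have "f3 (f2 u) = f2 (f3 u) + act 0 u" by (rule *) (simp_all add: br_simps **)
  then show "f3 (f2 u) = f2 (f3 u)" by (simp add: act_zero assms)
  have "e1 (f3 u) = f3 (e1 u) + act (- ?e 3 2) u" by (rule *) (simp_all add: br_simps **)
  then show "e1 (f3 u) = f3 (e1 u) - f2 u" by (simp add: act_uminus ** assms)
  have "h2 (e1 u) = e1 (h2 u) + act (- ?e 1 2) u" by (rule *) (simp_all add: br_simps **)
  then show "h2 (e1 u) = e1 (h2 u) - e1 u" by (simp add: act_uminus ** assms)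
  have "h1 (e2 u) = e2 (h1 u) + act (- ?e 2 3) u" by (rule *) (simp_all add: br_simps **)
  then show "h1 (e2 u) = e2 (h1 u) - e2 u" by (simp add: act_uminus ** assms)
  have "h1 (f1 u) = f1 (h1 u) + act (mscale (-2) (?e 2 1)) u" by (rule *) (simp_all add: br_simps **)
  then show "h1 (f1 u) = f1 (h1 u) + cscale (-2) (f1 u)" using act_mscale[OF unit_matrix_sl3[of 2 1] assms, of "-2"] by simp
  have "h2 (f2 u) = f2 (h2 u) + act (mscale (-2) (?e 3 2)) u" by (rule *) (simp_all add: br_simps **)
  then show "h2 (f2 u) = f2 (h2 u) + cscale (-2) (f2 u)" using act_mscale[OF unit_matrix_sl3[of 3 2] assms, of "-2"] by simp
  have "h1 (e1 u) = e1 (h1 u) + act (mscale 2 (?e 1 2)) u" by (rule *) (simp_all add: br_simps **)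
  then show "h1 (e1 u) = e1 (h1 u) + cscale 2 (e1 u)" using act_mscale[OF unit_matrix_sl3[of 1 2] assms, of "2"] by simp
  have "h2 (e2 u) = e2 (h2 u) + act (mscale 2 (?e 2 3)) u" by (rule *) (simp_all add: br_simps **)
  then show "h2 (e2 u) = e2 (h2 u) + cscale 2 (e2 u)" using act_mscale[OF unit_matrix_sl3[of 2 3] assms, of "2"] by simp
qed

lemma act_expand:
  assumes A: "A \<in> sl3" and u: "u \<in> V"
  shows "act A u = cscale (A $ 1 $ 2) (e1 u) + cscale (A $ 2 $ 3) (e2 u) + cscale (A $ 1 $ 3) (e3 u)
    + cscale (A $ 2 $ 1) (f1 u) + cscale (A $ 3 $ 2) (f2 u) + cscale (A $ 3 $ 1) (f3 u)
    + cscale (A $ 1 $ 1) (h1 u) + cscale (A $ 1 $ 1 + A $ 2 $ 2) (h2 u)"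
proof -
  have ms: "mscale c B \<in> sl3" if "B \<in> sl3" for c B
    using that by (simp add: sl3_def trace_def mscale_def sum_3 flip: distrib_left)
  have ad: "B + C \<in> sl3" if "B \<in> sl3" "C \<in> sl3" for B C
    using that by (simp add: sl3_def trace_add)
  have "A = mscale (A $ 1 $ 2) (unit_matrix 1 2) + mscale (A $ 2 $ 3) (unit_matrix 2 3)
    + mscale (A $ 1 $ 3) (unit_matrix 1 3) + mscale (A $ 2 $ 1) (unit_matrix 2 1)
    + mscale (A $ 3 $ 2) (unit_matrix 3 2) + mscale (A $ 3 $ 1) (unit_matrix 3 1)
    + mscale (A $ 1 $ 1) (unit_matrix 1 1 - unit_matrix 2 2)
    + mscale (A $ 1 $ 1 + A $ 2 $ 2) (unit_matrix 2 2 - unit_matrix 3 3)" (is "A = ?B")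
    using sl3_33[OF A] by (simp add: vec_eq_iff forall_3 unit_matrix_entry mscale_def)
  then have "act A u = act ?B u" by simp
  then show ?thesis
    by (simp add: act_add act_mscale ms ad unit_matrix_sl3 h_sl3 u)
qed

text \<open>The remaining operators \<open>e3\<close>, \<open>f3\<close>, \<open>h1\<close>, \<open>h2\<close> are commutators of the four that are considered.\<close>

lemma generated_submodule:
  assumes U: "cvec.subspace U" "U \<subseteq> V"
    and cl: "\<And>u. u \<in> U \<Longrightarrow> e1 u \<in> U \<and> e2 u \<in> U \<and> f1 u \<in> U \<and> f2 u \<in> U"
    and nz: "U \<noteq> {0}"
  shows "U = V"
proof -
  note c = cvec.subspace_add[OF U(1)] cvec.subspace_diff[OF U(1)] cvec.subspace_scale[OF U(1)]
  have "act A u \<in> U" if A: "A \<in> sl3" and u: "u \<in> U" for A u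
  proof -
    have uV: "u \<in> V" using u U by blast
    note r = comm_rules[OF uV]
    have "e3 u = e1 (e2 u) - e2 (e1 u)" "f3 u = f2 (f1 u) - f1 (f2 u)"
      "h1 u = e1 (f1 u) - f1 (e1 u)" "h2 u = e2 (f2 u) - f2 (e2 u)"
      using r by simp_all
    then have "e3 u \<in> U" "f3 u \<in> U" "h1 u \<in> U" "h2 u \<in> U"
      using cl u by (auto intro!: c)
    then show ?thesis
      unfolding act_expand[OF A uV] using cl u by (intro c) auto
  qed
  then show ?thesis
    using irr U nz by (auto simp: is_irreducible_def)
qed

definition wt :: "weight \<Rightarrow> cvec \<Rightarrow> bool" where
  "wt \<mu> u \<longleftrightarrow> u \<in> V \<and> h1 u = cscale (of_int (fst \<mu>)) u \<and> h2 u = cscale (of_int (snd \<mu>)) u"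

lemma wt_V: "wt \<mu> u \<Longrightarrow> u \<in> V"
  by (simp add: wt_def)

lemma weight_space_iff_wt: "u \<in> weight_space (V, act) \<mu> \<longleftrightarrow> wt \<mu> u"
proof
  assume u: "u \<in> weight_space (V, act) \<mu>"
  have c: "unit_matrix i i - unit_matrix j j \<in> cartan" for i j
    by (auto simp: cartan_def h_sl3 unit_matrix_entry)
  from u c[of 1 2] c[of 2 3] show "wt \<mu> u"
    by (simp add: weight_space_def wt_def weight_eval_def unit_matrix_entry)
next
  assume u: "wt \<mu> u"
  have "act H u = cscale (weight_eval \<mu> H) u" if H: "H \<in> cartan" for H
  proof -
    have "H $ 1 $ 2 = 0" "H $ 1 $ 3 = 0" "H $ 2 $ 3 = 0" "H $ 2 $ 1 = 0" "H $ 3 $ 1 = 0" "H $ 3 $ 2 = 0" "H \<in> sl3"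
      using H by (auto simp: cartan_def)
    with u show ?thesis
      by (subst act_expand) (auto simp: wt_def weight_eval_def mult.commute simp flip: cvec.scale_left_distrib)
  qed
  with u show "u \<in> weight_space (V, act) \<mu>"
    by (simp add: weight_space_def wt_V)
qed

lemma wt_ops:
  assumes "wt (m, n) u"
  shows "wt (m - 2, n + 1) (f1 u)" "wt (m + 1, n - 2) (f2 u)"
    "wt (m + 2, n - 1) (e1 u)" "wt (m - 1, n + 2) (e2 u)"
  using assms
  by (auto simp: wt_def comm_rules op_scale cvec.scale_left_distrib cvec.scale_left_diff_distrib)

lemma wt_f3: "wt (m, n) u \<Longrightarrow> wt (m - 1, n - 1) (f3 u)"
proof -
  assume u: "wt (m, n) u"
  have "wt (m - 1, n - 1) (f2 (f1 u))" "wt (m - 1, n - 1) (f1 (f2 u))"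
    using wt_ops[OF wt_ops(1)[OF u]] wt_ops[OF wt_ops(2)[OF u]] by simp_all
  moreover have "f3 u = f2 (f1 u) + cscale (-1) (f1 (f2 u))"
    using comm_rules(8)[OF wt_V[OF u]] by simp
  ultimately show ?thesis
    by (simp only: wt_def op_add op_scale V_add V_scale cvec.scale_right_distrib cvec.scale_scale mult.commute simp_thms)
qed

end

context sl3_hw_module
begin

section \<open>Weight vectors and singular vectors\<close>

lemma span_V: "S \<subseteq> V \<Longrightarrow> cvec.span S \<subseteq> V"
  by (rule cvec.span_minimal[OF _ subspace_V])

lemma lin_span_closed:
  assumes T: "lin T" and S: "S \<subseteq> V" and gen: "\<And>s. s \<in> S \<Longrightarrow> T s \<in> cvec.span S"
    and x: "x \<in> cvec.span S"
  shows "T x \<in> cvec.span S"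
proof -
  from x have "x \<in> V \<and> T x \<in> cvec.span S"
  proof (induction rule: cvec.span_induct_alt)
    case base
    then show ?case by (simp add: V_0 lin_0[OF T] cvec.span_zero)
  next
    case (step c s y)
    then have "s \<in> V" "y \<in> V" using S by auto
    then have "T (cscale c s + y) = cscale c (T s) + T y"
      by (simp add: lin_add[OF T] lin_scale[OF T] V_scale)
    then show ?case
      using step gen \<open>s \<in> V\<close> by (simp add: V_add V_scale cvec.span_add cvec.span_scale)
  qed
  then show ?thesis ..
qed

lemma eigenvectors_independent:
  assumes T: "lin T" and "finite E"
    and "\<And>\<epsilon>. \<epsilon> \<in> E \<Longrightarrow> y \<epsilon> \<in> V \<and> T (y \<epsilon>) = cscale \<epsilon> (y \<epsilon>)"
    and "(\<Sum>\<epsilon>\<in>E. y \<epsilon>) = 0" and "\<epsilon> \<in> E"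
  shows "y \<epsilon> = 0"
  using assms(2-)
proof (induction E arbitrary: y \<epsilon> rule: finite_induct)
  case (insert d E)
  have yV: "y \<epsilon> \<in> V" "T (y \<epsilon>) = cscale \<epsilon> (y \<epsilon>)" if "\<epsilon> \<in> insert d E" for \<epsilon>
    using insert.prems(1) that by auto
  have s: "y d + (\<Sum>\<epsilon>\<in>E. y \<epsilon>) = 0"
    using insert by simp
  have inV: "(\<Sum>\<epsilon>\<in>E. y \<epsilon>) \<in> V \<and> T (\<Sum>\<epsilon>\<in>E. y \<epsilon>) = (\<Sum>\<epsilon>\<in>E. T (y \<epsilon>))"
    using yV by (intro lin_sum[OF T]) auto
  have "T (y d + (\<Sum>\<epsilon>\<in>E. y \<epsilon>)) = cscale d (y d) + (\<Sum>\<epsilon>\<in>E. cscale \<epsilon> (y \<epsilon>))"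
    using inV yV by (simp add: lin_add[OF T])
  then have "cscale d (y d) + (\<Sum>\<epsilon>\<in>E. cscale \<epsilon> (y \<epsilon>)) = 0"
    by (simp add: s lin_0[OF T])
  moreover have "cscale d (y d) + (\<Sum>\<epsilon>\<in>E. cscale d (y \<epsilon>)) = 0"
    using arg_cong[OF s, of "cscale d"] by (simp add: cvec.scale_right_distrib cvec.scale_sum_right)
  ultimately have z: "(\<Sum>\<epsilon>\<in>E. cscale (\<epsilon> - d) (y \<epsilon>)) = 0"
    by (simp add: cvec.scale_left_diff_distrib sum_subtractf add_eq_0_iff)
  have E0: "y \<epsilon> = 0" if "\<epsilon> \<in> E" for \<epsilon>
  proof -
    have "cscale (\<epsilon> - d) (y \<epsilon>) = 0"
    proof (rule insert.IH[OF _ z that])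
      fix \<eta> assume "\<eta> \<in> E"
      then show "cscale (\<eta> - d) (y \<eta>) \<in> V \<and>
          T (cscale (\<eta> - d) (y \<eta>)) = cscale \<eta> (cscale (\<eta> - d) (y \<eta>))"
        using yV by (simp add: V_scale lin_scale[OF T] mult.commute)
    qed
    moreover have "\<epsilon> \<noteq> d" using that insert.hyps by auto
    ultimately show ?thesis by simp
  qed
  then show ?case using s insert.prems(3) by auto
qed simp

text \<open>Collecting the terms of a linear combination by eigenvalue, independence of eigenvectors removes
  all groups but that of the eigenvalue \<open>c\<close>.\<close>

lemma eigenvector_in_span:
  assumes T: "lin T" and S: "S \<subseteq> V" and ev: "\<And>s. s \<in> S \<Longrightarrow> T s = cscale (ev s) s"
    and x: "x \<in> cvec.span S" "T x = cscale c x"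
  shows "x \<in> cvec.span {s \<in> S. ev s = c}"
proof -
  obtain F r where F: "finite F" "F \<subseteq> S" and xs: "x = (\<Sum>s\<in>F. cscale (r s) s)"
    using x(1) unfolding cvec.span_explicit by blast
  define E where "E = insert c (ev ` F)"
  define z where "z \<epsilon> = (\<Sum>s\<in>{s \<in> F. ev s = \<epsilon>}. cscale (r s) s)" for \<epsilon>
  define y where "y \<epsilon> = (if \<epsilon> = c then z c - x else z \<epsilon>)" for \<epsilon>
  have xV: "x \<in> V" using x span_V[OF S] by blast
  have zV: "z \<epsilon> \<in> V \<and> T (z \<epsilon>) = cscale \<epsilon> (z \<epsilon>)" for \<epsilon>
  proof -
    have "z \<epsilon> \<in> V \<and> T (z \<epsilon>) = (\<Sum>s\<in>{s \<in> F. ev s = \<epsilon>}. T (cscale (r s) s))"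
      unfolding z_def using F S by (intro lin_sum[OF T] V_scale) auto
    moreover have "(\<Sum>s\<in>{s \<in> F. ev s = \<epsilon>}. T (cscale (r s) s)) = cscale \<epsilon> (z \<epsilon>)"
      unfolding z_def cvec.scale_sum_right
    proof (rule sum.cong[OF refl])
      fix s assume "s \<in> {s \<in> F. ev s = \<epsilon>}"
      then show "T (cscale (r s) s) = cscale \<epsilon> (cscale (r s) s)"
        using F S by (subst lin_scale[OF T]) (auto simp: ev mult.commute)
    qed
    ultimately show ?thesis by simp
  qed
  have "T (z c + cscale (-1) x) = cscale c (z c + cscale (-1) x)"
    using zV[of c] xV x(2)
    by (simp only: lin_add[OF T] lin_scale[OF T] V_scale cvec.scale_right_distrib cvec.scale_scale mult.commute)
  then have yT: "y \<epsilon> \<in> V \<and> T (y \<epsilon>) = cscale \<epsilon> (y \<epsilon>)" for \<epsilon>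
    using zV xV cvec.subspace_diff[OF subspace_V] by (auto simp: y_def)
  have "(\<Sum>\<epsilon>\<in>E. z \<epsilon>) = x"
    unfolding z_def xs using F by (intro sum.group) (auto simp: E_def)
  moreover have "finite E" "c \<in> E" using F by (auto simp: E_def)
  ultimately have "(\<Sum>\<epsilon>\<in>E. y \<epsilon>) = 0"
    by (auto simp: y_def sum.remove[of E c] sum.cong[of "E - {c}" _ y z])
  then have "y c = 0"
    using eigenvectors_independent[OF T \<open>finite E\<close>, of y c] yT \<open>c \<in> E\<close> by blast
  then have "x = z c" by (simp add: y_def)
  also have "\<dots> \<in> cvec.span {s \<in> S. ev s = c}"
    unfolding z_def using F(2) by (intro cvec.span_sum cvec.span_scale cvec.span_base) auto
  finally show ?thesis .
qed

text \<open>The eigenvalue \<open>m + \<i> n\<close> on vectors of weight \<open>(m, n)\<close> determines the weight, so that one operator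
  separates all weights.\<close>

definition sep :: "cvec \<Rightarrow> cvec" where
  "sep u = h1 u + cscale \<i> (h2 u)"

lemma lin_sep: "lin sep"
  unfolding lin_def sep_def
  by (auto simp: op_add op_scale V_add V_scale cvec.scale_right_distrib mult.commute)

lemma sep_wt: "wt \<mu> u \<Longrightarrow> sep u = cscale (Complex (of_int (fst \<mu>)) (of_int (snd \<mu>))) u"
  by (simp add: sep_def wt_def complex_eq_iff Complex_eq cvec.scale_left_distrib)

lemma weight_vector_in_span:
  assumes S: "\<And>s. s \<in> S \<Longrightarrow> wt (w s) s" and x: "x \<in> cvec.span S" "wt \<mu> x"
  shows "x \<in> cvec.span {s \<in> S. w s = \<mu>}"
proof -
  let ?ev = "\<lambda>\<nu>. Complex (of_int (fst \<nu>)) (of_int (snd \<nu>))"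
  have SV: "S \<subseteq> V" using S wt_V by blast
  have "x \<in> cvec.span {s \<in> S. ?ev (w s) = ?ev \<mu>}"
    using S x SV by (intro eigenvector_in_span[OF lin_sep]) (auto simp: sep_wt)
  moreover have "{s \<in> S. ?ev (w s) = ?ev \<mu>} = {s \<in> S. w s = \<mu>}"
    by (auto simp: prod_eq_iff)
  ultimately show ?thesis by simp
qed

fun lowering_word :: "bool list \<Rightarrow> cvec \<Rightarrow> cvec" where
  "lowering_word [] u = u"
| "lowering_word (True # is) u = f1 (lowering_word is u)"
| "lowering_word (False # is) u = f2 (lowering_word is u)"

lemma lowering_word_wt:
  assumes u: "wt (m, n) u"
  shows "\<exists>i j. wt (m - 2 * int i + int j, n + int i - 2 * int j) (lowering_word is u)"
proof (induction "is")
  case Nil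
  have "wt (m - 2 * int 0 + int 0, n + int 0 - 2 * int 0) (lowering_word [] u)"
    using u by simp
  then show ?case by blast
next
  case (Cons c "is")
  then obtain i j where ij: "wt (m - 2 * int i + int j, n + int i - 2 * int j) (lowering_word is u)" by blast
  show ?case
  proof (cases c)
    case True
    have "wt (m - 2 * int (Suc i) + int j, n + int (Suc i) - 2 * int j) (lowering_word (c # is) u)"
      using wt_ops(1)[OF ij] True by (simp add: algebra_simps)
    then show ?thesis by blast
  next
    case False
    have "wt (m - 2 * int i + int (Suc j), n + int i - 2 * int (Suc j)) (lowering_word (c # is) u)"
      using wt_ops(2)[OF ij] False by (simp add: algebra_simps)
    then show ?thesis by blast
  qed
qed

text \<open>A raising operator can be moved to the right through a word of lowering operators at the cost of
  shorter words, until it kills \<open>u\<close>.  So the words applied to \<open>u\<close> span a submodule.\<close>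

lemma singular_vector_generates:
  assumes u: "wt \<mu> u" "u \<noteq> 0" and e: "e1 u = 0" "e2 u = 0"
  shows "cvec.span (range (\<lambda>is. lowering_word is u)) = V"
proof (rule generated_submodule)
  let ?S = "range (\<lambda>is. lowering_word is u)"
  let ?U = "cvec.span ?S"
  have wordwt: "\<exists>\<nu>. wt \<nu> (lowering_word is u)" for "is"
    using lowering_word_wt[of "fst \<mu>" "snd \<mu>" u "is"] u by (auto simp: prod.collapse)
  then have wV: "lowering_word is u \<in> V" for "is" using wt_V by blast
  then have SV: "?S \<subseteq> V" by blast
  have fS: "f1 s \<in> ?S" "f2 s \<in> ?S" if "s \<in> ?S" for s
  proof -
    from that obtain "is" where "s = lowering_word is u" by blast
    then have "f1 s = lowering_word (True # is) u" "f2 s = lowering_word (False # is) u" by simp_all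
    then show "f1 s \<in> ?S" "f2 s \<in> ?S" by (metis rangeI)+
  qed
  have f: "f1 x \<in> ?U" "f2 x \<in> ?U" if "x \<in> ?U" for x
    using that by (auto intro: lin_span_closed[OF _ SV] lin_op cvec.span_base fS)
  have hU: "h1 (lowering_word is u) \<in> ?U" "h2 (lowering_word is u) \<in> ?U" for "is"
    using wordwt[of "is"] by (auto simp: wt_def intro!: cvec.span_scale cvec.span_base[OF rangeI])
  have "e1 (lowering_word is u) \<in> ?U \<and> e2 (lowering_word is u) \<in> ?U" for "is"
  proof (induction "is")
    case Nil
    then show ?case by (simp add: e cvec.span_zero)
  next
    case (Cons c "is")
    show ?case
      by (cases c) (auto simp: comm_rules wV Cons f hU cvec.span_add)
  qed
  then have eU: "e1 x \<in> ?U" "e2 x \<in> ?U" if "x \<in> ?U" for x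
    using that by (auto intro: lin_span_closed[OF _ SV] lin_op)
  show "cvec.subspace ?U" by simp
  show "?U \<subseteq> V" by (rule span_V[OF SV])
  show "e1 x \<in> ?U \<and> e2 x \<in> ?U \<and> f1 x \<in> ?U \<and> f2 x \<in> ?U" if "x \<in> ?U" for x
    using eU f that by blast
  have "u \<in> ?U" by (rule cvec.span_base) (metis rangeI lowering_word.simps(1))
  then show "?U \<noteq> {0}" using u(2) by blast
qed

lemma singular_vector_dominates:
  assumes u: "wt (m, n) u" "u \<noteq> 0" and e: "e1 u = 0" "e2 u = 0" and x: "wt \<nu> x" "x \<noteq> 0"
  shows "\<exists>i j. \<nu> = (m - 2 * int i + int j, n + int i - 2 * int j)"
proof -
  let ?S = "range (\<lambda>is. lowering_word is u)"
  have "\<forall>s\<in>?S. \<exists>i j. wt (m - 2 * int i + int j, n + int i - 2 * int j) s"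
    using lowering_word_wt[OF u(1)] by blast
  then obtain i j where ij: "\<And>s. s \<in> ?S \<Longrightarrow> wt (m - 2 * int (i s) + int (j s), n + int (i s) - 2 * int (j s)) s"
    by metis
  have "x \<in> cvec.span ?S"
    using singular_vector_generates[OF u e] x wt_V by blast
  from weight_vector_in_span[OF ij this x(1)] x(2)
  have "{s \<in> ?S. (m - 2 * int (i s) + int (j s), n + int (i s) - 2 * int (j s)) = \<nu>} \<noteq> {}"
    by (metis cvec.span_empty singletonD)
  then show ?thesis by blast
qed

lemma v0_wt: "wt (int a, int b) v0"
  using v0_weight weight_space_iff_wt by blast

text \<open>Two nonzero singular vectors would each have a weight below that of the other.  This is the way in
  which relations between lowering operators are obtained below.\<close>

lemma singular_vector_zero:
  assumes u: "wt \<mu> u" and e: "e1 u = 0" "e2 u = 0" and "\<mu> \<noteq> (int a, int b)"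
  shows "u = 0"
proof (rule ccontr)
  assume nz: "u \<noteq> 0"
  obtain m n where mn: "\<mu> = (m, n)" by fastforce
  obtain i j where "(int a, int b) = (m - 2 * int i + int j, n + int i - 2 * int j)"
    using singular_vector_dominates[OF u[unfolded mn] nz e v0_wt v0_nz] by blast
  moreover obtain i' j' where "(m, n) = (int a - 2 * int i' + int j', int b + int i' - 2 * int j')"
    using singular_vector_dominates[OF v0_wt v0_nz e1_v0 e2_v0 u[unfolded mn] nz] by blast
  ultimately have "m = int a" "n = int b" by auto
  with assms(4) mn show False by simp
qed

end

context sl3_hw_module
begin

section \<open>Gelfand-Tsetlin vectors\<close>

text \<open>These are highest weight vectors for the subalgebra \<open>sl(2)\<close> of \<open>e1\<close>, \<open>h1\<close>, \<open>f1\<close>: if \<open>e1\<close> kills a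
  vector with \<open>h1\<close>-weight \<open>m\<close>, then it also kills its images under \<open>f2\<close> and under
  \<open>(m + 1) f3 + f1 f2\<close>.  The scalar below is \<open>m + 1\<close> for the vector \<open>\<xi> p q\<close>.\<close>

primrec \<xi> :: "nat \<Rightarrow> nat \<Rightarrow> cvec" where
  "\<xi> 0 = (\<lambda>q. (f2 ^^ q) v0)"
| "\<xi> (Suc p) = (\<lambda>q. cscale (of_nat a + of_nat q - of_nat p + 1) (f3 (\<xi> p q)) + f1 (f2 (\<xi> p q)))"

lemma \<xi>_wt: "wt (int a + int q - int p, int b - 2 * int q - int p) (\<xi> p q)"
proof (induction p arbitrary: q)
  case 0
  show ?case
  proof (induction q)
    case (Suc q)
    show ?case using wt_ops(2)[OF Suc] by (simp add: algebra_simps)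
  qed (simp add: v0_wt)
next
  case (Suc p)
  let ?m = "(int a + int q - int (Suc p), int b - 2 * int q - int (Suc p))"
  have 1: "wt ?m (f3 (\<xi> p q))"
    using wt_f3[OF Suc[of q]] by (simp add: algebra_simps)
  have 2: "wt ?m (f1 (f2 (\<xi> p q)))"
    using wt_ops(1)[OF wt_ops(2)[OF Suc[of q]]] by (simp add: algebra_simps)
  show ?case
    using 1 2
    by (simp add: wt_def op_add op_scale V_add V_scale cvec.scale_right_distrib mult.commute)
qed

lemmas \<xi>_V [simp] = \<xi>_wt[THEN wt_V]

lemma h1_\<xi>: "h1 (\<xi> p q) = cscale (of_nat a + of_nat q - of_nat p) (\<xi> p q)"
  using \<xi>_wt[of q p] by (simp add: wt_def)

lemma h2_\<xi>: "h2 (\<xi> p q) = cscale (of_nat b - 2 * of_nat q - of_nat p) (\<xi> p q)"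
  using \<xi>_wt[of q p] by (simp add: wt_def)

text \<open>The operator \<open>f2\<close> raises \<open>m\<close> by one; the additional \<open>f3\<close> is the commutator of \<open>f2\<close> and \<open>f1\<close>.\<close>

lemma f2_\<xi>: "f2 (\<xi> p q) = \<xi> p (Suc q)"
proof (induction p arbitrary: q)
  case (Suc p)
  let ?u = "\<xi> p q" let ?c = "of_nat a + of_nat q - of_nat p + 1 :: complex"
  have "f2 (\<xi> (Suc p) q) = cscale ?c (f3 (f2 ?u)) + (f1 (f2 (f2 ?u)) + f3 (f2 ?u))"
    by (simp add: op_add op_scale V_scale comm_rules)
  also have "\<dots> = \<xi> (Suc p) (Suc q)"
    by (simp add: Suc cvec.scale_left_distrib algebra_simps)
  finally show ?case .
qed simp

lemma e1_\<xi>: "e1 (\<xi> p q) = 0"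
proof (induction p arbitrary: q)
  case 0
  show ?case
  proof (induction q)
    case (Suc q)
    then show ?case using comm_rules(2)[OF \<xi>_V[of 0 q]] by simp
  qed (simp add: e1_v0)
next
  case (Suc p)
  have "h1 (f2 (\<xi> p q)) = cscale (of_nat a + of_nat q - of_nat p + 1) (f2 (\<xi> p q))"
    unfolding f2_\<xi> h1_\<xi> by (simp add: algebra_simps)
  then show ?case
    by (simp add: op_add op_scale V_scale comm_rules Suc)
qed

lemma e2_\<xi>_0: "e2 (\<xi> 0 (Suc q)) = cscale ((of_nat q + 1) * (of_nat b - of_nat q)) (\<xi> 0 q)"
proof (induction q)
  case 0
  have "e2 (f2 v0) = f2 (e2 v0) + h2 v0"
    using comm_rules(5)[OF wt_V[OF v0_wt]] .
  then show ?case using h2_\<xi>[of 0 0] by (simp add: e2_v0)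
next
  case (Suc q)
  have "e2 (\<xi> 0 (Suc (Suc q))) = f2 (e2 (\<xi> 0 (Suc q))) + h2 (\<xi> 0 (Suc q))"
    using comm_rules(5)[OF \<xi>_V[of 0 "Suc q"]] by (simp only: f2_\<xi>)
  also have "\<dots> = cscale ((of_nat q + 1) * (of_nat b - of_nat q)) (\<xi> 0 (Suc q))
      + cscale (of_nat b - 2 * of_nat (Suc q)) (\<xi> 0 (Suc q))"
    unfolding Suc h2_\<xi> by (simp only: op_scale \<xi>_V f2_\<xi>) simp
  also have "\<dots> = cscale ((of_nat (Suc q) + 1) * (of_nat b - of_nat (Suc q))) (\<xi> 0 (Suc q))"
    unfolding cvec.scale_left_distrib[symmetric] by (rule arg_cong[where f = "\<lambda>c. cscale c _"]) (simp add: algebra_simps)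
  finally show ?case .
qed

text \<open>The coefficients \<open>cA\<close> and \<open>cB\<close> describe \<open>e2\<close> on the Gelfand-Tsetlin vectors.  Both denominators are
  the number \<open>m + 1\<close> for \<open>\<xi> p q\<close>, which is positive as long as \<open>p \<le> a + q\<close>.\<close>

definition cA :: "nat \<Rightarrow> nat \<Rightarrow> complex" where
  "cA p q = of_nat q * (of_nat b - of_nat q + 1) * (of_nat a + of_nat q + 1) / (of_nat a + of_nat q + 1 - of_nat p)"

definition cB :: "nat \<Rightarrow> nat \<Rightarrow> complex" where
  "cB p q = of_nat p * (of_nat a - of_nat p + 1) * (of_nat a + of_nat b + 2 - of_nat p) / (of_nat a + of_nat q - of_nat p + 1)"

lemma nonzero_denominator: "p \<le> a + q \<Longrightarrow> of_nat a + of_nat q - of_nat p + 1 \<noteq> (0::complex)"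
proof -
  assume "p \<le> a + q"
  then have "of_nat a + of_nat q - of_nat p + 1 = (of_nat (a + q - p + 1) :: complex)"
    by (simp add: of_nat_diff)
  then show ?thesis by (simp only: of_nat_eq_0_iff)
qed

lemma cB_Suc:
  assumes "of_nat a + of_nat q - of_nat p \<noteq> (0::complex)"
  shows "cB (Suc p) q * (of_nat a + of_nat q - of_nat p) =
    (of_nat p + 1) * (of_nat a - of_nat p) * (of_nat a + of_nat b + 1 - of_nat p)"
proof -
  have "of_nat a + of_nat q - of_nat (Suc p) + 1 = (of_nat a + of_nat q - of_nat p :: complex)"
    by simp
  then have "cB (Suc p) q * (of_nat a + of_nat q - of_nat p) =
      of_nat (Suc p) * (of_nat a - of_nat (Suc p) + 1) * (of_nat a + of_nat b + 2 - of_nat (Suc p))"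
    unfolding cB_def by (simp only: times_divide_eq_left nonzero_mult_div_cancel_right[OF assms])
  then show ?thesis by (simp add: algebra_simps)
qed

lemma cA_mult:
  assumes "of_nat a + of_nat q - of_nat p + 1 \<noteq> (0::complex)"
  shows "cA p q * (of_nat a + of_nat q - of_nat p + 1) =
    of_nat q * (of_nat b - of_nat q + 1) * (of_nat a + of_nat q + 1)"
proof -
  have "of_nat a + of_nat q + 1 - of_nat p = (of_nat a + of_nat q - of_nat p + 1 :: complex)"
    by simp
  then show ?thesis
    unfolding cA_def by (simp only: times_divide_eq_left nonzero_mult_div_cancel_right[OF assms])
qed

lemma f3_\<xi>:
  assumes "p \<le> a"
  shows "f3 (\<xi> p q) = cscale (1 / (of_nat a + of_nat q - of_nat p + 1)) (\<xi> (Suc p) q - f1 (\<xi> p (Suc q)))"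
proof -
  have "\<xi> (Suc p) q - f1 (\<xi> p (Suc q)) = cscale (of_nat a + of_nat q - of_nat p + 1) (f3 (\<xi> p q))"
    by (simp add: f2_\<xi>)
  then show ?thesis
    using nonzero_denominator[of p q] assms by simp
qed

text \<open>Induction on \<open>p\<close>, moving \<open>e2\<close> to the right through \<open>(m + 1) f3 + f1 f2\<close>.  This produces \<open>f3\<close> on a
  vector with smaller \<open>q\<close>, which is expressed by Gelfand-Tsetlin vectors again at the cost of dividing
  by \<open>m\<close>; the assumption on \<open>p\<close> keeps \<open>m\<close> positive.  At \<open>0\<close> the truncated predecessors come with
  the coefficients \<open>cA p 0 = 0\<close> and \<open>cB 0 q = 0\<close>.\<close>

lemma e2_\<xi>:
  assumes "p \<le> a"
  shows "e2 (\<xi> p q) = cscale (cA p q) (\<xi> p (q - 1)) + cscale (cB p q) (f1 (\<xi> (p - 1) q))"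
  using assms
proof (induction p arbitrary: q)
  case 0
  show ?case
  proof (cases q)
    case 0
    then show ?thesis by (simp add: cA_def cB_def e2_v0)
  next
    case (Suc r)
    have "cA 0 q = (of_nat r + 1) * (of_nat b - of_nat r)"
      using nonzero_denominator[of 0 q] Suc by (simp add: cA_def)
    then show ?thesis
      using e2_\<xi>_0[of r] Suc by (simp add: cB_def del: \<xi>.simps)
  qed
next
  case (Suc p)
  let ?a = "of_nat a :: complex" and ?b = "of_nat b :: complex"
  let ?p = "of_nat p :: complex" and ?q = "of_nat q :: complex"
  let ?m = "?a + ?q - ?p" and ?u = "\<xi> p q"
  have IH: "e2 (\<xi> p q) = cscale (cA p q) (\<xi> p (q - 1)) + cscale (cB p q) (f1 (\<xi> (p - 1) q))"
    by (rule Suc.IH) (use Suc.prems in simp)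
  have m0: "?m \<noteq> 0"
    using nonzero_denominator[of "Suc p" q] Suc.prems by (simp add: algebra_simps)
  have m1: "?m + 1 \<noteq> 0"
    using nonzero_denominator[of p q] Suc.prems by simp
  have "e2 (\<xi> (Suc p) q) = cscale (?m + 1) (f3 (e2 ?u) + f1 ?u) + f1 (f2 (e2 ?u) + cscale (?b - 2 * ?q - ?p) ?u)"
    by (simp add: op_add op_scale V_scale comm_rules h2_\<xi>)
  also have "\<dots> = cscale (?m + 1) (f3 (e2 ?u)) + f1 (f2 (e2 ?u)) + cscale (?m + 1 + (?b - 2 * ?q - ?p)) (f1 ?u)"
    by (simp only: op_add op_scale V_scale op_V V_add \<xi>_V)
      (rule poly_mapping_eqI, simp only: lookup_add lookup_cscale, simp add: algebra_simps)
  also have "cscale (?m + 1) (f3 (e2 ?u)) + f1 (f2 (e2 ?u)) =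
      cscale (cA p q) (cscale (?m + 1) (f3 (\<xi> p (q - 1))) + f1 (f2 (\<xi> p (q - 1))))
      + cscale (cB p q) (cscale (?m + 1) (f3 (f1 (\<xi> (p - 1) q))) + f1 (f2 (f1 (\<xi> (p - 1) q))))"
    unfolding IH by (simp add: op_add op_scale V_scale V_add cvec.scale_right_distrib mult.commute add_ac)
  also have "cscale (cA p q) (cscale (?m + 1) (f3 (\<xi> p (q - 1))) + f1 (f2 (\<xi> p (q - 1)))) =
      cscale (cA (Suc p) q) (\<xi> (Suc p) (q - 1)) - cscale (cA p q / ?m) (f1 ?u)"
  proof (cases q)
    case 0
    then show ?thesis by (simp add: cA_def)
  next
    case (Suc r)
    have f3: "f3 (\<xi> p r) = cscale (1 / ?m) (\<xi> (Suc p) r - f1 ?u)"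
      using f3_\<xi>[of p r] Suc.prems \<open>q = Suc r\<close> Suc_leD[OF \<open>Suc p \<le> a\<close>] by (simp add: algebra_simps)
    have A: "cA (Suc p) q = cA p q * (?m + 1) / ?m"
      using m0 m1 by (simp add: cA_def divide_simps) (simp add: algebra_simps)
    show ?thesis
      unfolding \<open>q = Suc r\<close> diff_Suc_1 f3[unfolded \<open>q = Suc r\<close>] f2_\<xi> A[unfolded \<open>q = Suc r\<close>]
      using m0[unfolded \<open>q = Suc r\<close>]
      by (intro poly_mapping_eqI) (simp add: lookup_add lookup_minus lookup_cscale field_simps del: \<xi>.simps of_nat_Suc)
  qed
  also have "cscale (cB p q) (cscale (?m + 1) (f3 (f1 (\<xi> (p - 1) q))) + f1 (f2 (f1 (\<xi> (p - 1) q)))) =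
      cscale (cB p q) (f1 ?u)"
  proof (cases p)
    case 0
    then show ?thesis by (simp add: cB_def)
  next
    case (Suc r)
    let ?w = "\<xi> r q"
    have "?m + 2 = ?a + ?q - of_nat r + 1"
      by (simp add: Suc)
    then have "\<xi> p q = cscale (?m + 2) (f3 ?w) + f1 (f2 ?w)"
      by (simp only: Suc \<xi>.simps)
    then have "f1 (\<xi> p q) = f1 (cscale (?m + 2) (f3 ?w)) + f1 (f1 (f2 ?w))"
      by (simp only: op_add V_scale op_V \<xi>_V)
    moreover have "cscale (?m + 1) (f3 (f1 ?w)) + f1 (f2 (f1 ?w)) =
        cscale (?m + 1) (f1 (f3 ?w)) + (f1 (f1 (f2 ?w)) + f1 (f3 ?w))"
      by (simp add: comm_rules op_add)
    ultimately have "cscale (?m + 1) (f3 (f1 ?w)) + f1 (f2 (f1 ?w)) = f1 (\<xi> p q)"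
      by (simp only: op_scale op_V \<xi>_V)
        (rule poly_mapping_eqI, simp only: lookup_add lookup_cscale, simp add: algebra_simps)
    then show ?thesis by (simp only: Suc diff_Suc_1)
  qed
  finally have main: "e2 (\<xi> (Suc p) q) = cscale (cA (Suc p) q) (\<xi> (Suc p) (q - 1)) - cscale (cA p q / ?m) (f1 ?u)
      + cscale (cB p q) (f1 ?u) + cscale (?m + 1 + (?b - 2 * ?q - ?p)) (f1 ?u)" .
  have "cB (Suc p) q = cB p q - cA p q / ?m + (?m + 1 + (?b - 2 * ?q - ?p))"
  proof -
    have "cB (Suc p) q * ?m = (?p + 1) * (?a - ?p) * (?a + ?b + 1 - ?p)"
      by (rule cB_Suc[OF m0])
    moreover have "cB p q * (?m + 1) = ?p * (?a - ?p + 1) * (?a + ?b + 2 - ?p)"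
      using m1 by (simp add: cB_def)
    moreover have "cA p q * (?m + 1) = ?q * (?b - ?q + 1) * (?a + ?q + 1)"
      by (rule cA_mult[OF m1])
    moreover have "(m + 1) * m * (y - x / m + t) = m * (y * (m + 1)) - x * (m + 1) + (m + 1) * m * t"
      if "m \<noteq> 0" for m x y t :: complex
      using that by (simp add: field_simps)
    note this[OF m0, of "cB p q" "cA p q" "?m + 1 + (?b - 2 * ?q - ?p)"]
    ultimately have "(?m + 1) * ?m * cB (Suc p) q =
        (?m + 1) * ?m * (cB p q - cA p q / ?m + (?m + 1 + (?b - 2 * ?q - ?p)))"
      by algebra
    then show ?thesis using m0 m1 by simp
  qed
  then show ?case
    by (simp only: main cvec.scale_left_distrib cvec.scale_left_diff_distrib diff_Suc_1) simp
qed

text \<open>As \<open>e1\<close> kills the vector, \<open>e3\<close> acts on it as \<open>e1 e2\<close>.  Only the second term of \<open>e2\<close> survives \<open>e1\<close>, and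
  the factor \<open>m\<close> from \<open>e1 f1\<close> cancels the denominator of \<open>cB\<close>.\<close>

lemma e3_\<xi>:
  assumes "p < a"
  shows "e3 (\<xi> (Suc p) q) = cscale ((of_nat p + 1) * (of_nat a - of_nat p) * (of_nat a + of_nat b + 1 - of_nat p)) (\<xi> p q)"
proof -
  let ?m = "of_nat a + of_nat q - of_nat p :: complex"
  have m0: "?m \<noteq> 0"
    using nonzero_denominator[of "Suc p" q] assms by (simp add: algebra_simps)
  have "e3 (\<xi> (Suc p) q) = e1 (e2 (\<xi> (Suc p) q))"
    using comm_rules(7)[OF \<xi>_V[of "Suc p" q]] by (simp add: e1_\<xi> del: \<xi>.simps)
  also have "\<dots> = cscale (cB (Suc p) q) (e1 (f1 (\<xi> p q)))"
    using e2_\<xi>[of "Suc p" q] assms by (simp add: op_add op_scale V_scale e1_\<xi> del: \<xi>.simps)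
  also have "e1 (f1 (\<xi> p q)) = cscale ?m (\<xi> p q)"
    by (simp add: comm_rules e1_\<xi> h1_\<xi> del: \<xi>.simps)
  also have "cscale (cB (Suc p) q) (cscale ?m (\<xi> p q)) =
      cscale ((of_nat p + 1) * (of_nat a - of_nat p) * (of_nat a + of_nat b + 1 - of_nat p)) (\<xi> p q)"
    unfolding cvec.scale_scale
    by (subst cB_Suc[OF m0]) simp
  finally show ?thesis .
qed

text \<open>Applying \<open>e3\<close> while \<open>p > 0\<close> and then \<open>e2\<close> leads back to a multiple of \<open>v0\<close>, with
  a factor that is nonzero in this range.\<close>

lemma \<xi>_nonzero: "p \<le> a \<Longrightarrow> q \<le> b \<Longrightarrow> \<xi> p q \<noteq> 0"
proof (induction p)
  case 0
  then show ?case
  proof (induction q)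
    case (Suc q)
    then have "of_nat q + 1 \<noteq> (0::complex)" "of_nat b - of_nat q \<noteq> (0::complex)"
      using of_nat_neq_0[of q, where 'a = complex] by (simp_all add: add.commute)
    with Suc have "e2 (\<xi> 0 (Suc q)) \<noteq> 0"
      unfolding e2_\<xi>_0 by simp
    then show ?case by (metis op_0(2))
  qed (simp add: v0_nz)
next
  case (Suc p)
  have "of_nat p + 1 \<noteq> (0::complex)" "of_nat a - of_nat p \<noteq> (0::complex)"
    "of_nat a + of_nat b + 1 - of_nat p \<noteq> (0::complex)"
  proof -
    show "of_nat p + 1 \<noteq> (0::complex)"
      using of_nat_neq_0[of p, where 'a = complex] by (simp add: add.commute)
    show "of_nat a - of_nat p \<noteq> (0::complex)" using Suc by simp
    have "of_nat a + of_nat b + 1 - of_nat p = (of_nat (a + b + 1 - p) :: complex)"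
      using Suc by (simp add: of_nat_diff)
    then show "of_nat a + of_nat b + 1 - of_nat p \<noteq> (0::complex)"
      using Suc by (simp only: of_nat_eq_0_iff)
  qed
  with Suc have "e3 (\<xi> (Suc p) q) \<noteq> 0"
    by (subst e3_\<xi>) auto
  then show ?case by (metis op_0(3))
qed

end

section \<open>A basis of each weight space\<close>

lemma dim_span_independent_family:
  assumes fin: "finite I"
    and ind: "\<And>c i. (\<Sum>i\<in>I. cscale (c i) (g i)) = 0 \<Longrightarrow> i \<in> I \<Longrightarrow> c i = 0"
  shows "cvec.dim (cvec.span (g ` I)) = card I"
proof -
  have inj: "inj_on g I"
  proof (rule inj_onI, rule ccontr)
    fix i j assume ij: "i \<in> I" "j \<in> I" "g i = g j" "i \<noteq> j"
    let ?c = "\<lambda>l. if l = i then 1 else if l = j then -1 else (0::complex)"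
    have "(\<Sum>l\<in>I. cscale (?c l) (g l)) = (\<Sum>l\<in>{i, j}. cscale (?c l) (g l))"
      using ij fin by (intro sum.mono_neutral_right) auto
    also have "\<dots> = 0" using ij by simp
    finally have "?c i = 0" by (rule ind) (rule ij)
    then show False by simp
  qed
  have "cvec.independent (g ` I)"
  proof
    assume "cvec.dependent (g ` I)"
    then obtain r v where v: "v \<in> g ` I" "r v \<noteq> 0" and s: "(\<Sum>v\<in>g ` I. cscale (r v) v) = 0"
      using cvec.dependent_finite[of "g ` I"] fin by auto
    have "(\<Sum>i\<in>I. cscale (r (g i)) (g i)) = 0"
      using s by (simp add: sum.reindex[OF inj])
    then have "r (g i) = 0" if "i \<in> I" for i using ind[of "\<lambda>i. r (g i)"] that by blast
    then show False using v by blast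
  qed
  then show ?thesis
    using cvec.dim_eq_card_independent[of "g ` I"] card_image[OF inj] by simp
qed

text \<open>The triple \<open>(p, q, k)\<close> stands for the vector \<open>(f1 ^^ k) (\<xi> p q)\<close>, of weight \<open>\<mu>\<close>.  The bounds
  are the interlacing conditions of Gelfand-Tsetlin patterns, in coordinates that count from the
  highest weight.\<close>

definition gt_patterns :: "nat \<Rightarrow> nat \<Rightarrow> weight \<Rightarrow> (nat \<times> nat \<times> nat) set" where
  "gt_patterns a b \<mu> = {(p, q, k). p \<le> a \<and> q \<le> b \<and> k \<le> a + q - p \<and>
     \<mu> = (int a + int q - int p - 2 * int k, int b - 2 * int q - int p + int k)}"

context sl3_hw_module
begin

lemma wt_unique: "wt \<mu> u \<Longrightarrow> wt \<nu> u \<Longrightarrow> u \<noteq> 0 \<Longrightarrow> \<mu> = \<nu>"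
  by (auto simp: wt_def prod_eq_iff)

lemma f1_pow_V [simp]: "u \<in> V \<Longrightarrow> (f1 ^^ k) u \<in> V"
  by (rule lin_V[OF lin_pow[OF lin_op(4)]])

lemma f1_pow_wt: "wt (m, n) u \<Longrightarrow> wt (m - 2 * int k, n + int k) ((f1 ^^ k) u)"
proof (induction k)
  case (Suc k)
  then show ?case using wt_ops(1)[of "m - 2 * int k" "n + int k" "(f1 ^^ k) u"] by (simp add: algebra_simps)
qed simp

lemma e1_f1_pow:
  assumes u: "u \<in> V" "e1 u = 0" "h1 u = cscale m u"
  shows "e1 ((f1 ^^ Suc k) u) = cscale (of_nat (Suc k) * (m - of_nat k)) ((f1 ^^ k) u)"
proof -
  have h: "h1 ((f1 ^^ k) u) = cscale (m - 2 * of_nat k) ((f1 ^^ k) u)" for k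
  proof (induction k)
    case (Suc k)
    have "h1 ((f1 ^^ Suc k) u) = cscale (m - 2 * of_nat k) ((f1 ^^ Suc k) u) + cscale (-2) ((f1 ^^ Suc k) u)"
      using comm_rules(11)[of "(f1 ^^ k) u"] u Suc by (simp only: op_scale f1_pow_V funpow.simps o_apply)
    also have "\<dots> = cscale (m - 2 * of_nat (Suc k)) ((f1 ^^ Suc k) u)"
      unfolding cvec.scale_left_distrib[symmetric]
      by (rule arg_cong[where f = "\<lambda>c. cscale c _"]) (simp add: algebra_simps)
    finally show ?case .
  qed (simp add: u)
  show ?thesis
  proof (induction k)
    case 0
    then show ?case using u comm_rules(1)[OF u(1)] by simp
  next
    case (Suc k)
    have "e1 ((f1 ^^ Suc (Suc k)) u) = f1 (e1 ((f1 ^^ Suc k) u)) + h1 ((f1 ^^ Suc k) u)"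
      using comm_rules(1)[of "(f1 ^^ Suc k) u"] u by simp
    also have "\<dots> = cscale (of_nat (Suc k) * (m - of_nat k) + (m - 2 * of_nat (Suc k))) ((f1 ^^ Suc k) u)"
      unfolding Suc h using u by (simp only: op_scale f1_pow_V cvec.scale_left_distrib funpow.simps o_apply)
    also have "of_nat (Suc k) * (m - of_nat k) + (m - 2 * of_nat (Suc k)) = of_nat (Suc (Suc k)) * (m - of_nat (Suc k))"
      by (simp add: algebra_simps)
    finally show ?case .
  qed
qed

lemma e2_f1_pow: "u \<in> V \<Longrightarrow> e2 ((f1 ^^ k) u) = (f1 ^^ k) (e2 u)"
  by (induction k) (simp_all add: comm_rules)

lemma f2_f1_pow:
  assumes u: "u \<in> V"
  shows "f2 ((f1 ^^ Suc k) u) = (f1 ^^ Suc k) (f2 u) + cscale (of_nat (Suc k)) ((f1 ^^ k) (f3 u))"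
proof -
  have f3: "f3 ((f1 ^^ k) u) = (f1 ^^ k) (f3 u)" for k
    using u by (induction k) (simp_all add: comm_rules)
  show ?thesis
  proof (induction k)
    case 0
    then show ?case using comm_rules(8)[OF u] by simp
  next
    case (Suc k)
    have "f2 ((f1 ^^ Suc (Suc k)) u) = f1 (f2 ((f1 ^^ Suc k) u)) + f3 ((f1 ^^ Suc k) u)"
      using comm_rules(8)[of "(f1 ^^ Suc k) u"] u by simp
    also have "\<dots> = (f1 ^^ Suc (Suc k)) (f2 u) + (cscale (of_nat (Suc k)) ((f1 ^^ Suc k) (f3 u)) + (f1 ^^ Suc k) (f3 u))"
      unfolding Suc f3 using u by (simp add: op_add op_scale V_scale add.assoc)
    also have "cscale (of_nat (Suc k)) ((f1 ^^ Suc k) (f3 u)) + (f1 ^^ Suc k) (f3 u) =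
        cscale (of_nat (Suc (Suc k))) ((f1 ^^ Suc k) (f3 u))"
      by (simp only: of_nat_Suc[of "Suc k"] cvec.scale_left_distrib cvec.scale_one add.commute)
    finally show ?case .
  qed
qed

lemma f1_pow_zero: "(f1 ^^ j) u = 0 \<Longrightarrow> j \<le> k \<Longrightarrow> (f1 ^^ k) u = 0"
proof -
  assume z: "(f1 ^^ j) u = 0" and "j \<le> k"
  then obtain i where "k = i + j" by (metis le_add_diff_inverse2)
  then have "(f1 ^^ k) u = (f1 ^^ i) 0" using z by (simp add: funpow_add)
  then show ?thesis by (simp add: lin_0[OF lin_pow[OF lin_op(4)]])
qed

text \<open>The vector is singular and its weight is not the highest one: \<open>e1\<close> kills it by \<open>sl(2)\<close> theory, and
  \<open>e2\<close> commutes with \<open>f1\<close> and leads to the same statement for smaller \<open>p + q\<close>.\<close>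

lemma f1_pow_\<xi>_zero: "p \<le> a \<Longrightarrow> (f1 ^^ Suc (a + q - p)) (\<xi> p q) = 0"
proof (induction "p + q" arbitrary: p q rule: less_induct)
  case less
  let ?m = "a + q - p" let ?w = "(f1 ^^ Suc ?m) (\<xi> p q)"
  have m: "h1 (\<xi> p q) = cscale (of_nat ?m) (\<xi> p q)"
    using h1_\<xi>[of p q] less.prems by (simp add: of_nat_diff)
  show ?case
  proof (rule singular_vector_zero[OF f1_pow_wt[OF \<xi>_wt]])
    show "e1 ?w = 0"
      unfolding e1_f1_pow[OF \<xi>_V e1_\<xi> m] by simp
    have 1: "cscale (cA p q) ((f1 ^^ Suc ?m) (\<xi> p (q - 1))) = 0"
    proof (cases q)
      case (Suc r)
      have "(f1 ^^ Suc (a + r - p)) (\<xi> p r) = 0"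
        using less Suc by simp
      then have "(f1 ^^ Suc ?m) (\<xi> p r) = 0"
        by (rule f1_pow_zero) (use Suc in simp)
      then show ?thesis by (simp only: Suc diff_Suc_1 cvec.scale_zero_right)
    qed (simp add: cA_def)
    have 2: "cscale (cB p q) ((f1 ^^ Suc ?m) (f1 (\<xi> (p - 1) q))) = 0"
    proof (cases p)
      case (Suc r)
      have "(f1 ^^ Suc (a + q - r)) (\<xi> r q) = 0"
        using less Suc by simp
      moreover have "(f1 ^^ Suc ?m) (f1 (\<xi> r q)) = (f1 ^^ Suc (Suc ?m)) (\<xi> r q)"
        by (simp only: funpow_Suc_right o_apply)
      moreover have "Suc (a + q - r) = Suc (Suc ?m)"
        using Suc less.prems by simp
      ultimately show ?thesis by (simp only: Suc diff_Suc_1 cvec.scale_zero_right)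
    qed (simp add: cB_def)
    have "e2 ?w = (f1 ^^ Suc ?m) (cscale (cA p q) (\<xi> p (q - 1)) + cscale (cB p q) (f1 (\<xi> (p - 1) q)))"
      unfolding e2_f1_pow[OF \<xi>_V] e2_\<xi>[OF less.prems] ..
    also have "\<dots> = cscale (cA p q) ((f1 ^^ Suc ?m) (\<xi> p (q - 1))) + cscale (cB p q) ((f1 ^^ Suc ?m) (f1 (\<xi> (p - 1) q)))"
      using lin_pow[OF lin_op(4), of "Suc ?m"] by (simp only: lin_add lin_scale V_scale \<xi>_V op_V)
    finally show "e2 ?w = 0" by (simp only: 1 2 add_0)
  qed (use less.prems in auto)
qed

lemma \<xi>_beyond_b: "\<xi> p (Suc b) = 0"
proof (induction p)
  case 0
  show ?case
  proof (rule singular_vector_zero[OF \<xi>_wt e1_\<xi>])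
    show "e2 (\<xi> 0 (Suc b)) = 0" unfolding e2_\<xi>_0 by simp
  qed auto
qed simp

text \<open>For \<open>q = 0\<close> this is a singular vector whose weight is not the highest one.  Its image under \<open>e2\<close> has
  to be computed directly, because \<open>e2_\<xi>\<close> would divide by zero; it is a multiple of
  \<open>f1 (\<xi> a 0)\<close>, which vanishes.  Larger \<open>q\<close> follow by applying \<open>f2\<close>.\<close>

lemma \<xi>_beyond_a: "\<xi> (Suc a) q = 0"
proof (induction q)
  case 0
  let ?u = "\<xi> a 0"
  have f1u: "f1 ?u = 0"
    using f1_pow_\<xi>_zero[of a 0] by simp
  have e2u: "e2 ?u = cscale (cB a 0) (f1 (\<xi> (a - 1) 0))"
    using e2_\<xi>[of a 0] by (simp add: cA_def)
  have "f3 (e2 ?u) + f1 (f2 (e2 ?u)) = 0"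
  proof (cases a)
    case 0
    then have "cB a 0 = 0" unfolding cB_def by simp
    then show ?thesis unfolding e2u by simp
  next
    case (Suc r)
    let ?w = "\<xi> r 0"
    have "of_nat a + of_nat 0 - of_nat r + 1 = (2 :: complex)"
      using Suc by simp
    then have "\<xi> (Suc r) 0 = cscale 2 (f3 ?w) + f1 (f2 ?w)"
      by (simp only: \<xi>.simps)
    then have "f1 (cscale 2 (f3 ?w) + f1 (f2 ?w)) = 0"
      using f1u by (simp only: Suc[symmetric])
    moreover have "f3 (f1 ?w) + f1 (f2 (f1 ?w)) = f1 (cscale 2 (f3 ?w) + f1 (f2 ?w))"
      by (simp only: comm_rules op_add op_scale op_V \<xi>_V V_scale)
        (rule poly_mapping_eqI, simp only: lookup_add lookup_cscale, simp)
    ultimately have "cscale (cB a 0) (f3 (f1 ?w) + f1 (f2 (f1 ?w))) = 0"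
      by simp
    moreover have "a - 1 = r" using Suc by simp
    ultimately show ?thesis
      unfolding e2u by (simp only: op_scale op_V \<xi>_V V_scale cvec.scale_right_distrib)
  qed
  moreover have "e2 (\<xi> (Suc a) 0) = (f3 (e2 ?u) + f1 ?u) + f1 (f2 (e2 ?u) + cscale (of_nat b - of_nat a) ?u)"
    by (simp add: op_add comm_rules h2_\<xi>)
  moreover have "f1 (f2 (e2 ?u) + cscale (of_nat b - of_nat a) ?u) = f1 (f2 (e2 ?u))"
    by (simp only: op_add op_scale V_scale op_V \<xi>_V f1u) simp
  ultimately have e2: "e2 (\<xi> (Suc a) 0) = 0"
    by (simp add: f1u del: \<xi>.simps)
  show ?case
    by (rule singular_vector_zero[OF \<xi>_wt e1_\<xi> e2]) auto
next
  case (Suc q)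
  then show ?case using f2_\<xi>[of "Suc a" q] by simp
qed

definition gt_vector :: "nat \<times> nat \<times> nat \<Rightarrow> cvec" where
  "gt_vector = (\<lambda>(p, q, k). (f1 ^^ k) (\<xi> p q))"

text \<open>The span is stable under \<open>f2\<close> because \<open>f3 (\<xi> p q)\<close> is a combination of \<open>\<xi> (Suc p) q\<close> and
  \<open>f1 (\<xi> p (Suc q))\<close>, and because the vectors one step beyond the bounds vanish.\<close>

lemma gt_vectors_span: "cvec.span {(f1 ^^ k) (\<xi> p q) | p q k. p \<le> a \<and> q \<le> b} = V" (is "cvec.span ?S = V")
proof (rule generated_submodule)
  let ?U = "cvec.span ?S"
  have SV: "?S \<subseteq> V" by auto
  have inS: "(f1 ^^ k) (\<xi> p q) \<in> ?U" if "p \<le> a" "q \<le> b" for p q k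
    using that by (intro cvec.span_base) blast
  have inS': "(f1 ^^ k) (\<xi> p q) \<in> ?U" if "p \<le> Suc a" "q \<le> Suc b" for p q k
  proof (cases "p = Suc a \<or> q = Suc b")
    case True
    then have "\<xi> p q = 0" using \<xi>_beyond_a \<xi>_beyond_b by blast
    then show ?thesis by (simp add: lin_0[OF lin_pow[OF lin_op(4)]] cvec.span_zero)
  qed (use that inS in auto)
  have f1S: "f1 s \<in> ?U" if s: "s \<in> ?S" for s
  proof -
    obtain p q k where "s = (f1 ^^ k) (\<xi> p q)" "p \<le> a" "q \<le> b" using s by blast
    then show ?thesis using inS[of p q "Suc k"] by simp
  qed
  have e1S: "e1 s \<in> ?U" if s: "s \<in> ?S" for s
  proof -
    obtain p q k where "s = (f1 ^^ k) (\<xi> p q)" "p \<le> a" "q \<le> b" using s by blast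
    then show ?thesis
      using e1_f1_pow[OF \<xi>_V e1_\<xi> h1_\<xi>] inS[of p q]
      by (cases k) (simp_all add: e1_\<xi> cvec.span_zero cvec.span_scale del: funpow.simps(2))
  qed
  have e2S: "e2 s \<in> ?U" if s: "s \<in> ?S" for s
  proof -
    obtain p q k where s: "s = (f1 ^^ k) (\<xi> p q)" "p \<le> a" "q \<le> b" using s by blast
    have "e2 s = cscale (cA p q) ((f1 ^^ k) (\<xi> p (q - 1))) + cscale (cB p q) ((f1 ^^ Suc k) (\<xi> (p - 1) q))"
      unfolding s(1) e2_f1_pow[OF \<xi>_V] e2_\<xi>[OF s(2)] funpow_Suc_right o_apply
      using lin_pow[OF lin_op(4), of k] by (simp only: lin_add lin_scale V_scale \<xi>_V op_V)
    then show ?thesis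
      using s by (simp only:) (intro cvec.span_add cvec.span_scale inS; simp)
  qed
  have f2S: "f2 s \<in> ?U" if s: "s \<in> ?S" for s
  proof -
    obtain p q k where s: "s = (f1 ^^ k) (\<xi> p q)" "p \<le> a" "q \<le> b" using s by blast
    show ?thesis
    proof (cases k)
      case 0
      then show ?thesis using inS'[of p "Suc q" 0] s by (simp add: f2_\<xi>)
    next
      case (Suc j)
      obtain d where d: "f3 (\<xi> p q) = cscale d (\<xi> (Suc p) q + cscale (-1) (f1 (\<xi> p (Suc q))))"
        by (rule that[of "1 / (of_nat a + of_nat q - of_nat p + 1)"])
          (simp only: f3_\<xi>[OF s(2)] diff_conv_add_uminus cvec.scale_minus_left cvec.scale_one)
      have "f2 s = (f1 ^^ Suc j) (f2 (\<xi> p q)) + cscale (of_nat (Suc j)) ((f1 ^^ j) (f3 (\<xi> p q)))"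
        unfolding s(1) Suc by (rule f2_f1_pow[OF \<xi>_V])
      also have "\<dots> = (f1 ^^ Suc j) (\<xi> p (Suc q)) + cscale (of_nat (Suc j)) (cscale d
          ((f1 ^^ j) (\<xi> (Suc p) q) + cscale (-1) ((f1 ^^ Suc j) (\<xi> p (Suc q)))))"
        unfolding d f2_\<xi> funpow_Suc_right o_apply
        using lin_pow[OF lin_op(4), of j] by (simp only: lin_add lin_scale V_scale V_add \<xi>_V op_V)
      finally have "f2 s = (f1 ^^ Suc j) (\<xi> p (Suc q)) + cscale (of_nat (Suc j)) (cscale d
          ((f1 ^^ j) (\<xi> (Suc p) q) + cscale (-1) ((f1 ^^ Suc j) (\<xi> p (Suc q)))))" .
      then show ?thesis
        using s by (simp only:) (intro cvec.span_add cvec.span_scale inS'; simp)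
    qed
  qed
  show "cvec.subspace ?U" by simp
  show "?U \<subseteq> V" by (rule span_V[OF SV])
  show "e1 x \<in> ?U \<and> e2 x \<in> ?U \<and> f1 x \<in> ?U \<and> f2 x \<in> ?U" if "x \<in> ?U" for x
    using that lin_span_closed[OF _ SV _ that] e1S e2S f1S f2S lin_op by blast
  have "v0 \<in> ?U" using inS[of 0 0 0] by simp
  then show "?U \<noteq> {0}" using v0_nz by blast
qed

lemma weight_space_span: "weight_space (V, act) \<mu> = cvec.span (gt_vector ` gt_patterns a b \<mu>)"
proof
  show "cvec.span (gt_vector ` gt_patterns a b \<mu>) \<subseteq> weight_space (V, act) \<mu>"
  proof (rule cvec.span_minimal)
    show "gt_vector ` gt_patterns a b \<mu> \<subseteq> weight_space (V, act) \<mu>"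
      using f1_pow_wt[OF \<xi>_wt] by (auto simp: weight_space_iff_wt gt_vector_def gt_patterns_def)
    show "cvec.subspace (weight_space (V, act) \<mu>)"
      unfolding cvec.subspace_def Ball_def weight_space_iff_wt
      by (auto simp: wt_def V_0 V_add V_scale op_add op_scale cvec.scale_right_distrib mult.commute)
  qed
  show "weight_space (V, act) \<mu> \<subseteq> cvec.span (gt_vector ` gt_patterns a b \<mu>)"
  proof
    fix x assume "x \<in> weight_space (V, act) \<mu>"
    then have x: "wt \<mu> x" by (simp add: weight_space_iff_wt)
    let ?S = "{(f1 ^^ k) (\<xi> p q) | p q k. p \<le> a \<and> q \<le> b}"
    have "\<forall>s\<in>?S. \<exists>\<nu>. wt \<nu> s" using f1_pow_wt[OF \<xi>_wt] by blast
    then have "\<exists>w. \<forall>s\<in>?S. wt (w s) s" by (rule bchoice)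
    then obtain w where w: "\<And>s. s \<in> ?S \<Longrightarrow> wt (w s) s" by (elim exE) (rule that, erule bspec)
    have "x \<in> cvec.span {s \<in> ?S. w s = \<mu>}"
      by (rule weight_vector_in_span[OF w _ x]) (use gt_vectors_span wt_V[OF x] in auto)
    also have "\<dots> \<subseteq> cvec.span (insert 0 (gt_vector ` gt_patterns a b \<mu>))"
    proof (rule cvec.span_mono, rule subsetI)
      fix s assume s: "s \<in> {s \<in> ?S. w s = \<mu>}"
      then obtain p q k where pqk: "s = (f1 ^^ k) (\<xi> p q)" "p \<le> a" "q \<le> b" by blast
      show "s \<in> insert 0 (gt_vector ` gt_patterns a b \<mu>)"
      proof (cases "s = 0")
        case False
        have "wt \<mu> s" using w s by blast
        then have "\<mu> = (int a + int q - int p - 2 * int k, int b - 2 * int q - int p + int k)"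
          using wt_unique[OF _ f1_pow_wt[OF \<xi>_wt]] False pqk(1) by blast
        moreover have "k \<le> a + q - p"
        proof (rule ccontr)
          assume "\<not> k \<le> a + q - p"
          then have "s = 0"
            unfolding pqk(1) by (intro f1_pow_zero[OF f1_pow_\<xi>_zero[OF pqk(2)]]) simp
          with False show False ..
        qed
        ultimately have "(p, q, k) \<in> gt_patterns a b \<mu>"
          using pqk by (simp add: gt_patterns_def)
        then show ?thesis
          using pqk(1) by (auto simp: gt_vector_def intro: rev_image_eqI)
      qed simp
    qed
    finally show "x \<in> cvec.span (gt_vector ` gt_patterns a b \<mu>)"
      by (simp add: cvec.span_insert_0)
  qed
qed

lemma e1_pow_f1_pow_less: "j < k \<Longrightarrow> (e1 ^^ k) ((f1 ^^ j) (\<xi> p q)) = 0"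
proof (induction j arbitrary: k)
  case 0
  then obtain i where "k = Suc i" by (cases k) auto
  then show ?case by (simp add: funpow_Suc_right e1_\<xi> lin_0[OF lin_pow[OF lin_op(1)]] del: funpow.simps)
next
  case (Suc j)
  then obtain i where i: "k = Suc i" "j < i" by (cases k) auto
  show ?case
    unfolding i(1) funpow_Suc_right[of i e1] o_apply e1_f1_pow[OF \<xi>_V e1_\<xi> h1_\<xi>]
    using lin_pow[OF lin_op(1), of i] Suc.IH[OF i(2)] by (simp only: lin_scale f1_pow_V \<xi>_V cvec.scale_zero_right)
qed

lemma e1_pow_f1_pow:
  assumes "p \<le> a" "k \<le> a + q - p"
  shows "\<exists>\<gamma>. \<gamma> \<noteq> 0 \<and> (e1 ^^ k) ((f1 ^^ k) (\<xi> p q)) = cscale \<gamma> (\<xi> p q)"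
  using assms(2)
proof (induction k)
  case 0
  have "1 \<noteq> (0::complex) \<and> (e1 ^^ 0) ((f1 ^^ 0) (\<xi> p q)) = cscale 1 (\<xi> p q)" by simp
  then show ?case by blast
next
  case (Suc k)
  then obtain \<gamma> where \<gamma>: "\<gamma> \<noteq> 0" "(e1 ^^ k) ((f1 ^^ k) (\<xi> p q)) = cscale \<gamma> (\<xi> p q)" by auto
  let ?c = "of_nat (Suc k) * (of_nat a + of_nat q - of_nat p - of_nat k) :: complex"
  have "(of_nat a + of_nat q - of_nat p - of_nat k :: complex) = of_nat (a + q - p - k)"
    using Suc.prems assms(1) by (simp add: of_nat_diff)
  moreover have "a + q - p - k \<noteq> 0" using Suc.prems by simp
  ultimately have "?c \<noteq> 0" by (simp only: mult_eq_0_iff of_nat_eq_0_iff) simp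
  moreover have "(e1 ^^ Suc k) ((f1 ^^ Suc k) (\<xi> p q)) = cscale (?c * \<gamma>) (\<xi> p q)"
    unfolding funpow_Suc_right[of k e1] o_apply e1_f1_pow[OF \<xi>_V e1_\<xi> h1_\<xi>]
    using lin_pow[OF lin_op(1), of k] \<gamma>(2) by (simp only: lin_scale f1_pow_V \<xi>_V cvec.scale_scale)
  ultimately show ?case using \<gamma>(1) by (metis mult_eq_0_iff)
qed

lemma finite_gt_patterns: "finite (gt_patterns a b \<mu>)"
  by (rule finite_subset[of _ "{..a} \<times> {..b} \<times> {..a + b}"]) (auto simp: gt_patterns_def)

text \<open>Within one weight space the exponent \<open>k\<close> determines \<open>p\<close> and \<open>q\<close>.  If \<open>k\<close> is the largest exponent in a
  linear relation, then \<open>e1 ^^ k\<close> kills all other terms of the relation.\<close>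

lemma gt_vectors_independent:
  assumes sum: "(\<Sum>i\<in>gt_patterns a b \<mu>. cscale (c i) (gt_vector i)) = 0" and i: "i \<in> gt_patterns a b \<mu>"
  shows "c i = 0"
proof (rule ccontr)
  let ?I = "gt_patterns a b \<mu>"
  let ?k = "\<lambda>i :: nat \<times> nat \<times> nat. snd (snd i)"
  define J where "J = {i \<in> ?I. c i \<noteq> 0}"
  assume "c i \<noteq> 0"
  then have "i \<in> J" using i by (simp add: J_def)
  then have J: "finite J" "J \<noteq> {}"
    by (simp add: J_def finite_gt_patterns, blast)
  then obtain j where j: "j \<in> J" "\<And>i. i \<in> J \<Longrightarrow> ?k i \<le> ?k j"
    using Max_in[of "?k ` J"] Max_ge[of "?k ` J"] by (metis (no_types, lifting) finite_imageI image_iff image_is_empty)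
  obtain p q k where pqk: "j = (p, q, k)" by (cases j) auto
  have P: "p \<le> a" "q \<le> b" "k \<le> a + q - p"
    and \<mu>: "\<mu> = (int a + int q - int p - 2 * int k, int b - 2 * int q - int p + int k)"
    using j(1) by (auto simp: J_def pqk gt_patterns_def)
  have E: "lin (e1 ^^ k)" by (rule lin_pow[OF lin_op(1)])
  have V: "gt_vector i \<in> V" for i by (cases i) (simp add: gt_vector_def)
  have "0 = (e1 ^^ k) (\<Sum>i\<in>?I. cscale (c i) (gt_vector i))"
    unfolding sum lin_0[OF E] ..
  also have "\<dots> = (\<Sum>i\<in>?I. (e1 ^^ k) (cscale (c i) (gt_vector i)))"
    using lin_sum[OF E, of ?I "\<lambda>i. cscale (c i) (gt_vector i)"] V_scale[OF V] by blast
  also have "\<dots> = (\<Sum>i\<in>?I. cscale (c i) ((e1 ^^ k) (gt_vector i)))"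
    by (simp only: lin_scale[OF E V])
  also have "\<dots> = (\<Sum>i\<in>{j}. cscale (c i) ((e1 ^^ k) (gt_vector i)))"
  proof (rule sum.mono_neutral_right[OF finite_gt_patterns])
    show "{j} \<subseteq> ?I" using j(1) by (auto simp: J_def)
    show "\<forall>i\<in>?I - {j}. cscale (c i) ((e1 ^^ k) (gt_vector i)) = 0"
    proof
      fix i assume i: "i \<in> ?I - {j}"
      obtain p' q' k' where i': "i = (p', q', k')" by (cases i) auto
      show "cscale (c i) ((e1 ^^ k) (gt_vector i)) = 0"
      proof (cases "c i = 0")
        case False
        then have "k' \<le> k" using j(2)[of i] i i' pqk by (auto simp: J_def)
        moreover have "k' \<noteq> k"
        proof
          assume k: "k' = k"
          have "\<mu> = (int a + int q' - int p' - 2 * int k', int b - 2 * int q' - int p' + int k')"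
            using i i' by (auto simp: gt_patterns_def)
          with \<mu> k have "q' = q" "p' = p" by auto
          with k i i' pqk show False by auto
        qed
        ultimately show ?thesis
          by (simp add: i' gt_vector_def e1_pow_f1_pow_less)
      qed simp
    qed
  qed
  also have "\<dots> = cscale (c j) ((e1 ^^ k) ((f1 ^^ k) (\<xi> p q)))"
    by (simp add: pqk gt_vector_def)
  finally have "cscale (c j) ((e1 ^^ k) ((f1 ^^ k) (\<xi> p q))) = 0" ..
  moreover obtain \<gamma> where "\<gamma> \<noteq> 0" "(e1 ^^ k) ((f1 ^^ k) (\<xi> p q)) = cscale \<gamma> (\<xi> p q)"
    using e1_pow_f1_pow[OF P(1,3)] by blast
  moreover have "c j \<noteq> 0" using j(1) by (simp add: J_def)
  ultimately show False using \<xi>_nonzero[OF P(1,2)] by simp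
qed

lemma dim_weight_space: "cvec.dim (weight_space (V, act) \<mu>) = card (gt_patterns a b \<mu>)"
  unfolding weight_space_span
  by (rule dim_span_independent_family[OF finite_gt_patterns]) (rule gt_vectors_independent)

end

theorem mbar_eq_card: "mbar (int a, int b) \<mu> = card (gt_patterns a b \<mu>)"
proof -
  have hw: "is_irreducible_hw (int a, int b) (irreducible_module (int a, int b))"
    unfolding irreducible_module_def using irreducible_hw_exists by (rule someI_ex)
  obtain V act where M: "irreducible_module (int a, int b) = (V, act)" by fastforce
  obtain v0 where "sl3_hw_module V act a b v0"
    using hw by (auto simp: M is_irreducible_hw_def sl3_hw_module_def)
  then show ?thesis
    unfolding mbar_def M by (rule sl3_hw_module.dim_weight_space)
qed

section \<open>Convolution over a group\<close>

lemma lookup_mult_single: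
  fixes F :: "'a::group_add \<Rightarrow>\<^sub>0 int"
  shows "Poly_Mapping.lookup (F * Poly_Mapping.single k c) z = Poly_Mapping.lookup F (z - k) * c"
proof -
  have eq: "(k = q \<and> z = l + q) \<longleftrightarrow> (l = z - k \<and> q = k)" for l q :: 'a
    by (auto simp: eq_diff_eq)
  have "Poly_Mapping.lookup (F * Poly_Mapping.single k c) z =
      (\<Sum>l. Poly_Mapping.lookup F l * (\<Sum>q. c when l = z - k \<and> q = k))"
    unfolding lookup_mult lookup_single when_when by (simp only: eq)
  also have "\<dots> = (\<Sum>l. Poly_Mapping.lookup F l * c when l = z - k)"
    by (simp add: mult_when when_when[symmetric])
  finally show ?thesis by simp
qed

lemma lookup_mult_group:
  fixes F G :: "'a::group_add \<Rightarrow>\<^sub>0 int"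
  assumes "finite S" "Poly_Mapping.keys G \<subseteq> S"
  shows "Poly_Mapping.lookup (F * G) z = (\<Sum>k\<in>S. Poly_Mapping.lookup F (z - k) * Poly_Mapping.lookup G k)"
proof -
  have "G = (\<Sum>k\<in>S. Poly_Mapping.single k (Poly_Mapping.lookup G k))"
  proof (rule poly_mapping_eqI)
    fix m
    show "Poly_Mapping.lookup G m = Poly_Mapping.lookup (\<Sum>k\<in>S. Poly_Mapping.single k (Poly_Mapping.lookup G k)) m"
      using assms by (auto simp: lookup_sum lookup_single when_def in_keys_iff)
  qed
  then have "F * G = (\<Sum>k\<in>S. F * Poly_Mapping.single k (Poly_Mapping.lookup G k))"
    by (metis sum_distrib_left)
  then show ?thesis
    by (simp add: lookup_sum lookup_mult_single)
qed

type_synonym weight_ring = "weight \<Rightarrow>\<^sub>0 int"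

text \<open>The term of \<open>F\<close> of maximal height \<open>fst + snd\<close> survives in \<open>F * D\<close>, since all terms of \<open>D\<close> other than
  the constant one lower the height.\<close>

lemma cancel_leading_one:
  fixes F D :: weight_ring
  assumes D: "Poly_Mapping.lookup D 0 \<noteq> 0"
    "\<And>\<kappa>. \<kappa> \<in> Poly_Mapping.keys D \<Longrightarrow> \<kappa> \<noteq> 0 \<Longrightarrow> fst \<kappa> + snd \<kappa> < 0"
    and FD: "F * D = 0"
  shows "F = 0"
proof (rule ccontr)
  assume "F \<noteq> 0"
  let ?h = "\<lambda>\<mu> :: weight. fst \<mu> + snd \<mu>"
  have "finite (?h ` Poly_Mapping.keys F)" "?h ` Poly_Mapping.keys F \<noteq> {}"
    using \<open>F \<noteq> 0\<close> by auto
  then obtain m where m: "m \<in> Poly_Mapping.keys F" "\<And>x. x \<in> Poly_Mapping.keys F \<Longrightarrow> ?h x \<le> ?h m"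
    using Max_in[of "?h ` Poly_Mapping.keys F"] Max_ge[of "?h ` Poly_Mapping.keys F"] by fastforce
  have "0 = Poly_Mapping.lookup (F * D) m"
    by (simp add: FD)
  also have "\<dots> = (\<Sum>k\<in>Poly_Mapping.keys D. Poly_Mapping.lookup F (m - k) * Poly_Mapping.lookup D k)"
    by (rule lookup_mult_group) auto
  also have "\<dots> = (\<Sum>k\<in>{0}. Poly_Mapping.lookup F (m - k) * Poly_Mapping.lookup D k)"
  proof (rule sum.mono_neutral_right)
    show "{0} \<subseteq> Poly_Mapping.keys D" using D(1) by (simp add: in_keys_iff)
    show "\<forall>k\<in>Poly_Mapping.keys D - {0}. Poly_Mapping.lookup F (m - k) * Poly_Mapping.lookup D k = 0"
    proof
      fix k assume "k \<in> Poly_Mapping.keys D - {0}"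
      then have "m - k \<notin> Poly_Mapping.keys F"
        using D(2)[of k] m(2)[of "m - k"] by auto
      then show "Poly_Mapping.lookup F (m - k) * Poly_Mapping.lookup D k = 0"
        by (simp add: in_keys_iff)
    qed
  qed simp
  finally show False using D(1) m(1) by (simp add: in_keys_iff)
qed

section \<open>Alternating elements of the weight ring\<close>

lemma fin_weyl_eq: "fin_weyl = {\<lambda>(a, b). (a, b), \<lambda>(a, b). (- a, a + b), \<lambda>(a, b). (a + b, - b),
    \<lambda>(a, b). (- a - b, a), \<lambda>(a, b). (b, - a - b), \<lambda>(a, b). (- b, - a)}"
proof
  show "fin_weyl \<subseteq> {\<lambda>(a, b). (a, b), \<lambda>(a, b). (- a, a + b), \<lambda>(a, b). (a + b, - b),
    \<lambda>(a, b). (- a - b, a), \<lambda>(a, b). (b, - a - b), \<lambda>(a, b). (- b, - a)}"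
    using fin_weyl_explicit by blast
  have 1: "wrefl 1 \<circ> w \<in> fin_weyl" "wrefl 2 \<circ> w \<in> fin_weyl" if "w \<in> fin_weyl" for w
    using that by (auto intro: fin_weyl.step)
  have s: "(\<lambda>(a, b). (a, b)) = id" "(\<lambda>(a, b). (- a, a + b)) = wrefl 1 \<circ> id"
    "(\<lambda>(a, b). (a + b, - b)) = wrefl 2 \<circ> id"
    "(\<lambda>(a, b). (- a - b, a)) = wrefl 1 \<circ> (wrefl 2 \<circ> id)"
    "(\<lambda>(a, b). (b, - a - b)) = wrefl 2 \<circ> (wrefl 1 \<circ> id)"
    "(\<lambda>(a, b). (- b, - a)) = wrefl 1 \<circ> (wrefl 2 \<circ> (wrefl 1 \<circ> id))"
    by (auto simp: fun_eq_iff refl_simps)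
  show "{\<lambda>(a, b). (a, b), \<lambda>(a, b). (- a, a + b), \<lambda>(a, b). (a + b, - b),
    \<lambda>(a, b). (- a - b, a), \<lambda>(a, b). (b, - a - b), \<lambda>(a, b). (- b, - a)} \<subseteq> fin_weyl"
    unfolding s(2-) unfolding s(1) by (intro insert_subsetI empty_subsetI 1 fin_weyl.id)
qed

lemma sum_fin_weyl:
  "(\<Sum>w\<in>fin_weyl. f w) = f (\<lambda>(a, b). (a, b)) + f (\<lambda>(a, b). (- a, a + b)) + f (\<lambda>(a, b). (a + b, - b))
    + f (\<lambda>(a, b). (- a - b, a)) + f (\<lambda>(a, b). (b, - a - b)) + f (\<lambda>(a, b). (- b, - a))"
proof -
  have ne: "f \<noteq> g" if "f (1, 2) \<noteq> g (1, 2)" for f g :: "weight \<Rightarrow> weight"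
    using that by auto
  show ?thesis
    unfolding fin_weyl_eq by (simp add: ne add.assoc)
qed

lemma wdet_refl_comp: "i \<in> {1, 2} \<Longrightarrow> wdet (wrefl i \<circ> w) = - wdet w"
  by (cases "w (1, 0)"; cases "w (0, 1)") (auto simp: wdet_def refl_simps algebra_simps)

lemma wdet_id: "wdet id = 1"
  by (simp add: wdet_def)

lemma wdet_comp: "u \<in> fin_weyl \<Longrightarrow> wdet (u \<circ> v) = wdet u * wdet v"
  by (induction rule: fin_weyl.induct)
    (simp_all only: wdet_id wdet_refl_comp comp_assoc id_o mult_1 minus_mult_left)

lemma wdet_inv: "u \<in> fin_weyl \<Longrightarrow> wdet u * wdet (inv u) = 1"
proof -
  assume u: "u \<in> fin_weyl"
  then have "u \<circ> inv u = id"
    using fin_weyl_bij_inv by (metis bij_is_surj surj_iff)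
  then show ?thesis using wdet_comp[OF u, of "inv u"] wdet_id by simp
qed

text \<open>This is the numerator of Weyl's character formula divided by \<open>e\<^sup>\<rho>\<close>, which replaces the action of
  the Weyl group by the shifted action; at \<open>\<nu> = 0\<close> it is the denominator.\<close>

definition alternant :: "weight \<Rightarrow> weight_ring" where
  "alternant \<nu> = (\<Sum>w\<in>fin_weyl. Poly_Mapping.single (shifted w \<nu>) (wdet w))"

lemma alternant_explicit:
  "alternant (a, b) = frag_of (a, b) - frag_of (- a - 2, a + b + 1) - frag_of (a + b + 1, - b - 2)
    + frag_of (- a - b - 3, a) + frag_of (b, - a - b - 3) - frag_of (- b - 2, - a - 2)"
  unfolding alternant_def sum_fin_weyl
  by (simp add: shifted_def rho_def wdet_def single_uminus algebra_simps)

definition alternating :: "weight_ring \<Rightarrow> bool" where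
  "alternating A \<longleftrightarrow> (\<forall>i\<in>{1, 2}. \<forall>\<mu>. Poly_Mapping.lookup A (shifted (wrefl i) \<mu>) = - Poly_Mapping.lookup A \<mu>)"

definition weyl_invariant :: "weight_ring \<Rightarrow> bool" where
  "weyl_invariant F \<longleftrightarrow> (\<forall>i\<in>{1, 2}. \<forall>\<mu>. Poly_Mapping.lookup F (wrefl i \<mu>) = Poly_Mapping.lookup F \<mu>)"

lemma wrefl_wrefl: "i \<in> {1, 2} \<Longrightarrow> wrefl i (wrefl i \<mu>) = \<mu>"
  using fun_cong[OF refl_comp_refl, of i \<mu>] by (simp only: o_apply id_apply)

lemma wrefl_add: "i \<in> {1, 2} \<Longrightarrow> wrefl i (\<mu> + \<nu>) = wrefl i \<mu> + wrefl i \<nu>"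
  using fin_weyl_add[OF refl_in_fin_weyl] .

lemma wrefl_diff: "i \<in> {1, 2} \<Longrightarrow> wrefl i (\<mu> - \<nu>) = wrefl i \<mu> - wrefl i \<nu>"
  using wrefl_add[of i "\<mu> - \<nu>" \<nu>] by (simp add: algebra_simps)

lemma shifted_shifted: "i \<in> {1, 2} \<Longrightarrow> shifted (wrefl i) (shifted (wrefl i) \<mu>) = \<mu>"
  by (simp add: shifted_def wrefl_wrefl)

lemma shifted_diff: "i \<in> {1, 2} \<Longrightarrow> shifted (wrefl i) \<mu> - shifted (wrefl i) \<nu> = wrefl i (\<mu> - \<nu>)"
  by (simp add: shifted_def wrefl_diff wrefl_add)

lemma alternant_alternating: "alternating (alternant \<nu>)"
  unfolding alternating_def
proof (intro ballI allI)
  fix i :: nat and \<mu> assume i: "i \<in> {1, 2}"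
  have comp: "wrefl i \<circ> (wrefl i \<circ> w) = w" for w :: "weight \<Rightarrow> weight"
    using refl_comp_refl[OF i] by (simp flip: comp_assoc)
  have step: "wrefl i \<circ> w \<in> fin_weyl" if "w \<in> fin_weyl" for w
    using fin_weyl.step that i by blast
  have "(\<Sum>w\<in>fin_weyl. wdet w when shifted w \<nu> = shifted (wrefl i) \<mu>) =
      (\<Sum>w\<in>fin_weyl. - (wdet w when shifted w \<nu> = \<mu>))"
  proof (rule sum.reindex_bij_witness[of _ "\<lambda>w. wrefl i \<circ> w" "\<lambda>w. wrefl i \<circ> w"])
    fix w
    have "shifted (wrefl i \<circ> w) \<nu> = \<mu> \<longleftrightarrow> shifted w \<nu> = shifted (wrefl i) \<mu>"
    proof -
      have "shifted (wrefl i \<circ> w) \<nu> = shifted (wrefl i) (shifted w \<nu>)"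
        by (simp add: shifted_def)
      then show ?thesis using shifted_shifted[OF i] by metis
    qed
    then show "- (wdet (wrefl i \<circ> w) when shifted (wrefl i \<circ> w) \<nu> = \<mu>) = (wdet w when shifted w \<nu> = shifted (wrefl i) \<mu>)"
      using wdet_refl_comp[OF i, of w] by (simp add: when_def)
  qed (simp_all only: comp step)
  then show "Poly_Mapping.lookup (alternant \<nu>) (shifted (wrefl i) \<mu>) = - Poly_Mapping.lookup (alternant \<nu>) \<mu>"
    by (simp add: alternant_def lookup_sum lookup_single sum_negf)
qed

abbreviation weyl_twist :: "nat \<Rightarrow> weight_ring \<Rightarrow> weight_ring" where
  "weyl_twist i \<equiv> Poly_Mapping.map_key (wrefl i)"

lemma inj_wrefl: "i \<in> {1, 2} \<Longrightarrow> inj (wrefl i)"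
  by (metis injI wrefl_wrefl)

lemma lookup_weyl_twist: "i \<in> {1, 2} \<Longrightarrow> Poly_Mapping.lookup (weyl_twist i F) \<mu> = Poly_Mapping.lookup F (wrefl i \<mu>)"
  using inj_wrefl by (simp add: map_key.rep_eq)

lemma weyl_invariant_iff: "weyl_invariant F \<longleftrightarrow> (\<forall>i\<in>{1, 2}. weyl_twist i F = F)"
  unfolding weyl_invariant_def poly_mapping_eq_iff fun_eq_iff using lookup_weyl_twist by auto

lemma weyl_twist_add: "i \<in> {1, 2} \<Longrightarrow> weyl_twist i (F + G) = weyl_twist i F + weyl_twist i G"
  by (simp add: map_key_plus inj_wrefl)

lemma weyl_twist_mult:
  assumes i: "i \<in> {1, 2}"
  shows "weyl_twist i (F * G) = weyl_twist i F * weyl_twist i G"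
proof (rule poly_mapping_eqI)
  fix \<mu>
  have "Poly_Mapping.lookup (weyl_twist i (F * G)) \<mu> =
      (\<Sum>\<kappa>\<in>Poly_Mapping.keys G. Poly_Mapping.lookup F (wrefl i \<mu> - \<kappa>) * Poly_Mapping.lookup G \<kappa>)"
    unfolding lookup_weyl_twist[OF i] by (rule lookup_mult_group) auto
  also have "\<dots> = (\<Sum>\<kappa>\<in>wrefl i ` Poly_Mapping.keys G.
      Poly_Mapping.lookup (weyl_twist i F) (\<mu> - \<kappa>) * Poly_Mapping.lookup (weyl_twist i G) \<kappa>)"
    by (rule sum.reindex_bij_witness[of _ "wrefl i" "wrefl i"])
      (auto simp: lookup_weyl_twist[OF i] wrefl_wrefl[OF i] wrefl_diff[OF i])
  also have "\<dots> = Poly_Mapping.lookup (weyl_twist i F * weyl_twist i G) \<mu>"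
  proof (rule lookup_mult_group[symmetric])
    show "Poly_Mapping.keys (weyl_twist i G) \<subseteq> wrefl i ` Poly_Mapping.keys G"
    proof
      fix \<kappa> assume "\<kappa> \<in> Poly_Mapping.keys (weyl_twist i G)"
      then have "wrefl i \<kappa> \<in> Poly_Mapping.keys G" by (simp add: in_keys_iff lookup_weyl_twist[OF i])
      then show "\<kappa> \<in> wrefl i ` Poly_Mapping.keys G"
        by (rule rev_image_eqI) (simp add: wrefl_wrefl[OF i])
    qed
  qed simp
  finally show "Poly_Mapping.lookup (weyl_twist i (F * G)) \<mu> = Poly_Mapping.lookup (weyl_twist i F * weyl_twist i G) \<mu>" .
qed

text \<open>Substitute \<open>s \<cdot> \<kappa>\<close> for \<open>\<kappa>\<close> in the convolution and use \<open>s \<cdot> \<mu> - s \<cdot> \<kappa> = s (\<mu> - \<kappa>)\<close>.\<close>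

lemma lookup_twist_mult_alternating:
  assumes i: "i \<in> {1, 2}" and D: "alternating D"
  shows "Poly_Mapping.lookup (weyl_twist i F * D) \<mu> = - Poly_Mapping.lookup (F * D) (shifted (wrefl i) \<mu>)"
proof -
  have D': "Poly_Mapping.lookup D (shifted (wrefl i) \<kappa>) = - Poly_Mapping.lookup D \<kappa>" for \<kappa>
    using D i unfolding alternating_def by blast
  have "Poly_Mapping.lookup (weyl_twist i F * D) \<mu> =
      (\<Sum>\<kappa>\<in>Poly_Mapping.keys D. Poly_Mapping.lookup F (wrefl i (\<mu> - \<kappa>)) * Poly_Mapping.lookup D \<kappa>)"
    by (subst lookup_mult_group[of "Poly_Mapping.keys D"]) (simp_all add: lookup_weyl_twist[OF i])
  also have "\<dots> = (\<Sum>\<kappa>\<in>Poly_Mapping.keys D.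
      - (Poly_Mapping.lookup F (shifted (wrefl i) \<mu> - \<kappa>) * Poly_Mapping.lookup D \<kappa>))"
    by (rule sum.reindex_bij_witness[of _ "shifted (wrefl i)" "shifted (wrefl i)"])
      (auto simp: shifted_shifted[OF i] D' in_keys_iff shifted_diff[OF i])
  also have "\<dots> = - Poly_Mapping.lookup (F * D) (shifted (wrefl i) \<mu>)"
    by (subst lookup_mult_group[of "Poly_Mapping.keys D"]) (simp_all add: sum_negf)
  finally show ?thesis .
qed

lemma invariant_times_alternating:
  assumes "weyl_invariant F" "alternating D"
  shows "alternating (F * D)"
  unfolding alternating_def
proof (intro ballI allI)
  fix i :: nat and \<mu> assume i: "i \<in> {1, 2}"
  with assms(1) have "weyl_twist i F = F" unfolding weyl_invariant_iff by blast
  with lookup_twist_mult_alternating[OF i assms(2), of F \<mu>]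
  show "Poly_Mapping.lookup (F * D) (shifted (wrefl i) \<mu>) = - Poly_Mapping.lookup (F * D) \<mu>" by simp
qed

text \<open>Simple reflections take every weight, under the shifted action, to a dominant one or to one that is
  fixed by a simple reflection; at the latter an alternating element vanishes.\<close>

lemma alternating_zero:
  assumes A: "alternating A" and dom: "\<And>\<mu>. \<mu> \<in> dominant \<Longrightarrow> Poly_Mapping.lookup A \<mu> = 0"
  shows "A = 0"
proof -
  \<comment> \<open>recentred at \<open>-\<rho>\<close>, so that the shifted action becomes the linear one\<close>
  define g where "g x y = Poly_Mapping.lookup A (x - 1, y - 1)" for x y
  have 1: "g (- x) (x + y) = - g x y" for x y
    using A[unfolded alternating_def, rule_format, of 1 "(x - 1, y - 1)"]
    by (simp add: g_def shifted_def rho_def refl_simps algebra_simps)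
  have 2: "g (x + y) (- y) = - g x y" for x y
    using A[unfolded alternating_def, rule_format, of 2 "(x - 1, y - 1)"]
    by (simp add: g_def shifted_def rho_def refl_simps algebra_simps)
  have pos: "g x y = 0" if "x > 0" "y > 0" for x y
    unfolding g_def using that by (intro dom) (simp add: dominant_def pairing_def)
  have x0: "g 0 y = 0" for y using 1[of 0 y] by simp
  have y0: "g x 0 = 0" for x using 2[of x 0] by simp
  have a: "g x y = 0" if "y > 0" for x y
  proof (cases "x > 0 \<or> x = 0")
    case False
    then show ?thesis
      using 1[of x y] pos[of "- x" "x + y"] y0[of "-x"] 2[of "- x" "x + y"] pos[of y "- x - y"] that
      by (cases "x + y > 0"; cases "x + y = 0") auto
  qed (use pos x0 that in auto)
  have "g x y = 0" for x y
    using a[of y x] y0 2[of x y] a[of "- y" "x + y"] by (cases "y > 0"; cases "y = 0") auto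
  then have "Poly_Mapping.lookup A (x, y) = 0" for x y
    using g_def[of "x + 1" "y + 1"] by simp
  then show ?thesis by (intro poly_mapping_eqI) auto
qed

lemma lookup_alternant_dominant:
  assumes "\<mu> \<in> dominant" "\<nu> \<in> dominant"
  shows "Poly_Mapping.lookup (alternant \<nu>) \<mu> = (if \<mu> = \<nu> then 1 else 0)"
proof -
  obtain a b m n where ab: "\<nu> = (a, b)" "\<mu> = (m, n)" by fastforce
  have "a \<ge> 0" "b \<ge> 0" "m \<ge> 0" "n \<ge> 0" using assms by (auto simp: ab dominant_def pairing_def)
  then show ?thesis
    unfolding ab alternant_explicit by (auto simp: lookup_add lookup_minus when_def)
qed

lemma alternant_0_lookup: "Poly_Mapping.lookup (alternant 0) 0 = 1"
  by (rule lookup_alternant_dominant[THEN trans]) (auto simp: dominant_def pairing_def)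

lemma alternant_0_keys: "\<kappa> \<in> Poly_Mapping.keys (alternant 0) \<Longrightarrow> \<kappa> \<noteq> 0 \<Longrightarrow> fst \<kappa> + snd \<kappa> < 0"
  using alternant_explicit[of 0 0]
  by (auto simp: in_keys_iff lookup_add lookup_minus when_def zero_prod_def split: if_splits)

lemma cancel_alternant: "F * alternant 0 = 0 \<Longrightarrow> F = 0"
  by (rule cancel_leading_one[of "alternant 0"]) (use alternant_0_lookup alternant_0_keys in auto)

section \<open>The Weyl character formula\<close>

definition gt_char :: "nat \<Rightarrow> nat \<Rightarrow> weight_ring" where
  "gt_char a b = (\<Sum>p\<le>a. \<Sum>q\<le>b. \<Sum>k\<le>a + q - p.
     frag_of (int a + int q - int p - 2 * int k, int b - 2 * int q - int p + int k))"

lemma lookup_gt_char: "Poly_Mapping.lookup (gt_char a b) \<mu> = int (card (gt_patterns a b \<mu>))"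
proof -
  let ?wt = "\<lambda>(p, q, k). (int a + int q - int p - 2 * int k, int b - 2 * int q - int p + int k)"
  let ?I = "SIGMA p:{..a}. SIGMA q:{..b}. {..a + q - p}"
  have "Poly_Mapping.lookup (gt_char a b) \<mu> = (\<Sum>p\<le>a. \<Sum>q\<le>b. \<Sum>k\<le>a + q - p. if \<mu> = ?wt (p, q, k) then 1 else 0)"
    by (simp add: gt_char_def lookup_sum when_def)
  also have "\<dots> = (\<Sum>i\<in>?I. if \<mu> = ?wt i then 1 else 0)"
    by (simp add: sum.Sigma split_def)
  also have "\<dots> = (\<Sum>i\<in>{i \<in> ?I. \<mu> = ?wt i}. 1)"
    by (subst sum.inter_filter) auto
  also have "{i \<in> ?I. \<mu> = ?wt i} = gt_patterns a b \<mu>"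
    by (auto simp: gt_patterns_def)
  finally show ?thesis by simp
qed

definition irr_char :: "weight \<Rightarrow> weight_ring" where
  "irr_char \<nu> = gt_char (nat (fst \<nu>)) (nat (snd \<nu>))"

lemma lookup_irr_char:
  assumes "\<nu> \<in> dominant"
  shows "Poly_Mapping.lookup (irr_char \<nu>) \<mu> = int (mbar \<nu> \<mu>)"
proof -
  have "\<nu> = (int (nat (fst \<nu>)), int (nat (snd \<nu>)))"
    using assms by (auto simp: dominant_def pairing_def prod_eq_iff)
  then show ?thesis
    unfolding irr_char_def lookup_gt_char using mbar_eq_card by metis
qed

lemma frag_of_power: "frag_of \<mu> ^ n = frag_of (wscale (int n) \<mu>)"
  by (induction n; cases \<mu>) (auto simp: wscale_def mult_single algebra_simps simp flip: single_one zero_prod_def)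

text \<open>Multiplication by \<open>1 - X\<close> collapses the sum over \<open>k\<close> to two terms.  Because of \<open>Z = X Y\<close> the
  second one is \<open>X\<^sup>a\<^sup>+\<^sup>1 Z\<^sup>q Y\<^sup>p\<close>, so that both leave products of geometric series; in the final
  expansion the terms \<open>Z\<^sup>a\<^sup>+\<^sup>1\<close> and \<open>X\<^sup>a\<^sup>+\<^sup>1 Y\<^sup>a\<^sup>+\<^sup>1\<close> cancel.\<close>

lemma weyl_identity:
  fixes X Y Z :: "'a::comm_ring_1"
  assumes Z: "Z = X * Y"
  shows "(\<Sum>p\<le>a. \<Sum>q\<le>b. \<Sum>k\<le>a + q - p. Y ^ q * Z ^ p * X ^ k) * ((1 - X) * (1 - Y) * (1 - Z)) =
    1 - X ^ Suc a - Y ^ Suc b + X ^ Suc a * Z ^ Suc b + Y ^ Suc b * Z ^ Suc a - Z ^ Suc a * Z ^ Suc b"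
proof -
  define g where "g x n = (\<Sum>i\<le>n. x ^ i)" for x :: 'a and n
  define S where "S = (\<Sum>p\<le>a. \<Sum>q\<le>b. \<Sum>k\<le>a + q - p. Y ^ q * Z ^ p * X ^ k)"
  have g: "g x n * (1 - x) = 1 - x ^ Suc n" for x n
    using sum_gp_basic[of x n] by (simp add: g_def mult.commute)
  have "(\<Sum>k\<le>a + q - p. Y ^ q * Z ^ p * X ^ k) * (1 - X) = Y ^ q * Z ^ p - X ^ Suc a * (Z ^ q * Y ^ p)"
    if "p \<le> a" for p q
  proof -
    have "(\<Sum>k\<le>a + q - p. Y ^ q * Z ^ p * X ^ k) * (1 - X) = Y ^ q * Z ^ p * (g X (a + q - p) * (1 - X))"
      by (simp add: g_def sum_distrib_left sum_distrib_right mult.assoc)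
    also have "\<dots> = Y ^ q * Z ^ p - Y ^ q * Y ^ p * (X ^ p * X ^ Suc (a + q - p))"
      unfolding g by (simp add: Z power_mult_distrib algebra_simps)
    also have "X ^ p * X ^ Suc (a + q - p) = X ^ Suc a * X ^ q"
    proof -
      have "p + Suc (a + q - p) = Suc a + q" using that by simp
      then show ?thesis by (simp only: power_add[symmetric])
    qed
    finally show ?thesis by (simp add: Z power_mult_distrib algebra_simps)
  qed
  then have "S * (1 - X) =
      (\<Sum>p\<le>a. \<Sum>q\<le>b. Y ^ q * Z ^ p - X ^ Suc a * (Z ^ q * Y ^ p))"
    by (simp add: S_def sum_distrib_right)
  also have "\<dots> = g Z a * g Y b - X ^ Suc a * (g Y a * g Z b)"
  proof -
    have "(\<Sum>p\<le>a. \<Sum>q\<le>b. Y ^ q * Z ^ p) = g Z a * g Y b"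
      unfolding g_def sum_product by (intro sum.cong refl mult.commute)
    moreover have "g Y a * g Z b = (\<Sum>p\<le>a. \<Sum>q\<le>b. Z ^ q * Y ^ p)"
      unfolding g_def sum_product by (intro sum.cong refl mult.commute)
    then have "(\<Sum>p\<le>a. \<Sum>q\<le>b. X ^ Suc a * (Z ^ q * Y ^ p)) = X ^ Suc a * (g Y a * g Z b)"
      by (simp only: sum_distrib_left)
    ultimately show ?thesis by (simp only: sum_subtractf)
  qed
  finally have X: "S * (1 - X) = g Z a * g Y b - X ^ Suc a * (g Y a * g Z b)" .
  have "S * ((1 - X) * (1 - Y) * (1 - Z)) = S * (1 - X) * ((1 - Y) * (1 - Z))"
    by (simp only: mult.assoc)
  also have "\<dots> = (g Z a * g Y b - X ^ Suc a * (g Y a * g Z b)) * ((1 - Y) * (1 - Z))"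
    unfolding X ..
  also have "\<dots> = (g Z a * (1 - Z)) * (g Y b * (1 - Y)) - X ^ Suc a * ((g Y a * (1 - Y)) * (g Z b * (1 - Z)))"
    by (simp add: algebra_simps)
  also have "\<dots> = (1 - Z ^ Suc a) * (1 - Y ^ Suc b) - X ^ Suc a * ((1 - Y ^ Suc a) * (1 - Z ^ Suc b))"
    unfolding g ..
  also have "\<dots> = 1 - X ^ Suc a - Y ^ Suc b + X ^ Suc a * Z ^ Suc b + Y ^ Suc b * Z ^ Suc a - Z ^ Suc a * Z ^ Suc b"
  proof -
    have "Z ^ Suc a = X ^ Suc a * Y ^ Suc a" by (simp only: Z power_mult_distrib)
    moreover have "(1 - x * y) * (1 - v) - x * ((1 - y) * (1 - z)) = 1 - x - v + x * z + v * (x * y) - x * y * z"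
      for x y z v :: 'a by (simp add: algebra_simps)
    ultimately show ?thesis by (simp only:)
  qed
  finally show ?thesis unfolding S_def .
qed

text \<open>Take for \<open>X\<close>, \<open>Y\<close>, \<open>Z\<close> the exponentials of the negatives of the three positive roots.\<close>

theorem weyl_character_formula: "gt_char a b * alternant 0 = alternant (int a, int b)"
proof -
  let ?X = "frag_of (-2, 1) :: weight_ring" and ?Y = "frag_of (1, -2) :: weight_ring"
    and ?Z = "frag_of (-1, -1) :: weight_ring" and ?L = "frag_of (int a, int b) :: weight_ring"
  have Z: "?Z = ?X * ?Y" by (simp add: mult_single)
  have D: "alternant 0 = (1 - ?X) * (1 - ?Y) * (1 - ?Z)"
    using alternant_explicit[of 0 0]
    by (simp add: algebra_simps mult_single zero_prod_def flip: single_one)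
  have "gt_char a b = ?L * (\<Sum>p\<le>a. \<Sum>q\<le>b. \<Sum>k\<le>a + q - p. ?Y ^ q * ?Z ^ p * ?X ^ k)"
    by (simp add: gt_char_def sum_distrib_left frag_of_power mult_single wscale_def algebra_simps)
  then have "gt_char a b * alternant 0 = ?L * (1 - ?X ^ Suc a - ?Y ^ Suc b + ?X ^ Suc a * ?Z ^ Suc b
      + ?Y ^ Suc b * ?Z ^ Suc a - ?Z ^ Suc a * ?Z ^ Suc b)"
    unfolding D weyl_identity[OF Z, symmetric] by (simp only: mult.assoc)
  also have "\<dots> = alternant (int a, int b)"
    unfolding alternant_explicit frag_of_power
    by (simp add: mult_single wscale_def algebra_simps)
  finally show ?thesis .
qed

lemma irr_char_times_alternant: "\<nu> \<in> dominant \<Longrightarrow> irr_char \<nu> * alternant 0 = alternant \<nu>"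
  unfolding irr_char_def weyl_character_formula
  by (rule arg_cong[where f = alternant]) (auto simp: dominant_def pairing_def prod_eq_iff)

text \<open>In Weyl's formula the numerator and the denominator are alternating, and the denominator can be
  cancelled.\<close>

lemma irr_char_invariant:
  assumes "\<nu> \<in> dominant"
  shows "weyl_invariant (irr_char \<nu>)"
  unfolding weyl_invariant_iff
proof
  fix i :: nat assume i: "i \<in> {1, 2}"
  have "weyl_twist i (irr_char \<nu>) * alternant 0 = irr_char \<nu> * alternant 0"
  proof (rule poly_mapping_eqI)
    fix \<mu>
    have "Poly_Mapping.lookup (alternant \<nu>) (shifted (wrefl i) \<mu>) = - Poly_Mapping.lookup (alternant \<nu>) \<mu>"
      using alternant_alternating i unfolding alternating_def by blast
    then show "Poly_Mapping.lookup (weyl_twist i (irr_char \<nu>) * alternant 0) \<mu> =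
        Poly_Mapping.lookup (irr_char \<nu> * alternant 0) \<mu>"
      unfolding lookup_twist_mult_alternating[OF i alternant_alternating] irr_char_times_alternant[OF assms] by simp
  qed
  then have "(weyl_twist i (irr_char \<nu>) - irr_char \<nu>) * alternant 0 = 0"
    by (simp add: left_diff_distrib)
  then show "weyl_twist i (irr_char \<nu>) = irr_char \<nu>"
    using cancel_alternant by fastforce
qed

text \<open>After multiplication by the denominator both sides are alternating, and they agree at dominant
  weights because \<open>alternant \<nu>\<close> has no dominant exponent other than \<open>\<nu>\<close>.\<close>

lemma invariant_expansion:
  assumes "weyl_invariant K"
  shows "K = (\<Sum>\<nu>\<in>Poly_Mapping.keys (K * alternant 0) \<inter> dominant.
    frag_cmul (Poly_Mapping.lookup (K * alternant 0) \<nu>) (irr_char \<nu>))" (is "K = ?R")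
proof -
  let ?A = "K * alternant 0" let ?S = "Poly_Mapping.keys ?A \<inter> dominant"
  have cm: "frag_cmul c F * G = frag_cmul c (F * G)" for c and F G :: weight_ring
  proof -
    have "frag_cmul c F = Poly_Mapping.single 0 c * F" for F :: weight_ring
      by (rule poly_mapping_eqI) (simp add: lookup_mult_single mult.commute[of "Poly_Mapping.single 0 c"])
    then show ?thesis by (simp add: mult.assoc)
  qed
  define B where "B = (\<Sum>\<nu>\<in>?S. frag_cmul (Poly_Mapping.lookup ?A \<nu>) (alternant \<nu>))"
  have RB: "?R * alternant 0 = B"
    unfolding B_def sum_distrib_right by (rule sum.cong) (auto simp: cm irr_char_times_alternant)
  have "alternating (?A - B)"
    unfolding alternating_def
  proof (intro ballI allI)
    fix i :: nat and \<mu> assume i: "i \<in> {1, 2}"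
    have a: "Poly_Mapping.lookup C (shifted (wrefl i) \<mu>) = - Poly_Mapping.lookup C \<mu>" if "alternating C" for C
      using that i unfolding alternating_def by blast
    show "Poly_Mapping.lookup (?A - B) (shifted (wrefl i) \<mu>) = - Poly_Mapping.lookup (?A - B) \<mu>"
      unfolding B_def lookup_minus lookup_sum lookup_frag_cmul a[OF alternant_alternating]
        a[OF invariant_times_alternating[OF assms alternant_alternating]]
      by (simp add: sum_negf)
  qed
  then have "?A - B = 0"
  proof (rule alternating_zero)
    fix \<mu> assume \<mu>: "\<mu> \<in> dominant"
    have "Poly_Mapping.lookup B \<mu> = (\<Sum>\<nu>\<in>?S. if \<nu> = \<mu> then Poly_Mapping.lookup ?A \<nu> else 0)"
      unfolding B_def lookup_sum lookup_frag_cmul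
      by (rule sum.cong) (auto simp: lookup_alternant_dominant[OF \<mu>])
    also have "\<dots> = Poly_Mapping.lookup ?A \<mu>"
      using \<mu> by (simp add: in_keys_iff)
    finally show "Poly_Mapping.lookup (?A - B) \<mu> = 0" by (simp add: lookup_minus)
  qed
  then have "(K - ?R) * alternant 0 = 0"
    by (simp only: left_diff_distrib RB)
  then have "K - ?R = 0" by (rule cancel_alternant)
  then show ?thesis by simp
qed

section \<open>The grading modulo 3\<close>

text \<open>For \<open>i = 0, 1, 2\<close> these are the three classes of the root lattice modulo \<open>3P\<close>.\<close>

definition grade :: "int \<Rightarrow> weight set" where
  "grade i = {\<mu>. 3 dvd fst \<mu> - i \<and> 3 dvd snd \<mu> - i}"

definition grade_part :: "int \<Rightarrow> weight_ring \<Rightarrow> weight_ring" where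
  "grade_part i F = Poly_Mapping.mapp (\<lambda>\<mu> c. if \<mu> \<in> grade i then c else 0) F"

lemma lookup_grade_part: "Poly_Mapping.lookup (grade_part i F) \<mu> = (if \<mu> \<in> grade i then Poly_Mapping.lookup F \<mu> else 0)"
  by (simp add: grade_part_def lookup_mapp when_def in_keys_iff)

definition graded :: "int \<Rightarrow> weight_ring \<Rightarrow> bool" where
  "graded i F \<longleftrightarrow> Poly_Mapping.keys F \<subseteq> grade i"

lemma graded_grade_part: "graded i (grade_part i F)"
  by (auto simp: graded_def in_keys_iff lookup_grade_part split: if_splits)

lemma graded_mult:
  assumes "graded i F" "graded j G"
  shows "graded (i + j) (F * G)"
  unfolding graded_def
proof
  fix \<mu> assume "\<mu> \<in> Poly_Mapping.keys (F * G)"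
  then have "\<exists>\<kappa> \<eta>. \<mu> = \<kappa> + \<eta> \<and> \<kappa> \<in> Poly_Mapping.keys F \<and> \<eta> \<in> Poly_Mapping.keys G"
    using keys_mult[of F G] by blast
  then obtain \<kappa> \<eta> where "\<mu> = \<kappa> + \<eta>" "\<kappa> \<in> grade i" "\<eta> \<in> grade j"
    using assms unfolding graded_def by blast
  then have "fst \<mu> - (i + j) = (fst \<kappa> - i) + (fst \<eta> - j)" "snd \<mu> - (i + j) = (snd \<kappa> - i) + (snd \<eta> - j)"
    "3 dvd fst \<kappa> - i" "3 dvd snd \<kappa> - i" "3 dvd fst \<eta> - j" "3 dvd snd \<eta> - j"
    by (auto simp: grade_def)
  then have "3 dvd fst \<mu> - (i + j)" "3 dvd snd \<mu> - (i + j)"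
    by (simp_all only: dvd_add)
  then show "\<mu> \<in> grade (i + j)" by (simp add: grade_def)
qed

lemma graded_add: "graded i F \<Longrightarrow> graded i G \<Longrightarrow> graded i (F + G)"
  using keys_add[of F G] by (auto simp: graded_def)

lemma graded_diff: "graded i F \<Longrightarrow> graded i G \<Longrightarrow> graded i (F - G)"
  using keys_diff[of F G] by (auto simp: graded_def)

lemma grade_shift: "grade (i + 3) = grade i"
proof -
  have "3 dvd x - (i + 3) \<longleftrightarrow> 3 dvd x - i" for x by presburger
  then show ?thesis by (simp add: grade_def)
qed

lemma graded_shift: "graded (i + 3) F \<Longrightarrow> graded i F"
  by (simp add: graded_def grade_shift)

lemma grade_unique: "\<mu> \<in> grade i \<Longrightarrow> \<mu> \<in> grade j \<Longrightarrow> 3 dvd i - j"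
  unfolding grade_def mem_Collect_eq by presburger

lemma graded_lookup: "graded i F \<Longrightarrow> \<mu> \<in> grade j \<Longrightarrow> \<not> 3 dvd i - j \<Longrightarrow> Poly_Mapping.lookup F \<mu> = 0"
  using grade_unique[of \<mu> i j] by (auto simp: graded_def in_keys_iff)

lemma decompose:
  assumes "Poly_Mapping.keys F \<subseteq> grade 0 \<union> grade 1 \<union> grade 2"
  shows "F = grade_part 0 F + grade_part 1 F + grade_part 2 F"
proof (rule poly_mapping_eqI)
  fix \<mu>
  show "Poly_Mapping.lookup F \<mu> = Poly_Mapping.lookup (grade_part 0 F + grade_part 1 F + grade_part 2 F) \<mu>"
    using assms grade_unique[of \<mu> 0 1] grade_unique[of \<mu> 0 2] grade_unique[of \<mu> 1 2]
    by (cases "Poly_Mapping.lookup F \<mu> = 0") (auto simp: lookup_add lookup_grade_part in_keys_iff)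
qed

lemma wrefl_grade: "i \<in> {1, 2} \<Longrightarrow> wrefl i \<mu> \<in> grade j \<longleftrightarrow> \<mu> \<in> grade (- j)"
  by (cases \<mu>) (auto simp: grade_def refl_simps; presburger)

lemma grade_minus: "grade (- 1) = grade 2" "grade (- 2) = grade 1"
  using grade_shift[of "-1"] grade_shift[of "-2"] by simp_all

lemma twist_part:
  assumes "i \<in> {1, 2}" "weyl_invariant F"
  shows "weyl_twist i (grade_part 0 F) = grade_part 0 F" "weyl_twist i (grade_part 1 F) = grade_part 2 F" "weyl_twist i (grade_part 2 F) = grade_part 1 F"
proof -
  have "Poly_Mapping.lookup F (wrefl i \<mu>) = Poly_Mapping.lookup F \<mu>" for \<mu>
    using assms unfolding weyl_invariant_def by blast
  then show "weyl_twist i (grade_part 0 F) = grade_part 0 F" "weyl_twist i (grade_part 1 F) = grade_part 2 F"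
    "weyl_twist i (grade_part 2 F) = grade_part 1 F"
    by (auto simp: poly_mapping_eq_iff fun_eq_iff lookup_weyl_twist[OF assms(1)] lookup_grade_part
        wrefl_grade[OF assms(1)] grade_minus)
qed

text \<open>Under the shifted action rotations preserve the classes, while reflections exchange the classes \<open>0\<close>
  and \<open>1\<close>.\<close>

lemma keys_alternant:
  assumes "\<nu> \<in> grade 0 \<union> grade 1"
  shows "Poly_Mapping.keys (alternant \<nu>) \<subseteq> grade 0 \<union> grade 1"
proof
  fix \<mu> assume k: "\<mu> \<in> Poly_Mapping.keys (alternant \<nu>)"
  obtain a b where ab: "\<nu> = (a, b)" by fastforce
  from k have "\<mu> \<in> {(a, b), (- a - 2, a + b + 1), (a + b + 1, - b - 2), (- a - b - 3, a), (b, - a - b - 3), (- b - 2, - a - 2)}"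
    unfolding ab alternant_explicit by (auto simp: in_keys_iff lookup_add lookup_minus when_def split: if_splits)
  moreover have "(3 dvd a \<and> 3 dvd b) \<or> (3 dvd a - 1 \<and> 3 dvd b - 1)"
    using assms by (auto simp: ab grade_def)
  ultimately show "\<mu> \<in> grade 0 \<union> grade 1"
    unfolding insert_iff empty_iff
    by (elim disjE FalseE; simp add: grade_def; presburger)
qed

lemma keys_irr_char:
  assumes "\<nu> \<in> dominant" "\<nu> \<in> grade 0 \<union> grade 1"
  shows "Poly_Mapping.keys (irr_char \<nu>) \<subseteq> grade 0 \<union> grade 1 \<union> grade 2"
proof
  fix \<mu> assume "\<mu> \<in> Poly_Mapping.keys (irr_char \<nu>)"
  then have "gt_patterns (nat (fst \<nu>)) (nat (snd \<nu>)) \<mu> \<noteq> {}"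
    by (auto simp: in_keys_iff irr_char_def lookup_gt_char)
  then obtain p q k :: nat where \<mu>: "\<mu> = (fst \<nu> + int q - int p - 2 * int k, snd \<nu> - 2 * int q - int p + int k)"
    using assms(1) by (auto simp: gt_patterns_def dominant_def pairing_def)
  have "3 dvd fst \<nu> - snd \<nu>" using assms(2) unfolding grade_def by (auto; presburger)
  then have "3 dvd fst \<mu> - snd \<mu>" by (simp add: \<mu>) presburger
  then have "(3 dvd fst \<mu> \<and> 3 dvd snd \<mu>) \<or> (3 dvd fst \<mu> - 1 \<and> 3 dvd snd \<mu> - 1) \<or> (3 dvd fst \<mu> - 2 \<and> 3 dvd snd \<mu> - 2)"
    by presburger
  then show "\<mu> \<in> grade 0 \<union> grade 1 \<union> grade 2" by (auto simp: grade_def)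
qed

lemma alternant_0_split: "alternant 0 = grade_part 0 (alternant 0) + grade_part 1 (alternant 0)"
proof -
  have k: "Poly_Mapping.keys (alternant 0) \<subseteq> grade 0 \<union> grade 1"
    by (rule keys_alternant) (simp add: grade_def)
  have "grade_part 2 (alternant 0) = 0"
  proof (rule poly_mapping_eqI)
    fix \<mu>
    show "Poly_Mapping.lookup (grade_part 2 (alternant 0)) \<mu> = Poly_Mapping.lookup 0 \<mu>"
      using k grade_unique[of \<mu> 0 2] grade_unique[of \<mu> 1 2] by (auto simp: lookup_grade_part in_keys_iff)
  qed
  then show ?thesis using decompose[of "alternant 0"] k by auto
qed

lemma cancel_alternant_even: "F * grade_part 0 (alternant 0) = 0 \<Longrightarrow> F = 0"
proof (rule cancel_leading_one[of "grade_part 0 (alternant 0)"])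
  show "Poly_Mapping.lookup (grade_part 0 (alternant 0)) 0 \<noteq> 0"
    by (simp add: lookup_grade_part alternant_0_lookup grade_def)
  show "fst \<kappa> + snd \<kappa> < 0" if "\<kappa> \<in> Poly_Mapping.keys (grade_part 0 (alternant 0))" "\<kappa> \<noteq> 0" for \<kappa>
    using that by (intro alternant_0_keys) (auto simp: in_keys_iff lookup_grade_part split: if_splits)
qed

text \<open>This is the part of class \<open>2\<close> of the Weyl character formula, whose numerator has no such terms.\<close>

lemma irr_char_relation:
  assumes \<nu>: "\<nu> \<in> dominant" "\<nu> \<in> grade 0 \<union> grade 1"
  shows "grade_part 2 (irr_char \<nu>) * grade_part 0 (alternant 0) + grade_part 1 (irr_char \<nu>) * grade_part 1 (alternant 0) = 0"
proof -
  let ?F = "irr_char \<nu>"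
  let ?Fa = "grade_part 0 ?F" and ?Fb = "grade_part 1 ?F" and ?Fc = "grade_part 2 ?F"
  let ?Da = "grade_part 0 (alternant 0)" and ?Db = "grade_part 1 (alternant 0)"
  have g: "graded 0 (?Fa * ?Da)" "graded 1 (?Fb * ?Da)" "graded 1 (?Fa * ?Db)" "graded 0 (?Fc * ?Db)"
    "graded 2 (?Fc * ?Da)" "graded 2 (?Fb * ?Db)"
    using graded_mult[OF graded_grade_part[of 0 ?F] graded_grade_part[of 0 "alternant 0"]]
      graded_mult[OF graded_grade_part[of 1 ?F] graded_grade_part[of 0 "alternant 0"]]
      graded_mult[OF graded_grade_part[of 0 ?F] graded_grade_part[of 1 "alternant 0"]]
      graded_mult[OF graded_grade_part[of 2 ?F] graded_grade_part[of 1 "alternant 0"]]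
      graded_mult[OF graded_grade_part[of 2 ?F] graded_grade_part[of 0 "alternant 0"]]
      graded_mult[OF graded_grade_part[of 1 ?F] graded_grade_part[of 1 "alternant 0"]]
      graded_shift[of 0]
    by simp_all
  have "alternant \<nu> = (?Fa + ?Fb + ?Fc) * (?Da + ?Db)"
    using irr_char_times_alternant[OF \<nu>(1)] decompose[OF keys_irr_char[OF \<nu>]] alternant_0_split by simp
  then have e: "?Fc * ?Da + ?Fb * ?Db = alternant \<nu> - (?Fa * ?Da + ?Fb * ?Da + ?Fa * ?Db + ?Fc * ?Db)"
    by (simp add: algebra_simps)
  show ?thesis
  proof (rule poly_mapping_eqI)
    fix \<mu>
    show "Poly_Mapping.lookup (?Fc * ?Da + ?Fb * ?Db) \<mu> = Poly_Mapping.lookup 0 \<mu>"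
    proof (cases "\<mu> \<in> grade 2")
      case True
      then have "Poly_Mapping.lookup (alternant \<nu>) \<mu> = 0"
        using keys_alternant[OF \<nu>(2)] grade_unique[of \<mu> 0 2] grade_unique[of \<mu> 1 2] by (auto simp: in_keys_iff)
      then show ?thesis
        unfolding e using True by (simp add: lookup_minus lookup_add graded_lookup[OF g(1)] graded_lookup[OF g(2)]
            graded_lookup[OF g(3)] graded_lookup[OF g(4)])
    next
      case False
      then show ?thesis
        using graded_add[OF g(5,6)] by (auto simp: graded_def in_keys_iff)
    qed
  qed
qed

text \<open>The element \<open>K\<close> in the proof differs from the truncated product only in class \<open>2\<close>, where
  \<open>F\<^sub>0 G\<^sub>2\<close> takes the place of \<open>F\<^sub>1 G\<^sub>1\<close> to make it Weyl invariant.  The relations of \<open>irr_char_relation\<close> are used three times: for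
  \<open>F\<^sub>2 G\<^sub>1 = F\<^sub>1 G\<^sub>2\<close>, for the agreement of \<open>K D\<close> with \<open>F G D\<close> on the classes \<open>0\<close> and \<open>1\<close>, and for the
  absence of terms of class \<open>2\<close> in \<open>K D\<close>.\<close>

theorem truncated_product:
  assumes \<nu>: "\<nu> \<in> dominant" "\<nu> \<in> grade 0 \<union> grade 1" and \<eta>: "\<eta> \<in> dominant" "\<eta> \<in> grade 0 \<union> grade 1"
    and \<mu>: "\<mu> \<in> grade 0 \<union> grade 1"
  shows "Poly_Mapping.lookup (irr_char \<nu> * (grade_part 0 (irr_char \<eta>) + grade_part 1 (irr_char \<eta>))) \<mu> =
    (\<Sum>\<kappa> | \<kappa> \<in> dominant \<and> \<kappa> \<in> grade 0 \<union> grade 1 \<and> Poly_Mapping.lookup (irr_char \<nu> * alternant \<eta>) \<kappa> \<noteq> 0.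
      Poly_Mapping.lookup (irr_char \<nu> * alternant \<eta>) \<kappa> * Poly_Mapping.lookup (irr_char \<kappa>) \<mu>)"
proof -
  define F0 F1 F2 where F: "F0 = grade_part 0 (irr_char \<nu>)" "F1 = grade_part 1 (irr_char \<nu>)" "F2 = grade_part 2 (irr_char \<nu>)"
  define G0 G1 G2 where G: "G0 = grade_part 0 (irr_char \<eta>)" "G1 = grade_part 1 (irr_char \<eta>)" "G2 = grade_part 2 (irr_char \<eta>)"
  define D0 D1 where D: "D0 = grade_part 0 (alternant 0)" "D1 = grade_part 1 (alternant 0)"
  define K where "K = F0 * G0 + F2 * G1 + (F1 * G0 + F0 * G1) + (F2 * G0 + F0 * G2)"
  have Fs: "irr_char \<nu> = F0 + F1 + F2" unfolding F by (rule decompose[OF keys_irr_char[OF \<nu>]])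
  have Gs: "irr_char \<eta> = G0 + G1 + G2" unfolding G by (rule decompose[OF keys_irr_char[OF \<eta>]])
  have Ds: "alternant 0 = D0 + D1" unfolding D by (rule alternant_0_split)
  have FD: "F2 * D0 + F1 * D1 = 0" unfolding F D by (rule irr_char_relation[OF \<nu>])
  have GD: "G2 * D0 + G1 * D1 = 0" unfolding G D by (rule irr_char_relation[OF \<eta>])
  have "(F2 * G1 - F1 * G2) * D0 = G1 * (F2 * D0 + F1 * D1) - F1 * (G2 * D0 + G1 * D1)"
    by (simp add: algebra_simps)
  then have "(F2 * G1 - F1 * G2) * D0 = 0" by (simp add: FD GD)
  then have FG: "F2 * G1 = F1 * G2"
    using cancel_alternant_even[of "F2 * G1 - F1 * G2"] by (simp add: D)
  have K_inv: "weyl_invariant K"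
    unfolding weyl_invariant_iff
  proof
    fix i :: nat assume i: "i \<in> {1, 2}"
    have "weyl_twist i F0 = F0" "weyl_twist i F1 = F2" "weyl_twist i F2 = F1"
      unfolding F by (rule twist_part[OF i irr_char_invariant[OF \<nu>(1)]])+
    moreover have "weyl_twist i G0 = G0" "weyl_twist i G1 = G2" "weyl_twist i G2 = G1"
      unfolding G by (rule twist_part[OF i irr_char_invariant[OF \<eta>(1)]])+
    ultimately show "weyl_twist i K = K"
      unfolding K_def weyl_twist_add[OF i] weyl_twist_mult[OF i] by (simp add: FG algebra_simps)
  qed
  have gr: "graded 0 F0" "graded 1 F1" "graded 2 F2" "graded 0 G0" "graded 1 G1" "graded 2 G2"
    "graded 0 D0" "graded 1 D1"
    unfolding F G D by (rule graded_grade_part)+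
  have sh: "graded 3 H \<Longrightarrow> graded 0 H" "graded 4 H \<Longrightarrow> graded 1 H" "graded 5 H \<Longrightarrow> graded 2 H" for H
    using graded_shift[of 0 H] graded_shift[of 1 H] graded_shift[of 2 H] by simp_all
  have p: "graded 0 (F0 * G0)" "graded 0 (F2 * G1)" "graded 1 (F1 * G0)" "graded 1 (F0 * G1)"
    "graded 2 (F2 * G0)" "graded 2 (F0 * G2)" "graded 2 (F1 * G1)" "graded 1 (F2 * G2)"
    using graded_mult[OF gr(1) gr(4)] graded_mult[OF gr(3) gr(5)] graded_mult[OF gr(2) gr(4)]
      graded_mult[OF gr(1) gr(5)] graded_mult[OF gr(3) gr(4)] graded_mult[OF gr(1) gr(6)]
      graded_mult[OF gr(2) gr(5)] graded_mult[OF gr(3) gr(6)]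
    by (simp_all add: sh)
  have D0m: "graded i (H * D0)" if "graded i H" for i H using graded_mult[OF that gr(7)] by simp
  have D1m: "graded 1 (H * D1)" if "graded 0 H" for H using graded_mult[OF that gr(8)] by simp
  have D1m': "graded 2 (H * D1)" if "graded 1 H" for H using graded_mult[OF that gr(8)] by simp
  have D1m'': "graded 0 (H * D1)" if "graded 2 H" for H using graded_mult[OF that gr(8)] by (simp add: sh)

  let ?C = "grade 0 \<union> grade 1"
  have low: "Poly_Mapping.lookup T \<kappa> = 0" if "graded 2 T" "\<kappa> \<in> ?C" for T \<kappa>
    using that graded_lookup[of 2 T \<kappa> 0] graded_lookup[of 2 T \<kappa> 1] by auto
  \<comment> \<open>on the classes \<open>0\<close> and \<open>1\<close> the truncated product is \<open>K\<close>\<close>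
  have "irr_char \<nu> * (G0 + G1) = K + (F1 * G1 - F0 * G2)"
    unfolding Fs K_def by (simp add: algebra_simps)
  moreover have "graded 2 (F1 * G1 - F0 * G2)" by (rule graded_diff[OF p(7) p(6)])
  ultimately have 1: "Poly_Mapping.lookup (irr_char \<nu> * (G0 + G1)) \<mu> = Poly_Mapping.lookup K \<mu>"
    using low[OF _ \<mu>] by (simp add: lookup_add)
  have "irr_char \<nu> * alternant \<eta> = (F0 + F1 + F2) * (G0 + G1 + G2) * (D0 + D1)"
    unfolding irr_char_times_alternant[OF \<eta>(1), symmetric] Fs Gs Ds by (simp only: mult.assoc)
  also have "\<dots> = K * (D0 + D1) + (F1 * G1 * D0 + F2 * G2 * D1)
      + F1 * (G2 * D0 + G1 * D1) + G2 * (F2 * D0 + F1 * D1)"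
    unfolding K_def using FG by (simp add: algebra_simps)
  finally have N: "irr_char \<nu> * alternant \<eta> = K * alternant 0 + (F1 * G1 * D0 + F2 * G2 * D1)"
    by (simp add: FD GD Ds)
  have 2: "Poly_Mapping.lookup (irr_char \<nu> * alternant \<eta>) \<kappa> = Poly_Mapping.lookup (K * alternant 0) \<kappa>" if "\<kappa> \<in> ?C" for \<kappa>
    unfolding N using low[OF graded_add[OF D0m[OF p(7)] D1m'[OF p(8)]] that] by (simp add: lookup_add)
  have "K * alternant 0 = ((F0 * G0 + F2 * G1) * D0 + (F2 * G0 + F0 * G2) * D1)
      + ((F1 * G0 + F0 * G1) * D0 + (F0 * G0 + F2 * G1) * D1)
      + G0 * (F2 * D0 + F1 * D1) + F0 * (G2 * D0 + G1 * D1)"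
    unfolding K_def Ds by (simp add: algebra_simps)
  also have "\<dots> = ((F0 * G0 + F2 * G1) * D0 + (F2 * G0 + F0 * G2) * D1)
      + ((F1 * G0 + F0 * G1) * D0 + (F0 * G0 + F2 * G1) * D1)" (is "_ = ?A + ?B")
    by (simp add: FD GD)
  finally have KD: "K * alternant 0 = ?A + ?B" .
  have "graded 0 ?A" "graded 1 ?B"
    by (intro graded_add[OF D0m D1m''] graded_add[OF D0m D1m] graded_add p)+
  then have 3: "Poly_Mapping.keys (K * alternant 0) \<subseteq> ?C"
    unfolding KD using keys_add[of ?A ?B] by (auto simp: graded_def)
  have "Poly_Mapping.lookup K \<mu> = (\<Sum>\<kappa>\<in>Poly_Mapping.keys (K * alternant 0) \<inter> dominant.
      Poly_Mapping.lookup (K * alternant 0) \<kappa> * Poly_Mapping.lookup (irr_char \<kappa>) \<mu>)"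
    using arg_cong[OF invariant_expansion[OF K_inv], of "\<lambda>H. Poly_Mapping.lookup H \<mu>"]
    unfolding lookup_sum lookup_frag_cmul .
  also have "\<dots> = (\<Sum>\<kappa> | \<kappa> \<in> dominant \<and> \<kappa> \<in> ?C \<and> Poly_Mapping.lookup (irr_char \<nu> * alternant \<eta>) \<kappa> \<noteq> 0.
      Poly_Mapping.lookup (irr_char \<nu> * alternant \<eta>) \<kappa> * Poly_Mapping.lookup (irr_char \<kappa>) \<mu>)"
    using 2 3 by (intro sum.cong) (auto simp: in_keys_iff)
  finally show ?thesis using 1 by (simp add: G)
qed

section \<open>Labels of the extended affine Weyl group\<close>

text \<open>The class of a weight in \<open>P/Q\<close>, which is cyclic of order three.\<close>

definition congruence_class :: "weight \<Rightarrow> int" where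
  "congruence_class \<mu> = (fst \<mu> - snd \<mu>) mod 3"

definition wclass :: "ext_weyl \<Rightarrow> int" where
  "wclass y = congruence_class (shift y)"

lemma mod_diff_eq_iff:
  fixes x z k n :: int
  assumes "x mod n = x" "z mod n = z"
  shows "(z - k) mod n = x \<longleftrightarrow> z = (x + k) mod n"
proof
  assume "(z - k) mod n = x"
  then have "(x + k) mod n = (z - k + k) mod n" by (metis mod_add_left_eq)
  then show "z = (x + k) mod n" using assms(2) by simp
next
  assume "z = (x + k) mod n"
  then have "(z - k) mod n = (x + k - k) mod n" by (metis mod_diff_left_eq)
  then show "(z - k) mod n = x" using assms(1) by simp
qed

lemma root_lattice_iff: "\<mu> \<in> root_lattice \<longleftrightarrow> congruence_class \<mu> = 0"
proof
  assume "\<mu> \<in> root_lattice"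
  then obtain m n where "\<mu> = wscale m (simple_root 1) + wscale n (simple_root 2)"
    by (auto simp: root_lattice_def)
  then have "fst \<mu> - snd \<mu> = 3 * (m - n)" by (simp add: wscale_def simple_root_def)
  then show "congruence_class \<mu> = 0" by (simp add: congruence_class_def)
next
  assume "congruence_class \<mu> = 0"
  then obtain t where "fst \<mu> - snd \<mu> = 3 * t" by (auto simp: congruence_class_def dvd_def mod_eq_0_iff_dvd)
  then have "\<mu> = wscale (fst \<mu> - t) (simple_root 1) + wscale (fst \<mu> - 2 * t) (simple_root 2)"
    by (simp add: wscale_def simple_root_def prod_eq_iff algebra_simps)
  then show "\<mu> \<in> root_lattice" unfolding root_lattice_def by blast
qed

lemma congruence_class_fin_weyl: "w \<in> fin_weyl \<Longrightarrow> congruence_class (w \<mu>) = congruence_class \<mu>"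
proof (induction rule: fin_weyl.induct)
  case (step w i)
  have "congruence_class (wrefl i \<nu>) = congruence_class \<nu>" for \<nu>
  proof (cases \<nu>)
    case (Pair m n)
    have "(- m - (m + n)) mod 3 = (m - n) mod 3" "(m + n - (- n)) mod 3 = (m - n) mod 3"
      by (simp_all add: mod_eq_dvd_iff)
    with step(2) show ?thesis by (auto simp: Pair congruence_class_def refl_simps)
  qed
  with step show ?case by simp
qed simp

lemma wclass_plus: "wclass (u + v) = (wclass u + wclass v) mod 3"
proof -
  have "congruence_class (inv (hproj v) (shift u) + shift v) =
      (congruence_class (inv (hproj v) (shift u)) + congruence_class (shift v)) mod 3"
    by (simp add: congruence_class_def mod_add_eq algebra_simps)
  then show ?thesis
    by (simp add: wclass_def shift_plus congruence_class_fin_weyl fin_weyl_bij_inv hproj_in_fin_weyl)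
qed

lemma wclass_range: "wclass u mod 3 = wclass u"
  by (simp add: wclass_def congruence_class_def)

lemma wclass_diff: "wclass (u - v) = (wclass u - wclass v) mod 3"
proof -
  have "wclass u = (wclass (u - v) + wclass v) mod 3"
    using wclass_plus[of "u - v" v] by simp
  then have "(wclass u - wclass v) mod 3 = wclass (u - v) mod 3"
    by (simp add: mod_diff_left_eq)
  then show ?thesis by (simp add: wclass_range)
qed

lemma Waff_iff: "u \<in> Waff \<longleftrightarrow> wclass u = 0"
  by (simp add: Waff_def root_lattice_iff wclass_def)

lemma same_Waff_coset: "(\<exists>u\<in>Waff. z = u + x) \<longleftrightarrow> wclass z = wclass x"
proof -
  have "(\<exists>u\<in>Waff. z = u + x) \<longleftrightarrow> z - x \<in> Waff"
    by (metis add_diff_cancel diff_add_cancel)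
  also have "\<dots> \<longleftrightarrow> wclass z = wclass x"
    using mod_diff_eq_iff[OF _ wclass_range[of z], of 0 "wclass x"] by (simp add: Waff_iff wclass_diff wclass_range)
  finally show ?thesis .
qed

lemma iota_alt: "iota y = wscale 3 (shift y) + inv (hproj y) rho - rho"
  by (simp add: iota_def shifted_def)

lemma fin_weyl_diff: "w \<in> fin_weyl \<Longrightarrow> w (\<mu> - \<nu>) = w \<mu> - w \<nu>"
  using fin_weyl_add[of w "\<mu> - \<nu>" \<nu>] by (simp add: algebra_simps)

lemma wscale_3: "wscale 3 \<mu> = \<mu> + \<mu> + \<mu>"
  by (simp add: wscale_def prod_eq_iff)

lemma inv_hproj_in_fin_weyl: "inv (hproj y) \<in> fin_weyl"
  using fin_weyl_bij_inv[OF hproj_in_fin_weyl] by blast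

lemma inv_hproj_inverse: "hproj y (inv (hproj y) \<mu>) = \<mu>" "inv (hproj y) (hproj y \<mu>) = \<mu>"
  using fin_weyl_bij_inv[OF hproj_in_fin_weyl[of y]]
  by (simp_all add: bij_is_surj surj_f_inv_f bij_is_inj)

text \<open>The centre of an alcove behaves in this way: \<open>iota y + rho\<close> is three times the image of \<open>rho / 3\<close>
  under the affine action of the inverse of \<open>y\<close>.\<close>

lemma iota_plus: "iota (u + v) = iota v + inv (hproj v) (iota u)"
proof -
  have "inv (hproj u \<circ> hproj v) = inv (hproj v) \<circ> inv (hproj u)"
    using fin_weyl_bij_inv[OF hproj_in_fin_weyl] by (intro o_inv_distrib) auto
  then show ?thesis
    by (simp add: iota_alt hproj_plus shift_plus wscale_3 fin_weyl_add[OF inv_hproj_in_fin_weyl]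
        fin_weyl_diff[OF inv_hproj_in_fin_weyl])
qed

lemma iota_minus: "iota (u - v) = hproj v (iota u - iota v)"
  using iota_plus[of "u - v" v] inv_hproj_inverse(1)[of v "iota (u - v)"] by simp

lemma inv_hproj_rho_table:
  "(hproj y, inv (hproj y) (1, 1)) \<in>
    {(\<lambda>(a, b). (a, b), (1, 1)), (\<lambda>(a, b). (- a, a + b), (-1, 2)),
     (\<lambda>(a, b). (a + b, - b), (2, -1)), (\<lambda>(a, b). (- a - b, a), (1, -2)),
     (\<lambda>(a, b). (b, - a - b), (-2, 1)), (\<lambda>(a, b). (- b, - a), (-1, -1))}"
  using fin_weyl_table[OF hproj_in_fin_weyl[of y]] by auto

lemma iota_pair:
  assumes "shift y = (c, d)" "inv (hproj y) (1, 1) = p"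
  shows "iota y = (3 * c + fst p - 1, 3 * d + snd p - 1)"
  using assms by (simp add: iota_alt rho_def wscale_def prod_eq_iff)

lemma iota_grade: "iota y \<in> grade 0 \<union> grade 1"
proof -
  obtain c d where cd: "shift y = (c, d)" by fastforce
  define p where "p = inv (hproj y) (1, 1)"
  have "p \<in> {(1, 1), (-1, 2), (2, -1), (1, -2), (-2, 1), (-1, -1)}"
    using inv_hproj_rho_table[of y] by (auto simp: p_def)
  then show ?thesis
    unfolding iota_pair[OF cd p_def[symmetric]] insert_iff empty_iff
    by (elim disjE FalseE; simp add: grade_def; presburger)
qed

text \<open>No element of the affine Weyl group other than the identity fixes the centre of the fundamental
  alcove; the six possible linear parts are inspected.\<close>

lemma iota_eq_0:
  assumes "iota y = 0" "wclass y = 0"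
  shows "y = 0"
proof -
  obtain c d where cd: "shift y = (c, d)" by fastforce
  define p where "p = inv (hproj y) (1, 1)"
  have i: "3 * c + fst p - 1 = 0" "3 * d + snd p - 1 = 0"
    using assms(1) unfolding iota_pair[OF cd p_def[symmetric]] by (simp_all add: zero_prod_def)
  have k: "(c - d) mod 3 = 0" using assms(2) by (simp add: wclass_def congruence_class_def cd)
  have "hproj y = (\<lambda>(a, b). (a, b)) \<and> c = 0 \<and> d = 0"
    using inv_hproj_rho_table[of y, folded p_def] i k
    unfolding insert_iff empty_iff prod.inject by (elim disjE FalseE conjE; simp; presburger)
  then show ?thesis
    by (intro ext_weyl_eqI) (auto simp: hproj_zero shift_zero cd zero_prod_def fun_eq_iff)
qed

lemma iota_inj:
  assumes "iota u = iota v" "wclass u = wclass v"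
  shows "u = v"
proof -
  have "iota (u - v) = 0" using assms(1) fin_weyl_zero[OF hproj_in_fin_weyl] by (simp add: iota_minus)
  moreover have "wclass (u - v) = 0" using assms(2) by (simp add: wclass_diff)
  ultimately have "u - v = 0" by (rule iota_eq_0)
  then show ?thesis by simp
qed

lemma iota_gamma: "iota gamma = 0"
proof -
  have "wrefl 1 \<circ> wrefl 2 \<in> fin_weyl" by (intro fin_weyl_comp refl_in_fin_weyl) auto
  then have "inv (hproj gamma) (1, 1) = (1, -2)"
    unfolding hproj_gamma by (rule fin_weyl_inv_eq) (simp add: refl_simps)
  from iota_pair[OF shift_gamma this] show ?thesis by (simp add: zero_prod_def)
qed

lemma iota_Agrp:
  assumes "a \<in> Agrp"
  shows "iota (a + z) = iota z" "iota (- a + z) = iota z"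
proof -
  have g: "iota (gamma + z) = iota z" for z
    by (simp add: iota_plus iota_gamma fin_weyl_zero[OF inv_hproj_in_fin_weyl])
  then show a: "iota (a + z) = iota z" for z
    using assms by (auto simp: Agrp_def add.assoc)
  show "iota (- a + z) = iota z"
    using a[of "- a + z"] by (simp flip: add.assoc)
qed

lemma wclass_gamma: "wclass gamma = 2"
  by (simp add: wclass_def congruence_class_def shift_gamma)

text \<open>A label \<open>3 \<lambda>\<close> is realized by a translation, and a label \<open>3 \<lambda> + \<rho>\<close> by the longest element
  times a translation.  Left multiplication by \<open>gamma\<close> changes the class and keeps the label.\<close>

lemma iota_surj:
  assumes \<nu>: "\<nu> \<in> grade 0 \<union> grade 1" and c: "c mod 3 = c"
  shows "\<exists>z. iota z = \<nu> \<and> wclass z = c"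
proof -
  obtain z where z: "iota z = \<nu>"
  proof (cases "\<nu> \<in> grade 0")
    case True
    then obtain m n where mn: "\<nu> = (3 * m, 3 * n)"
      by (cases \<nu>) (auto simp: grade_def dvd_def)
    have "iota (transl (- (m, n))) = \<nu>"
      by (simp add: iota_alt shift_transl hproj_transl wscale_def inv_id mn)
    then show ?thesis by (rule that)
  next
    case False
    with \<nu> obtain m n where mn: "\<nu> = (3 * m + 1, 3 * n + 1)"
      by (cases \<nu>) (auto simp: grade_def dvd_def algebra_simps)
    let ?y = "srefl 1 + srefl 2 + srefl 1 + transl (- (m + 1, n + 1))"
    have h: "hproj ?y = wrefl 1 \<circ> wrefl 2 \<circ> wrefl 1"
      by (simp add: hproj_plus hproj_srefl hproj_transl)
    have "inv (hproj ?y) (1, 1) = (- 1, - 1)"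
      by (rule fin_weyl_inv_eq[OF hproj_in_fin_weyl]) (simp only: h, simp add: refl_simps)
    moreover have "shift ?y = (m + 1, n + 1)"
      by (simp add: shift_plus shift_srefl shift_transl fin_weyl_zero[OF inv_hproj_in_fin_weyl] inv_id hproj_transl)
    ultimately have "iota ?y = \<nu>" by (subst iota_pair) (auto simp: mn)
    then show ?thesis by (rule that)
  qed
  have g1: "iota (gamma + z) = \<nu>" and g2: "iota (gamma + (gamma + z)) = \<nu>"
    using z by (simp_all add: iota_Agrp(1)[of gamma] Agrp_def)
  have w: "wclass (gamma + z) = (2 + wclass z) mod 3" "wclass (gamma + (gamma + z)) = (2 + (2 + wclass z) mod 3) mod 3"
    by (simp_all add: wclass_plus wclass_gamma)
  have "wclass z = c \<or> wclass (gamma + z) = c \<or> wclass (gamma + (gamma + z)) = c"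
  proof -
    have "m \<in> {0, 1, 2}" if "m mod 3 = m" for m :: int
      using that pos_mod_bound[of 3 m] pos_mod_sign[of 3 m] by (simp, linarith)
    then have "c \<in> {0, 1, 2}" "wclass z \<in> {0, 1, 2}" using c wclass_range by blast+
    then show ?thesis unfolding w by auto
  qed
  then show ?thesis using z g1 g2 by blast
qed

text \<open>Both sides say that the image of the fundamental alcove under the inverse of \<open>y\<close> lies in the dominant
  chamber.\<close>

lemma Wtilde_plus_iff: "y \<in> Wtilde_plus \<longleftrightarrow> iota y \<in> dominant"
proof
  assume dom: "iota y \<in> dominant"
  obtain c d where cd: "shift y = (c, d)" by fastforce
  define w p where "w = hproj y" and "p = inv (hproj y) (1, 1)"
  have i: "3 * c + fst p - 1 \<ge> 0" "3 * d + snd p - 1 \<ge> 0"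
    using dom unfolding iota_pair[OF cd p_def[symmetric]] by (simp_all add: dominant_def pairing_def)
  have "c \<ge> 0 \<and> d \<ge> 0 \<and> (w (2, -1) \<in> negative_roots \<longrightarrow> c > 0) \<and> (w (-1, 2) \<in> negative_roots \<longrightarrow> d > 0)"
    using inv_hproj_rho_table[of y, folded p_def w_def] i
    unfolding insert_iff empty_iff prod.inject
    by (elim disjE FalseE conjE) (simp_all add: negative_roots_def simple_root_def)
  then show "y \<in> Wtilde_plus"
    by (auto simp: Wtilde_plus_def dominant_def pairing_def simple_root_def cd w_def)
qed (rule iota_dominant)

lemma Wplus_coset_iff:
  assumes "a \<in> Agrp"
  shows "z \<in> Wplus_coset a \<longleftrightarrow> iota z \<in> dominant \<and> wclass z = wclass a"
proof -
  have "z \<in> Wplus_coset a \<longleftrightarrow> - a + z \<in> Wplus"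
    unfolding Wplus_coset_def by (auto simp: add.assoc[symmetric]) (metis add.assoc add.left_neutral add.right_inverse)
  also have "\<dots> \<longleftrightarrow> iota z \<in> dominant \<and> wclass (- a + z) = 0"
    by (simp add: Wplus_def Wtilde_plus_iff iota_Agrp[OF assms] Waff_iff)
  also have "wclass (- a + z) = 0 \<longleftrightarrow> wclass z = wclass a"
  proof -
    have "wclass z = (wclass a + wclass (- a + z)) mod 3"
      using wclass_plus[of a "- a + z"] by (simp flip: add.assoc)
    then show ?thesis
      using mod_diff_eq_iff[OF wclass_range[of "- a + z"] wclass_range[of a], of "wclass a"]
      by (auto simp: add.commute)
  qed
  finally show ?thesis .
qed

lemma Agrp_plus: "a \<in> Agrp \<Longrightarrow> a' \<in> Agrp \<Longrightarrow> a + a' \<in> Agrp"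
  using gamma_cubed by (auto simp: Agrp_def add.assoc)

section \<open>Products of characters\<close>

lemma coeff_m_eq:
  assumes "iota x \<in> dominant"
  shows "coeff_m x z = (if wclass z = wclass x then Poly_Mapping.lookup (irr_char (iota x)) (iota z) else 0)"
  by (simp add: coeff_m_def same_Waff_coset lookup_irr_char[OF assms])

lemma finite_coeff_m:
  assumes "iota x \<in> dominant"
  shows "finite {z. coeff_m x z \<noteq> 0}"
proof (rule inj_on_finite)
  show "inj_on iota {z. coeff_m x z \<noteq> 0}"
    by (rule inj_onI, rule iota_inj) (auto simp: coeff_m_eq[OF assms] split: if_splits)
  show "iota ` {z. coeff_m x z \<noteq> 0} \<subseteq> Poly_Mapping.keys (irr_char (iota x))"
    by (auto simp: coeff_m_eq[OF assms] in_keys_iff split: if_splits)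
qed simp

lemma lookup_chi_char:
  assumes "iota x \<in> dominant"
  shows "Poly_Mapping.lookup (chi_char x) z = coeff_m x z"
  unfolding chi_char_def lookup_sum lookup_single
  using finite_coeff_m[OF assms] by (auto simp: when_def)

lemma invariant_fin_weyl:
  assumes "weyl_invariant F" "w \<in> fin_weyl"
  shows "Poly_Mapping.lookup F (w \<mu>) = Poly_Mapping.lookup F \<mu>"
  using assms(2)
proof (induction rule: fin_weyl.induct)
  case (step w i)
  then show ?case using assms(1) unfolding weyl_invariant_def o_apply by metis
qed simp

text \<open>The label of \<open>z - k\<close> is in the Weyl orbit of \<open>iota z - iota k\<close>, so its multiplicity is a coefficient of
  the ordinary character.  The elements \<open>k\<close> of a coset run through the labels, which are the weights of
  grade \<open>0\<close> and \<open>1\<close>, whence the truncation of the second factor.\<close>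

lemma lookup_chi_char_mult:
  assumes x: "iota x \<in> dominant" and y: "iota y \<in> dominant"
  shows "Poly_Mapping.lookup (chi_char x * chi_char y) z =
    (if wclass z = wclass (x + y) then Poly_Mapping.lookup (irr_char (iota x) *
       (grade_part 0 (irr_char (iota y)) + grade_part 1 (irr_char (iota y)))) (iota z) else 0)"
proof -
  let ?F = "irr_char (iota x)" and ?G = "irr_char (iota y)"
  let ?H = "grade_part 0 ?G + grade_part 1 ?G"
  let ?S = "Poly_Mapping.keys (chi_char y)"
  have H: "Poly_Mapping.lookup ?H \<mu> = (if \<mu> \<in> grade 0 \<union> grade 1 then Poly_Mapping.lookup ?G \<mu> else 0)" for \<mu>
    using grade_unique[of \<mu> 0 1] by (auto simp: lookup_add lookup_grade_part)
  have S: "k \<in> ?S \<longleftrightarrow> wclass k = wclass y \<and> iota k \<in> Poly_Mapping.keys ?H" for k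
    using iota_grade[of k] by (auto simp: in_keys_iff lookup_chi_char[OF y] coeff_m_eq[OF y] H)
  have inj: "inj_on iota ?S"
    by (rule inj_onI, rule iota_inj) (auto simp: S)
  have img: "iota ` ?S = Poly_Mapping.keys ?H"
  proof
    show "Poly_Mapping.keys ?H \<subseteq> iota ` ?S"
    proof
      fix \<kappa> assume k: "\<kappa> \<in> Poly_Mapping.keys ?H"
      then have "\<kappa> \<in> grade 0 \<union> grade 1" by (auto simp: in_keys_iff H split: if_splits)
      then obtain z where "iota z = \<kappa>" "wclass z = wclass y"
        using iota_surj[OF _ wclass_range[of y]] by blast
      with k show "\<kappa> \<in> iota ` ?S" by (intro rev_image_eqI[of z]) (auto simp: S)
    qed
  qed (auto simp: S)
  have cl: "wclass (z - k) = wclass x \<longleftrightarrow> wclass z = wclass (x + y)" if "k \<in> ?S" for k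
  proof -
    have "wclass k = wclass y" using that S by blast
    then show ?thesis
      unfolding wclass_diff wclass_plus using mod_diff_eq_iff[OF wclass_range wclass_range] by simp
  qed
  have "Poly_Mapping.lookup (chi_char x * chi_char y) z = (\<Sum>k\<in>?S. coeff_m x (z - k) * coeff_m y k)"
    by (subst lookup_mult_group[of ?S]) (simp_all add: lookup_chi_char x y)
  also have "\<dots> = (if wclass z = wclass (x + y) then
      (\<Sum>k\<in>?S. Poly_Mapping.lookup ?F (iota z - iota k) * Poly_Mapping.lookup ?H (iota k)) else 0)"
  proof -
    have "coeff_m x (z - k) * coeff_m y k = (if wclass z = wclass (x + y) then
        Poly_Mapping.lookup ?F (iota z - iota k) * Poly_Mapping.lookup ?H (iota k) else 0)" if k: "k \<in> ?S" for k
    proof -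
      have "coeff_m y k = Poly_Mapping.lookup ?H (iota k)"
        using k iota_grade[of k] by (auto simp: S coeff_m_eq[OF y] H)
      moreover have "coeff_m x (z - k) = (if wclass z = wclass (x + y) then
          Poly_Mapping.lookup ?F (iota z - iota k) else 0)"
        using cl[OF k] by (simp add: coeff_m_eq[OF x] iota_minus
            invariant_fin_weyl[OF irr_char_invariant[OF x] hproj_in_fin_weyl])
      ultimately show ?thesis by simp
    qed
    then show ?thesis by simp
  qed
  also have "(\<Sum>k\<in>?S. Poly_Mapping.lookup ?F (iota z - iota k) * Poly_Mapping.lookup ?H (iota k)) =
      (\<Sum>\<kappa>\<in>Poly_Mapping.keys ?H. Poly_Mapping.lookup ?F (iota z - \<kappa>) * Poly_Mapping.lookup ?H \<kappa>)"
    unfolding img[symmetric] by (simp add: sum.reindex[OF inj])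
  also have "\<dots> = Poly_Mapping.lookup (?F * ?H) (iota z)"
    by (rule lookup_mult_group[symmetric]) auto
  finally show ?thesis .
qed

lemma hproj_Wbar: "bij_betw hproj Wbar fin_weyl"
  unfolding bij_betw_def
proof
  show "inj_on hproj Wbar"
    by (rule inj_onI, rule ext_weyl_eqI) (auto simp: Wbar_def)
  have "w \<in> hproj ` Wbar" if "w \<in> fin_weyl" for w
    using that
  proof (induction rule: fin_weyl.induct)
    case id
    show ?case by (rule rev_image_eqI[of 0]) (simp_all add: Wbar_def shift_zero hproj_zero)
  next
    case (step w i)
    then obtain u where "u \<in> Wbar" "w = hproj u" by blast
    with step(2) show ?case
      by (intro rev_image_eqI[of "srefl i + u"])
        (simp_all add: Wbar_def shift_plus shift_srefl fin_weyl_zero[OF inv_hproj_in_fin_weyl] hproj_plus hproj_srefl)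
  qed
  then show "hproj ` Wbar = fin_weyl" using hproj_in_fin_weyl by blast
qed

lemma fusion_eq_sum_Wbar:
  "fusion x y z = (\<Sum>w\<in>Wbar. wdet (hproj w) * coeff_m x (z + w - y))"
proof -
  have "inj_on (\<lambda>w. z + w - z) Wbar"
    by (rule inj_onI) (simp add: diff_eq_eq)
  moreover have "KW_group z = (\<lambda>w. z + w - z) ` Wbar" by (auto simp: KW_group_def)
  ultimately have "fusion x y z = (\<Sum>w\<in>Wbar. wdet (hproj (z + w - z)) * coeff_m x (z + w - z + z - y))"
    by (simp add: fusion_def sum.reindex)
  also have "\<dots> = (\<Sum>w\<in>Wbar. wdet (hproj w) * coeff_m x (z + w - y))"
  proof (rule sum.cong[OF refl])
    fix w
    have "hproj (z + w - z) \<circ> hproj z = hproj z \<circ> hproj w"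
      by (simp flip: hproj_plus)
    then have "wdet (hproj (z + w - z)) * wdet (hproj z) = wdet (hproj z) * wdet (hproj w)"
      by (metis wdet_comp hproj_in_fin_weyl)
    then have "wdet (hproj (z + w - z)) = wdet (hproj w)"
      using wdet_inv[OF hproj_in_fin_weyl[of z]] by (metis mult.commute mult_cancel_right mult_zero_left zero_neq_one)
    then show "wdet (hproj (z + w - z)) * coeff_m x (z + w - z + z - y) = wdet (hproj w) * coeff_m x (z + w - y)"
      by simp
  qed
  finally show ?thesis .
qed

lemma wclass_fusion_argument:
  assumes "w \<in> Wbar" "wclass z = wclass (x + y)"
  shows "wclass (z + w - y) = wclass x"
proof -
  have "wclass w = 0" using assms(1) by (simp add: wclass_def Wbar_def congruence_class_def)
  then show ?thesis
    using assms(2) mod_diff_eq_iff[OF wclass_range[of x] wclass_range[of z], of "wclass y"]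
    by (simp add: wclass_diff wclass_plus[of z] wclass_plus[of x] wclass_range)
qed

text \<open>For \<open>w \<in> Wbar\<close>, the label of \<open>z + w - y\<close> lies in the Weyl orbit of the difference between the label of
  \<open>z\<close> and the shifted image of the label of \<open>y\<close>; so the sum over \<open>w\<close> is a coefficient of a product with
  an alternant.\<close>

lemma fusion_eq_lookup:
  assumes x: "iota x \<in> dominant" and z: "wclass z = wclass (x + y)"
  shows "fusion x y z = Poly_Mapping.lookup (irr_char (iota x) * alternant (iota y)) (iota z)"
proof -
  let ?F = "irr_char (iota x)"
  have "coeff_m x (z + w - y) = Poly_Mapping.lookup ?F (iota z - shifted (hproj w) (iota y))" if w: "w \<in> Wbar" for w
  proof -
    have "iota w = inv (hproj w) rho - rho"
      using w by (simp add: iota_alt Wbar_def wscale_def zero_prod_def)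
    then have "iota (z + w) - iota y = inv (hproj w) (iota z - shifted (hproj w) (iota y))"
      unfolding iota_plus shifted_def
      by (simp add: fin_weyl_diff[OF inv_hproj_in_fin_weyl] fin_weyl_add[OF inv_hproj_in_fin_weyl] inv_hproj_inverse)
    then show ?thesis
      using wclass_fusion_argument[OF w z]
      by (simp add: coeff_m_eq[OF x] iota_minus invariant_fin_weyl[OF irr_char_invariant[OF x]]
          hproj_in_fin_weyl inv_hproj_in_fin_weyl)
  qed
  then have "fusion x y z = (\<Sum>w\<in>Wbar. wdet (hproj w) * Poly_Mapping.lookup ?F (iota z - shifted (hproj w) (iota y)))"
    unfolding fusion_eq_sum_Wbar by simp
  also have "\<dots> = (\<Sum>w\<in>fin_weyl. wdet w * Poly_Mapping.lookup ?F (iota z - shifted w (iota y)))"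
    by (rule sum.reindex_bij_betw[OF hproj_Wbar])
  also have "\<dots> = Poly_Mapping.lookup (?F * alternant (iota y)) (iota z)"
    by (simp add: alternant_def sum_distrib_left lookup_sum lookup_mult_single mult.commute)
  finally show ?thesis .
qed

theorem proposition4p5:
  fixes a a' x y :: ext_weyl
  assumes "a \<in> Agrp" and "a' \<in> Agrp"
    and "x \<in> Wplus_coset a" and "y \<in> Wplus_coset a'"
  shows "finite {z \<in> Wplus_coset (a + a'). fusion x y z \<noteq> 0} \<and>
    chi_char x * chi_char y =
      (\<Sum>z | z \<in> Wplus_coset (a + a') \<and> fusion x y z \<noteq> 0. frag_cmul (fusion x y z) (chi_char z)) \<and>
    (\<forall>z \<in> Wplus_coset (a + a').
       fusion x y z = (\<Sum>w\<in>Wbar. wdet (hproj w) * coeff_m x (z + w - y)) \<and>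
       (\<Sum>w\<in>Wbar. wdet (hproj w) * coeff_m x (z + w - y)) =
         (\<Sum>w\<in>Wbar. wdet (hproj w) * int (mbar (iota x) (iota (z + w - y)))))"
proof -
  have x: "iota x \<in> dominant" "wclass x = wclass a" and y: "iota y \<in> dominant" "wclass y = wclass a'"
    using assms by (simp_all add: Wplus_coset_iff)
  let ?C = "{z \<in> Wplus_coset (a + a'). fusion x y z \<noteq> 0}"
  let ?N = "irr_char (iota x) * alternant (iota y)"
  let ?K = "{\<kappa>. \<kappa> \<in> dominant \<and> \<kappa> \<in> grade 0 \<union> grade 1 \<and> Poly_Mapping.lookup ?N \<kappa> \<noteq> 0}"
  have coset: "z \<in> Wplus_coset (a + a') \<longleftrightarrow> iota z \<in> dominant \<and> wclass z = wclass (x + y)" for z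
    using x y Agrp_plus[OF assms(1,2)] by (simp add: Wplus_coset_iff wclass_plus)
  have C: "z \<in> ?C \<longleftrightarrow> iota z \<in> ?K \<and> wclass z = wclass (x + y)" for z
    using fusion_eq_lookup[OF x(1), of z y] iota_grade[of z] by (auto simp: coset)
  have bij: "bij_betw iota ?C ?K"
    unfolding bij_betw_def
  proof
    show "inj_on iota ?C"
      by (rule inj_onI, rule iota_inj) (auto simp: coset)
    show "iota ` ?C = ?K"
    proof
      show "iota ` ?C \<subseteq> ?K" using C by blast
      show "?K \<subseteq> iota ` ?C"
      proof
        fix \<kappa> assume \<kappa>: "\<kappa> \<in> ?K"
        then obtain z where "iota z = \<kappa>" "wclass z = wclass (x + y)"
          using iota_surj[OF _ wclass_range[of "x + y"]] by blast
        with \<kappa> C show "\<kappa> \<in> iota ` ?C" by blast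
      qed
    qed
  qed
  have finK: "finite ?K"
    by (rule finite_subset[of _ "Poly_Mapping.keys ?N"]) (auto simp: in_keys_iff)
  then have finC: "finite ?C" using bij_betw_finite[OF bij] by blast
  have "chi_char x * chi_char y = (\<Sum>z\<in>?C. frag_cmul (fusion x y z) (chi_char z))"
  proof (rule poly_mapping_eqI)
    fix z
    have "Poly_Mapping.lookup (\<Sum>v\<in>?C. frag_cmul (fusion x y v) (chi_char v)) z =
        (\<Sum>v\<in>?C. if wclass z = wclass (x + y) then
          Poly_Mapping.lookup ?N (iota v) * Poly_Mapping.lookup (irr_char (iota v)) (iota z) else 0)"
      unfolding lookup_sum lookup_frag_cmul
    proof (rule sum.cong[OF refl])
      fix v assume "v \<in> ?C"
      then have v: "iota v \<in> dominant" "wclass v = wclass (x + y)" using C by auto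
      then show "fusion x y v * Poly_Mapping.lookup (chi_char v) z = (if wclass z = wclass (x + y) then
          Poly_Mapping.lookup ?N (iota v) * Poly_Mapping.lookup (irr_char (iota v)) (iota z) else 0)"
        by (simp add: lookup_chi_char coeff_m_eq fusion_eq_lookup[OF x(1)])
    qed
    also have "\<dots> = (if wclass z = wclass (x + y) then
        (\<Sum>v\<in>?C. Poly_Mapping.lookup ?N (iota v) * Poly_Mapping.lookup (irr_char (iota v)) (iota z)) else 0)"
      by simp
    also have "(\<Sum>v\<in>?C. Poly_Mapping.lookup ?N (iota v) * Poly_Mapping.lookup (irr_char (iota v)) (iota z)) =
        (\<Sum>\<kappa>\<in>?K. Poly_Mapping.lookup ?N \<kappa> * Poly_Mapping.lookup (irr_char \<kappa>) (iota z))"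
      by (rule sum.reindex_bij_betw[OF bij])
    also have "\<dots> = Poly_Mapping.lookup (irr_char (iota x) *
        (grade_part 0 (irr_char (iota y)) + grade_part 1 (irr_char (iota y)))) (iota z)"
      by (rule truncated_product[OF x(1) iota_grade y(1) iota_grade iota_grade, symmetric])
    finally show "Poly_Mapping.lookup (chi_char x * chi_char y) z =
        Poly_Mapping.lookup (\<Sum>v\<in>?C. frag_cmul (fusion x y v) (chi_char v)) z"
      unfolding lookup_chi_char_mult[OF x(1) y(1)] by simp
  qed
  moreover have "(\<Sum>w\<in>Wbar. wdet (hproj w) * coeff_m x (z + w - y)) =
      (\<Sum>w\<in>Wbar. wdet (hproj w) * int (mbar (iota x) (iota (z + w - y))))" if "z \<in> Wplus_coset (a + a')" for z
    using that wclass_fusion_argument[of _ z x y]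
    by (intro sum.cong) (auto simp: coset coeff_m_def same_Waff_coset)
  ultimately show ?thesis
    using finC fusion_eq_sum_Wbar by blast
qed

end
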